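(* Let $G$ be a finite group. The following are equivalent: (1) The Radon transform $R$ is injective on $G$. (2) $k(\rho)=0$ for all $\rho\in\hat G$. (3) $FPF(G)=\emptyset$. (4) $G$ is not a Frobenius complement.
   Context: For $n\ge 2$ let $C_n$ be the cyclic group of order $n$, and let $\Gamma_n$ be the set of nontrivial homomorphisms $C_n\to G$. For $f:G\to\mathbb{C}$, $x\in G$ and $\gamma\in\Gamma_n$ put $R_nf(x,\gamma)=\sum_{t\in C_n}f(x\gamma(t))$. The Radon transform is $Rf=(R_nf)_{n\ge2}$; it is injective on $G$ if the only $f:G\to\mathbb{C}$ with $R_nf=0$ for all $n\ge2$ is $f=0$. $\hat G$ denotes a set containing exactly one representative of each equivalence class of irreducible complex representations of $G$; each $\rho\in\hat G$ is finite dimensional, has representation space $\mathbb{C}^{\dim(\rho)}$, and is taken unitary with respect to the standard inner product. For $\rho\in\hat G$ and $\gamma\in\Gamma_n$ let $I(\rho,\gamma)=\sum_{t\in C_n}\rho(\gamma(t))$, a linear map $\mathbb{C}^{\dim(\rho)}\to\mathbb{C}^{\dim(\rho)}$, and let $$k(\rho)=\bigcap_{p\mid |G|}\ \bigcap_{\gamma\in\Gamma_p}\ker(I(\rho,\gamma)),$$ the outer intersection being over all primes $p$ dividing $|G|$. For a representation $\rho:G\to GL(V)$ let $F_\rho=\{v\in V:\rho(x)v=v\text{ for some }x\in G\setminus\{e\}\}$, where $e$ is the identity of $G$, and let $FPF(G)=\{\rho\in\hat G: F_\rho=\{0\}\}$. A finite group is a Frobenius complement if it is isomorphic to a point stabilizer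 of a finite Frobenius group, i.e. of a transitive permutation group on a finite set in which no nonidentity element fixes more than one point and some nonidentity element fixes a point.
   Formalization: The finite group G is additionally assumed nontrivial; for the trivial group (1) and (2) fail while (3) and (4) hold, so the equivalence as stated is false there. *)

theory Defs
  imports
    "HOL-Algebra.Elementary_Groups"
    "HOL-Algebra.Group_Action"
    "Jordan_Normal_Form.Matrix_Kernel"
begin

subsection \<open>The Radon transform\<close>

text \<open>The cyclic group \<open>C\<^sub>n\<close> is \<open>integer_mod_group n\<close>. Members of \<open>hom\<close> are functions on the whole
  type, so \<open>Gamma\<close> may contain several functions that agree on \<open>C\<^sub>n\<close>; below it is only quantified
  over or intersected over, and only values on \<open>C\<^sub>n\<close> are used.\<close>

definition Gamma :: "('a, 'b) monoid_scheme \<Rightarrow> nat \<Rightarrow> (int \<Rightarrow> 'a) set" where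
  "Gamma G n = {\<gamma> \<in> hom (integer_mod_group n) G.
     \<exists>t \<in> carrier (integer_mod_group n). \<gamma> t \<noteq> \<one>\<^bsub>G\<^esub>}"

definition radon ::
  "('a, 'b) monoid_scheme \<Rightarrow> nat \<Rightarrow> ('a \<Rightarrow> complex) \<Rightarrow> 'a \<Rightarrow> (int \<Rightarrow> 'a) \<Rightarrow> complex" where
  "radon G n f x \<gamma> = (\<Sum>t \<in> carrier (integer_mod_group n). f (x \<otimes>\<^bsub>G\<^esub> \<gamma> t))"

definition radon_injective :: "('a, 'b) monoid_scheme \<Rightarrow> bool" where
  "radon_injective G \<longleftrightarrow>
     (\<forall>f. (\<forall>n\<ge>2. \<forall>x \<in> carrier G. \<forall>\<gamma> \<in> Gamma G n. radon G n f x \<gamma> = 0)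
        \<longrightarrow> (\<forall>x \<in> carrier G. f x = 0))"

subsection \<open>Complex matrix representations\<close>

text \<open>A representation on \<open>\<complex>\<^sup>d\<close> is a homomorphism into the general linear group; \<open>d\<close> is read off from
  the size of the matrix at the identity.\<close>

abbreviation GL :: "nat \<Rightarrow> complex mat monoid" where
  "GL d \<equiv> units_of (ring_mat TYPE(complex) d ())"

definition deg :: "('a, 'b) monoid_scheme \<Rightarrow> ('a \<Rightarrow> complex mat) \<Rightarrow> nat" where
  "deg G \<rho> = dim_row (\<rho> \<one>\<^bsub>G\<^esub>)"

definition representation :: "('a, 'b) monoid_scheme \<Rightarrow> ('a \<Rightarrow> complex mat) \<Rightarrow> bool" where
  "representation G \<rho> \<longleftrightarrow> \<rho> \<in> hom G (GL (deg G \<rho>))"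

definition irreducible_rep :: "('a, 'b) monoid_scheme \<Rightarrow> ('a \<Rightarrow> complex mat) \<Rightarrow> bool" where
  "irreducible_rep G \<rho> \<longleftrightarrow> representation G \<rho> \<and> deg G \<rho> \<noteq> 0 \<and>
     (\<forall>W. subspace class_ring W (module_vec TYPE(complex) (deg G \<rho>)) \<and>
          (\<forall>x \<in> carrier G. \<forall>w \<in> W. \<rho> x *\<^sub>v w \<in> W)
        \<longrightarrow> W = {0\<^sub>v (deg G \<rho>)} \<or> W = carrier_vec (deg G \<rho>))"

definition unitary_rep :: "('a, 'b) monoid_scheme \<Rightarrow> ('a \<Rightarrow> complex mat) \<Rightarrow> bool" where
  "unitary_rep G \<rho> \<longleftrightarrow> representation G \<rho> \<and>
     (\<forall>x \<in> carrier G. \<forall>v \<in> carrier_vec (deg G \<rho>). \<forall>w \<in> carrier_vec (deg G \<rho>).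
        (\<rho> x *\<^sub>v v) \<bullet>c (\<rho> x *\<^sub>v w) = v \<bullet>c w)"

definition equivalent_rep ::
  "('a, 'b) monoid_scheme \<Rightarrow> ('a \<Rightarrow> complex mat) \<Rightarrow> ('a \<Rightarrow> complex mat) \<Rightarrow> bool" where
  "equivalent_rep G \<rho> \<sigma> \<longleftrightarrow> deg G \<rho> = deg G \<sigma> \<and>
     (\<exists>T \<in> carrier (GL (deg G \<rho>)). \<forall>x \<in> carrier G. T * \<rho> x = \<sigma> x * T)"

text \<open>The set of representatives is a choice, so it appears as a parameter \<open>Gh\<close> rather than as a
  function of the group.\<close>

definition unitary_dual :: "('a, 'b) monoid_scheme \<Rightarrow> ('a \<Rightarrow> complex mat) set \<Rightarrow> bool" where
  "unitary_dual G Gh \<longleftrightarrow>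
     (\<forall>\<rho> \<in> Gh. irreducible_rep G \<rho> \<and> unitary_rep G \<rho>) \<and>
     (\<forall>\<sigma>. irreducible_rep G \<sigma> \<longrightarrow> (\<exists>!\<rho>. \<rho> \<in> Gh \<and> equivalent_rep G \<sigma> \<rho>))"

definition I_op ::
  "('a, 'b) monoid_scheme \<Rightarrow> ('a \<Rightarrow> complex mat) \<Rightarrow> nat \<Rightarrow> (int \<Rightarrow> 'a) \<Rightarrow> complex mat" where
  "I_op G \<rho> n \<gamma> =
     finsum (ring_mat TYPE(complex) (deg G \<rho>) ()) (\<lambda>t. \<rho> (\<gamma> t)) (carrier (integer_mod_group n))"

text \<open>The intersection with \<open>carrier_vec\<close> makes the empty intersection the whole of \<open>\<complex>\<^sup>d\<close>.\<close>

definition k_space :: "('a, 'b) monoid_scheme \<Rightarrow> ('a \<Rightarrow> complex mat) \<Rightarrow> complex vec set" where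
  "k_space G \<rho> = carrier_vec (deg G \<rho>) \<inter>
     (\<Inter>p \<in> {p. Factorial_Ring.prime p \<and> p dvd Coset.order G}. \<Inter>\<gamma> \<in> Gamma G p. mat_kernel (I_op G \<rho> p \<gamma>))"

definition F_space :: "('a, 'b) monoid_scheme \<Rightarrow> ('a \<Rightarrow> complex mat) \<Rightarrow> complex vec set" where
  "F_space G \<rho> =
     {v \<in> carrier_vec (deg G \<rho>). \<exists>x \<in> carrier G - {\<one>\<^bsub>G\<^esub>}. \<rho> x *\<^sub>v v = v}"

definition FPF ::
  "('a, 'b) monoid_scheme \<Rightarrow> ('a \<Rightarrow> complex mat) set \<Rightarrow> ('a \<Rightarrow> complex mat) set" where
  "FPF G Gh = {\<rho> \<in> Gh. F_space G \<rho> = {0\<^sub>v (deg G \<rho>)}}"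

subsection \<open>Frobenius complements\<close>

definition frobenius_perm_group :: "'c set \<Rightarrow> ('c \<Rightarrow> 'c) set \<Rightarrow> bool" where
  "frobenius_perm_group X H \<longleftrightarrow>
     finite X \<and> subgroup H (BijGroup X) \<and>
     transitive_action ((BijGroup X)\<lparr>carrier := H\<rparr>) X (\<lambda>h. h) \<and>
     (\<forall>h \<in> H. h \<noteq> \<one>\<^bsub>BijGroup X\<^esub> \<longrightarrow> (\<forall>x \<in> X. \<forall>y \<in> X. h x = x \<and> h y = y \<longrightarrow> x = y)) \<and>
     (\<exists>h \<in> H. h \<noteq> \<one>\<^bsub>BijGroup X\<^esub> \<and> (\<exists>x \<in> X. h x = x))"

text \<open>Taking \<open>X\<close> to be a set of natural numbers is no restriction, since every finite set is in
  bijection with one and permutation groups transport along bijections.\<close>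

definition frobenius_complement :: "('a, 'b) monoid_scheme \<Rightarrow> bool" where
  "frobenius_complement G \<longleftrightarrow>
     (\<exists>(X :: nat set) H. frobenius_perm_group X H \<and>
        (\<exists>x \<in> X. G \<cong> (BijGroup X)\<lparr>carrier := stabilizer ((BijGroup X)\<lparr>carrier := H\<rparr>) (\<lambda>h. h) x\<rparr>))"

end

theory Submission
  imports
    Defs
    "HOL-Library.Poly_Mapping"
    "HOL-Computational_Algebra.Fundamental_Theorem_Algebra"
    "HOL-Algebra.Sylow"
    "HOL-Algebra.Multiplicative_Group"
begin

text \<open>
  The group \<open>G\<close> is realised as a finite subgroup \<open>S\<close> of an additively written group, and functions
  on \<open>G\<close> become elements of the group algebra \<open>\<complex>[S]\<close>. Write \<open>\<sigma>\<^sub>C\<close> for the sum of the elements of a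
  subgroup \<open>C\<close>. Under \<open>h(x) = f(x\<^sup>-\<^sup>1)\<close> the functions annihilated by the Radon transform become the
  \<open>h\<close> with \<open>\<sigma>\<^sub>C h = 0\<close> for every nontrivial subgroup \<open>C\<close>; they form the Radon kernel, a left ideal, and
  injectivity of the transform says that it is zero (\<open>radon_injective_iff\<close>). The group acts on the
  Radon kernel without fixed points: if a nontrivial subgroup \<open>C\<close> fixes \<open>h\<close>, then
  \<open>|C| h = \<sigma>\<^sub>C h = 0\<close>.

  Irreducible representations detect the Radon kernel. A nonzero \<open>v\<close> in \<open>k(\<rho>)\<close> has a nonzero matrix coefficient \<open>x \<mapsto> (\<rho>(x) v)\<^sub>i\<close>, which the
  Radon transform annihilates (\<open>k_space_not_radon_injective\<close>). If \<open>\<rho>\<close> is fixed-point-free, then every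
  \<open>I(\<rho>, \<gamma>)\<close> vanishes, since its values are fixed by the image of \<open>\<gamma>\<close>, and \<open>k(\<rho>)\<close> is the whole space
  (\<open>fixed_point_free_k_space\<close>). If the Radon kernel is nonzero, it contains a primitive idempotent
  \<open>E\<close>, and the minimal left ideal \<open>\<complex>[S] E\<close> affords an irreducible fixed-point-free representation
  (\<open>fixed_point_free_irreducible_exists\<close>). This settles the equivalence of the first three conditions.

  A nonzero Radon kernel makes \<open>G\<close> a Frobenius complement. The \<open>\<sigma>\<^sub>C\<close> have integer coefficients, so a nonzero complex
  Radon kernel yields a nonzero integral one, and reducing it modulo a large prime \<open>p\<close> gives a finite
  module \<open>M\<close> on which \<open>S\<close> acts without fixed points. The affine maps \<open>m \<mapsto> x m + c\<close> of \<open>M\<close> form a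
  Frobenius group in which the stabilizer of \<open>0\<close> is isomorphic to \<open>G\<close>
  (\<open>frobenius_complement_of_not_radon_injective\<close>).

  That Frobenius complements have a nonzero Radon kernel is the deepest part. Let \<open>G\<close> be a point stabilizer in the Frobenius group \<open>H\<close>.
  By Frobenius' theorem (\<open>frobenius_kernel_subgroup\<close>) the elements of \<open>H\<close> with no nonidentity
  conjugate in \<open>G\<close> form a subgroup \<open>K\<close>. Some Sylow subgroup \<open>P\<close> of \<open>K\<close> is normalised by \<open>G\<close>, and the
  elements of its centre annihilated by \<open>p\<close> form a nonzero elementary abelian \<open>p\<close>-group \<open>A\<close>, with \<open>p\<close> prime
  to \<open>|G|\<close>, on which \<open>G\<close> acts without fixed points (\<open>frobenius_elementary_abelian_subgroup\<close>). Every
  \<open>\<sigma>\<^sub>C\<close> annihilates \<open>A\<close>. If the Radon kernel were zero, Maschke's theorem would put a nonzero integer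
  into the left ideal \<open>J\<close> of \<open>\<int>[G]\<close> generated by the \<open>\<sigma>\<^sub>C\<close> (\<open>radon_kernel_or_scalar\<close>), and because \<open>p\<close>
  does not divide \<open>|G|\<close>, a lifting argument would produce an integer \<open>E\<close> prime to \<open>p\<close> in
  \<open>J + p \<int>[G]\<close> (\<open>scalar_mod_prime\<close>). Then \<open>E\<close> and \<open>p\<close> both annihilate \<open>A\<close>, so \<open>A = 0\<close>
  (\<open>fixed_point_free_module_trivial\<close>), a contradiction.

  Frobenius' theorem is proved inside group algebras: primitive idempotents play the part of
  irreducible characters, and the trace form \<open>pairing\<close> that of the inner product of characters.
\<close>

(* These names stand for the degree of a representation and for ordinary polynomials. *)
hide_const (open) UnivPoly.deg up_ring.coeff up_ring.monom

section \<open>Group algebras of finite subgroups\<close>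

text \<open>Finitely supported functions on a group type form a ring under convolution. A group
  algebra is carved out of it as the set \<open>galg S\<close> of the elements supported in a finite
  subgroup \<open>S\<close>, so that the algebras of a group and of its subgroups lie in one ring.
  As the group is written additively, \<open>sc c\<close> is the scalar \<open>c\<close>.\<close>

abbreviation cf :: "('g \<Rightarrow>\<^sub>0 'k::zero) \<Rightarrow> 'g \<Rightarrow> 'k" where
  "cf \<equiv> Poly_Mapping.lookup"
abbreviation sg :: "'g \<Rightarrow> 'k::zero \<Rightarrow> ('g \<Rightarrow>\<^sub>0 'k)" where
  "sg \<equiv> Poly_Mapping.single"
abbreviation sc :: "'k::zero \<Rightarrow> ('g::zero \<Rightarrow>\<^sub>0 'k)" where
  "sc c \<equiv> Poly_Mapping.single 0 c"

definition fin_subgroup :: "'g::group_add set \<Rightarrow> bool" where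
  "fin_subgroup S \<longleftrightarrow> finite S \<and> 0 \<in> S \<and> (\<forall>x\<in>S. \<forall>y\<in>S. x + y \<in> S) \<and> (\<forall>x\<in>S. - x \<in> S)"

lemma fin_subgroupD:
  assumes "fin_subgroup S"
  shows "finite S" "0 \<in> S" "x \<in> S \<Longrightarrow> y \<in> S \<Longrightarrow> x + y \<in> S" "x \<in> S \<Longrightarrow> - x \<in> S"
    "x \<in> S \<Longrightarrow> y \<in> S \<Longrightarrow> x - y \<in> S"
  using assms unfolding fin_subgroup_def by (auto simp: diff_conv_add_uminus simp del: add_uminus_conv_diff)

lemma fin_subgroup_card_pos: "fin_subgroup S \<Longrightarrow> 0 < card S"
  by (metis card_gt_0_iff empty_iff fin_subgroupD(1,2))

lemma fin_subgroup_add_cancel: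
  assumes "fin_subgroup S" "x \<in> S"
  shows "x + y \<in> S \<longleftrightarrow> y \<in> S" "y + x \<in> S \<longleftrightarrow> y \<in> S"
proof -
  show "x + y \<in> S \<longleftrightarrow> y \<in> S"
    using fin_subgroupD(3)[OF assms(1), of "- x" "x + y"] fin_subgroupD(3,4)[OF assms(1)] assms(2)
    by (auto simp: add.assoc[symmetric])
  show "y + x \<in> S \<longleftrightarrow> y \<in> S"
    using fin_subgroupD(5)[OF assms(1), of "y + x" x] fin_subgroupD(3)[OF assms(1)] assms(2)
    by auto
qed

lemma fin_subgroup_minus_iff: "fin_subgroup S \<Longrightarrow> - x \<in> S \<longleftrightarrow> x \<in> S"
  by (metis fin_subgroupD(4) minus_minus)

lemma bij_betw_left_translation:
  assumes "fin_subgroup S" "x \<in> S" shows "bij_betw ((+) x) S S"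
  by (rule bij_betw_byWitness[where f' = "(+) (- x)"])
    (use assms in \<open>auto simp: fin_subgroupD add.assoc[symmetric]\<close>)

lemma bij_betw_right_translation:
  assumes "fin_subgroup S" "x \<in> S" shows "bij_betw (\<lambda>y. y + x) S S"
  by (rule bij_betw_byWitness[where f' = "\<lambda>y. y + - x"])
    (use assms in \<open>auto simp: fin_subgroupD add.assoc simp del: add_uminus_conv_diff\<close>)

lemma bij_betw_inversion:
  assumes "fin_subgroup S" shows "bij_betw uminus S S"
  by (rule bij_betw_byWitness[where f' = uminus]) (use assms in \<open>auto simp: fin_subgroupD\<close>)

lemma sum_left_translate:
  assumes "fin_subgroup S" "x \<in> S" shows "(\<Sum>y\<in>S. f (x + y)) = sum f S"
  by (rule sum.reindex_bij_betw[OF bij_betw_left_translation[OF assms]])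

lemma sum_right_translate:
  assumes "fin_subgroup S" "x \<in> S" shows "(\<Sum>y\<in>S. f (y + x)) = sum f S"
  by (rule sum.reindex_bij_betw[OF bij_betw_right_translation[OF assms]])

lemma sum_invert:
  assumes "fin_subgroup S" shows "(\<Sum>y\<in>S. f (- y)) = sum f S"
  by (rule sum.reindex_bij_betw[OF bij_betw_inversion[OF assms]])

definition galg :: "'g set \<Rightarrow> ('g \<Rightarrow>\<^sub>0 'k::zero) set" where
  "galg S = {f. \<forall>x. cf f x \<noteq> 0 \<longrightarrow> x \<in> S}"

lemma galgD: "f \<in> galg S \<Longrightarrow> x \<notin> S \<Longrightarrow> cf f x = 0"
  by (auto simp: galg_def)

lemma cf_sg_mult: "cf (sg y c * f) x = c * cf f (- y + x)"
  for f :: "'g::group_add \<Rightarrow>\<^sub>0 'k::semiring_0"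
proof -
  have *: "x = y + q \<longleftrightarrow> q = - y + x" for q
    by (metis add.assoc add_0 left_minus right_minus)
  show ?thesis
    unfolding lookup_mult lookup_single
    by (simp only: * when_mult Sum_any_when_equal Sum_any_when_equal')
qed

lemma cf_mult_sg: "cf (f * sg y c) x = cf f (x - y) * c"
  for f :: "'g::group_add \<Rightarrow>\<^sub>0 'k::semiring_0"
proof -
  have *: "x = l + q \<longleftrightarrow> l = x - q" for q l
    by (metis add_diff_cancel diff_add_cancel)
  have "cf (f * sg y c) x = (\<Sum>l. cf f l * (c when x = l + y))"
    unfolding lookup_mult lookup_single
  proof (intro Sum_any.cong arg_cong2[where f="(*)"] refl)
    fix l
    have "(\<Sum>q. (c when y = q) when x = l + q) = (\<Sum>q. (c when x = l + y) when q = y)"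
      by (intro Sum_any.cong) (auto simp: when_def)
    then show "(\<Sum>q. (c when y = q) when x = l + q) = (c when x = l + y)" by simp
  qed
  also have "\<dots> = (\<Sum>l. (cf f l * c) when l = x - y)"
    by (intro Sum_any.cong) (auto simp: * mult_when)
  finally show ?thesis by simp
qed

lemma cf_sc_mult [simp]: "cf (sc c * f) x = c * cf f x"
  for f :: "'g::group_add \<Rightarrow>\<^sub>0 'k::semiring_0"
  by (simp add: cf_sg_mult)

lemma cf_mult_sc [simp]: "cf (f * sc c) x = cf f x * c"
  for f :: "'g::group_add \<Rightarrow>\<^sub>0 'k::semiring_0"
  by (simp add: cf_mult_sg)

lemma cf_of_nat_mult [simp]: "cf (of_nat n * f) x = of_nat n * cf f x"
  for f :: "'g::group_add \<Rightarrow>\<^sub>0 'k::comm_ring_1"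
  using cf_sc_mult[of "of_nat n" f x] by simp

lemma sc_commute: "sc c * f = f * sc c"
  for f :: "'g::group_add \<Rightarrow>\<^sub>0 'k::comm_semiring_0"
  by (rule poly_mapping_eqI) (simp add: mult.commute)

lemma sc_mult_assoc: "f * (sc c * h) = sc c * (f * h)"
  for f :: "'g::group_add \<Rightarrow>\<^sub>0 'k::comm_semiring_0"
  by (metis mult.assoc sc_commute)

lemma sc_mult_sc: "sc a * (sc b * f) = sc (a * b) * f"
  for f :: "'g::group_add \<Rightarrow>\<^sub>0 'k::comm_semiring_0"
  by (simp add: mult.assoc[symmetric] mult_single)

lemma sg_mult_sg: "sg x 1 * (sg y 1 * f) = sg (x + y) 1 * f"
  for f :: "'g::group_add \<Rightarrow>\<^sub>0 'k::comm_semiring_1"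
  by (simp add: mult.assoc[symmetric] mult_single)

lemma sg_eq_sc_mult: "sg x c = sc c * sg x 1"
  for c :: "'k::comm_semiring_1" and x :: "'g::group_add"
  by (simp add: mult_single)

lemma galg_expand:
  assumes "f \<in> galg S" "finite S" shows "f = (\<Sum>x\<in>S. sg x (cf f x))"
proof (rule poly_mapping_eqI)
  fix y
  have "cf (\<Sum>x\<in>S. sg x (cf f x)) y = (\<Sum>x\<in>S. if x = y then cf f y else 0)"
    unfolding lookup_sum by (intro sum.cong refl) (auto simp: lookup_single when_def)
  also have "\<dots> = cf f y" using assms by (auto simp: galgD)
  finally show "cf f y = cf (\<Sum>x\<in>S. sg x (cf f x)) y" by simp
qed

lemma cf_mult:
  fixes f g :: "'g::group_add \<Rightarrow>\<^sub>0 'k::semiring_0"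
  assumes "f \<in> galg S" "finite S"
  shows "cf (f * g) x = (\<Sum>y\<in>S. cf f y * cf g (- y + x))"
  by (subst galg_expand[OF assms]) (simp add: sum_distrib_right lookup_sum cf_sg_mult)

lemma galg_zero [simp]: "0 \<in> galg S" by (simp add: galg_def)

lemma galg_sg: "x \<in> S \<Longrightarrow> sg x c \<in> galg S"
  by (auto simp: galg_def lookup_single when_def)

lemma galg_one: "fin_subgroup S \<Longrightarrow> (1 :: 'g::group_add \<Rightarrow>\<^sub>0 'k::comm_ring_1) \<in> galg S"
  using galg_sg[of 0 S "1 :: 'k"] by (simp add: fin_subgroupD)

lemma galg_sc: "fin_subgroup S \<Longrightarrow> sc c \<in> galg S"
  by (simp add: galg_sg fin_subgroupD)

lemma galg_add: "f \<in> galg S \<Longrightarrow> g \<in> galg S \<Longrightarrow> f + g \<in> galg S"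
  for f :: "'g::group_add \<Rightarrow>\<^sub>0 'k::comm_ring_1"
  by (auto simp: galg_def lookup_add) (metis add_0)

lemma galg_uminus: "f \<in> galg S \<Longrightarrow> - f \<in> galg S"
  for f :: "'g::group_add \<Rightarrow>\<^sub>0 'k::comm_ring_1"
  by (auto simp: galg_def)

lemma galg_diff: "f \<in> galg S \<Longrightarrow> g \<in> galg S \<Longrightarrow> f - g \<in> galg S"
  for f :: "'g::group_add \<Rightarrow>\<^sub>0 'k::comm_ring_1"
  by (metis galg_add galg_uminus uminus_add_conv_diff add.commute)

lemma galg_sum: "(\<And>i. i \<in> I \<Longrightarrow> f i \<in> galg S) \<Longrightarrow> sum f I \<in> galg S"
  for f :: "'i \<Rightarrow> 'g::group_add \<Rightarrow>\<^sub>0 'k::comm_ring_1"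
  by (induction I rule: infinite_finite_induct) (auto intro: galg_add)

lemma galg_mult: 
  fixes f g :: "'g::group_add \<Rightarrow>\<^sub>0 'k::comm_ring_1"
  assumes S: "fin_subgroup S" and f: "f \<in> galg S" and g: "g \<in> galg S"
  shows "f * g \<in> galg S"
proof -
  have "cf (f * g) x = 0" if x: "x \<notin> S" for x
    unfolding cf_mult[OF f fin_subgroupD(1)[OF S]]
  proof (rule sum.neutral, intro ballI)
    fix y assume y: "y \<in> S"
    then have "- y + x \<notin> S" using x S fin_subgroup_add_cancel(1) fin_subgroupD(4) by blast
    then show "cf f y * cf g (- y + x) = 0" using g by (simp add: galgD)
  qed
  then show ?thesis by (auto simp: galg_def)
qed

lemma galg_mono: "S \<subseteq> T \<Longrightarrow> galg S \<subseteq> galg T"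
  by (auto simp: galg_def)

text \<open>The coefficient at the identity is a trace on the group algebra; the arguments with
  idempotents use this symmetry in place of characters.\<close>

lemma cf_mult_commute_zero:
  fixes f g :: "'g::group_add \<Rightarrow>\<^sub>0 'k::comm_ring_1"
  assumes S: "fin_subgroup S" and f: "f \<in> galg S" and g: "g \<in> galg S"
  shows "cf (f * g) 0 = cf (g * f) 0"
proof -
  have "cf (f * g) 0 = (\<Sum>y\<in>S. cf f (- y) * cf g y)"
    using f S sum_invert[OF S, of "\<lambda>y. cf f y * cf g (- y)"] by (simp add: cf_mult fin_subgroupD)
  also have "\<dots> = cf (g * f) 0"
    using g S by (simp add: cf_mult fin_subgroupD mult.commute)
  finally show ?thesis .
qed

lemma nonzero_cf: "f \<noteq> 0 \<Longrightarrow> \<exists>x. cf f x \<noteq> 0"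
  by (rule ccontr) (auto intro!: poly_mapping_eqI)

text \<open>Translating by the inverse of a point of the support moves a nonzero coefficient to
  the identity.\<close>

lemma trace_form_nondegenerate:
  fixes f :: "'g::group_add \<Rightarrow>\<^sub>0 'k::comm_ring_1"
  assumes "fin_subgroup S" "f \<in> galg S" "f \<noteq> 0"
  obtains y where "y \<in> galg S" "cf (f * y) 0 \<noteq> 0"
proof -
  obtain x where x: "cf f x \<noteq> 0" using nonzero_cf[OF assms(3)] by (elim exE)
  then have "x \<in> S" using galgD[OF assms(2), of x] by auto
  then have "sg (- x) 1 \<in> galg S" by (intro galg_sg fin_subgroupD(4)[OF assms(1)])
  moreover have "cf (f * sg (- x) 1) 0 \<noteq> 0" using x by (simp add: cf_mult_sg)
  ultimately show ?thesis using that by blast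
qed

text \<open>For \<open>p = 0\<close> the divisibility says \<open>f = 0\<close>. Statements modulo
  \<open>p\<close> therefore cover an integral domain and its quotients by prime elements at the
  same time.\<close>

definition cdvd :: "'k::comm_ring_1 \<Rightarrow> ('g::group_add \<Rightarrow>\<^sub>0 'k) \<Rightarrow> bool" where
  "cdvd p f \<longleftrightarrow> (\<forall>x. p dvd cf f x)"

lemma cdvd_zero_iff [simp]: "cdvd 0 f \<longleftrightarrow> f = 0"
  by (auto simp: cdvd_def intro: poly_mapping_eqI)

lemma cdvd_0 [simp]: "cdvd p 0" by (simp add: cdvd_def)

lemma cdvd_add: "cdvd p f \<Longrightarrow> cdvd p g \<Longrightarrow> cdvd p (f + g)"
  by (simp add: cdvd_def lookup_add)

lemma cdvd_uminus [simp]: "cdvd p (- f) \<longleftrightarrow> cdvd p f"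
  by (simp add: cdvd_def)

lemma cdvd_diff: "cdvd p f \<Longrightarrow> cdvd p g \<Longrightarrow> cdvd p (f - g)"
  by (simp add: cdvd_def lookup_minus)

lemma cdvd_sum: "(\<And>i. i \<in> I \<Longrightarrow> cdvd p (f i)) \<Longrightarrow> cdvd p (sum f I)"
  by (induction I rule: infinite_finite_induct) (auto intro: cdvd_add)

lemma cdvd_sg_mult: "cdvd p f \<Longrightarrow> cdvd p (sg x c * f)"
  by (simp add: cdvd_def cf_sg_mult)

lemma cdvd_mult_left:
  assumes "cdvd p f" shows "cdvd p (a * f)"
proof -
  have "a \<in> galg (Poly_Mapping.keys a)" by (simp add: galg_def in_keys_iff)
  from galg_expand[OF this] have "a = (\<Sum>x\<in>Poly_Mapping.keys a. sg x (cf a x))" by simp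
  then have "a * f = (\<Sum>x\<in>Poly_Mapping.keys a. sg x (cf a x) * f)"
    by (subst sum_distrib_right[symmetric]) (rule arg_cong[where f = "\<lambda>u. u * f"])
  then show ?thesis by (simp add: assms cdvd_sum cdvd_sg_mult)
qed

lemma cdvd_mult_sc: "cdvd p f \<Longrightarrow> cdvd (c * p) (sc c * f)"
  by (simp add: cdvd_def mult_dvd_mono)

lemma cdvdE:
  assumes "cdvd p f" obtains h where "f = sc p * h" 
proof -
  have "\<forall>x. \<exists>c. cf f x = p * c \<and> (cf f x = 0 \<longrightarrow> c = 0)"
    using assms by (metis cdvd_def dvdE mult_zero_right)
  then obtain c where c: "\<And>x. cf f x = p * c x" "\<And>x. cf f x = 0 \<Longrightarrow> c x = 0" by metis
  have "finite {x. c x \<noteq> 0}"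
    by (rule finite_subset[of _ "{x. cf f x \<noteq> 0}"]) (use c(2) in auto)
  then have "f = sc p * Poly_Mapping.Abs_poly_mapping c"
    by (intro poly_mapping_eqI) (simp add: c(1))
  then show ?thesis using that by blast
qed

section \<open>Fraction-free projections and Maschke's theorem\<close>

text \<open>Division-free Gaussian elimination. A submodule \<open>L\<close> of the free module on
  \<open>S\<close> need not be a direct summand, but modulo \<open>p\<close> it has a projection up
  to a scalar \<open>D\<close> that is not divisible by \<open>p\<close>: an element
  \<open>b\<close> of \<open>L\<close> with \<open>p\<close> not dividing \<open>b(s)\<close> serves
  as the pivot for \<open>s\<close> and contributes the factor \<open>b(s)\<close> to
  \<open>D\<close>. For \<open>p = 0\<close> this is a projection over the field of fractions,
  cleared of denominators.\<close>

lemma fraction_free_projection: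
  fixes p :: "'k::comm_ring_1" and L :: "('g::group_add \<Rightarrow>\<^sub>0 'k) set"
  assumes "finite S" and p1: "\<not> p dvd 1" and pp: "\<And>a b. p dvd a * b \<Longrightarrow> p dvd a \<or> p dvd b"
    and "0 \<in> L" "\<And>f g. f \<in> L \<Longrightarrow> g \<in> L \<Longrightarrow> f + g \<in> L" "\<And>c f. f \<in> L \<Longrightarrow> sc c * f \<in> L"
    and "\<And>f x. f \<in> L \<Longrightarrow> x \<notin> S \<Longrightarrow> p dvd cf f x"
  shows "\<exists>D \<pi>. \<not> p dvd D \<and> (\<forall>s\<in>S. \<pi> s \<in> L) \<and> (\<forall>j\<in>L. cdvd p ((\<Sum>s\<in>S. sc (cf j s) * \<pi> s) - sc D * j))"
  using assms(1,4-7)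
proof (induction S arbitrary: L rule: finite_induct)
  case empty
  then show ?case by (intro exI[of _ 1]) (use p1 in \<open>auto simp: cdvd_def lookup_minus\<close>)
next
  case (insert s S)
  define L' where "L' = {f \<in> L. p dvd cf f s}"
  have "\<exists>D \<pi>. \<not> p dvd D \<and> (\<forall>s\<in>S. \<pi> s \<in> L') \<and> (\<forall>j\<in>L'. cdvd p ((\<Sum>s\<in>S. sc (cf j s) * \<pi> s) - sc D * j))"
  proof (rule insert.IH)
    show "p dvd cf f x" if "f \<in> L'" "x \<notin> S" for f x
      using that insert.prems(4)[of f x] by (cases "x = s") (auto simp: L'_def)
  qed (use insert.prems in \<open>auto simp: L'_def lookup_add\<close>)
  then obtain D \<pi> where D: "\<not> p dvd D" and \<pi>: "\<And>t. t \<in> S \<Longrightarrow> \<pi> t \<in> L'"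
    and eq: "\<And>j. j \<in> L' \<Longrightarrow> cdvd p ((\<Sum>s\<in>S. sc (cf j s) * \<pi> s) - sc D * j)" by blast
  have neg: "- f \<in> L" if "f \<in> L" for f using insert.prems(3)[OF that, of "-1"]
    by (simp add: single_uminus)
  have Lsum: "(\<Sum>t\<in>I. g t) \<in> L" if "\<And>t. t \<in> I \<Longrightarrow> g t \<in> L" for g and I :: "'g set"
    using that by (induction I rule: infinite_finite_induct) (auto intro: insert.prems)
  show ?case
  proof (cases "L' = L")
    case True
    define \<pi>' where "\<pi>' = \<pi>(s := 0)"
    have "(\<Sum>t\<in>insert s S. sc (cf j t) * \<pi>' t) = (\<Sum>t\<in>S. sc (cf j t) * \<pi> t)" for j :: "'g \<Rightarrow>\<^sub>0 'k"
    proof -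
      have "(\<Sum>t\<in>S. sc (cf j t) * \<pi>' t) = (\<Sum>t\<in>S. sc (cf j t) * \<pi> t)"
        by (rule sum.cong) (use insert.hyps in \<open>auto simp: \<pi>'_def\<close>)
      then show ?thesis using insert.hyps by (simp add: \<pi>'_def)
    qed
    then show ?thesis using D \<pi> eq True insert.prems(1)
      by (intro exI[of _ D] exI[of _ \<pi>']) (auto simp: \<pi>'_def)
  next
    case False
    then obtain b where b: "b \<in> L" "\<not> p dvd cf b s" by (auto simp: L'_def)
    define B where "B = (\<Sum>t\<in>S. sc (cf b t) * \<pi> t)"
    have BL: "B \<in> L" unfolding B_def
      by (intro Lsum insert.prems(3)) (use \<pi> in \<open>auto simp: L'_def\<close>)
    define \<pi>' where "\<pi>' = (\<lambda>t. if t = s then sc D * b + - B else sc (cf b s) * \<pi> t)"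
    have "cdvd p ((\<Sum>t\<in>insert s S. sc (cf j t) * \<pi>' t) - sc (D * cf b s) * j)" if j: "j \<in> L" for j
    proof -
      \<comment> \<open>The pivot clears the coefficient of \<open>j\<close> at
        \<open>s\<close>, so the induction hypothesis applies to \<open>j'\<close>.\<close>
      define j' where "j' = sc (cf b s) * j + - (sc (cf j s) * b)"
      have "j' \<in> L" unfolding j'_def by (intro insert.prems(2,3) neg j b)
      then have "j' \<in> L'" by (simp add: L'_def j'_def lookup_minus mult.commute)
      note eq[OF this]
      moreover have "(\<Sum>t\<in>S. sc (cf j' t) * \<pi> t) - sc D * j'
          = (\<Sum>t\<in>insert s S. sc (cf j t) * \<pi>' t) - sc (D * cf b s) * j"
      proof -
        have e1: "(\<Sum>t\<in>S. sc (cf j' t) * \<pi> t) = (\<Sum>t\<in>S. sc (cf j t) * \<pi>' t) + - (sc (cf j s) * B)"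
        proof -
          have "sc (cf j' t) * \<pi> t = sc (cf j t) * \<pi>' t - sc (cf j s) * (sc (cf b t) * \<pi> t)" if "t \<in> S" for t
          proof -
            have "t \<noteq> s" using that insert.hyps by auto
            then show ?thesis
              by (intro poly_mapping_eqI) (simp add: \<pi>'_def j'_def lookup_add lookup_minus algebra_simps)
          qed
          then show ?thesis by (simp add: B_def sum_subtractf sum_distrib_left)
        qed
        have e2: "(\<Sum>t\<in>insert s S. sc (cf j t) * \<pi>' t) = sc (cf j s) * (sc D * b - B) + (\<Sum>t\<in>S. sc (cf j t) * \<pi>' t)"
          using insert.hyps by (simp add: \<pi>'_def)
        show ?thesis unfolding e1 e2
          by (intro poly_mapping_eqI) (simp add: j'_def lookup_add lookup_minus algebra_simps)
      qed
      ultimately show ?thesis by simp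
    qed
    moreover have "\<not> p dvd D * cf b s" using pp D b by blast
    moreover have "\<forall>t\<in>insert s S. \<pi>' t \<in> L"
    proof
      fix t assume "t \<in> insert s S"
      moreover have "sc D * b + - B \<in> L" by (intro insert.prems(2,3) neg b BL)
      ultimately show "\<pi>' t \<in> L" using \<pi>[of t] insert.prems(3) by (auto simp: \<pi>'_def L'_def)
    qed
    ultimately show ?thesis by blast
  qed
qed

text \<open>Averaging the projection over \<open>S\<close> makes it commute with left
  multiplication, and a map that commutes with left multiplication is right multiplication by the
  image \<open>f\<close> of \<open>1\<close>. The scalar becomes \<open>D |S|\<close>, which is why
  \<open>p\<close> must not divide \<open>|S|\<close>.\<close>

lemma maschke:
  fixes p :: "'k::comm_ring_1" and L :: "('g::group_add \<Rightarrow>\<^sub>0 'k) set"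
  assumes S: "fin_subgroup S" and p1: "\<not> p dvd 1" and pp: "\<And>a b. p dvd a * b \<Longrightarrow> p dvd a \<or> p dvd b"
    and card: "\<not> p dvd of_nat (card S)"
    and L: "L \<subseteq> galg S" "0 \<in> L" "\<And>f g. f \<in> L \<Longrightarrow> g \<in> L \<Longrightarrow> f + g \<in> L"
    and ideal: "\<And>a f. a \<in> galg S \<Longrightarrow> f \<in> L \<Longrightarrow> a * f \<in> L"
  obtains D f where "\<not> p dvd D" "f \<in> L" "\<And>j. j \<in> L \<Longrightarrow> cdvd p (j * f - sc D * j)"
proof -
  have "\<exists>D \<pi>. \<not> p dvd D \<and> (\<forall>s\<in>S. \<pi> s \<in> L) \<and> (\<forall>j\<in>L. cdvd p ((\<Sum>s\<in>S. sc (cf j s) * \<pi> s) - sc D * j))"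
    by (rule fraction_free_projection)
      (use L S p1 pp in \<open>auto simp: fin_subgroupD galgD intro!: ideal galg_sc\<close>)
  then obtain D \<pi> where D: "\<not> p dvd D" and \<pi>: "\<And>t. t \<in> S \<Longrightarrow> \<pi> t \<in> L"
    and eq: "\<And>j. j \<in> L \<Longrightarrow> cdvd p ((\<Sum>s\<in>S. sc (cf j s) * \<pi> s) - sc D * j)" by blast
  define f where "f = (\<Sum>x\<in>S. sg (- x) 1 * \<pi> x)"
  have Lsum: "(\<Sum>t\<in>I. g t) \<in> L" if "\<And>t. t \<in> I \<Longrightarrow> g t \<in> L" for g and I :: "'g set"
    using that by (induction I rule: infinite_finite_induct) (auto intro: L)
  have fL: "f \<in> L" unfolding f_def
    by (intro Lsum ideal galg_sg fin_subgroupD(4)[OF S] \<pi>)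
  moreover have "cdvd p (j * f - sc (D * of_nat (card S)) * j)" if j: "j \<in> L" for j
  proof -
    have jS: "j \<in> galg S" using j L by auto
    have transl: "sg y 1 * f = (\<Sum>z\<in>S. sg (- z) 1 * \<pi> (z + y))" if y: "y \<in> S" for y
    proof -
      have "sg y 1 * f = (\<Sum>x\<in>S. sg (y - x) 1 * \<pi> x)"
        by (simp add: f_def sum_distrib_left sg_mult_sg)
      also have "\<dots> = (\<Sum>z\<in>S. sg (y - (z + y)) 1 * \<pi> (z + y))"
        using sum_right_translate[OF S y, of "\<lambda>x. sg (y - x) 1 * \<pi> x"] by simp
      finally show ?thesis by (simp add: diff_conv_add_uminus minus_add add.assoc[symmetric] del: add_uminus_conv_diff)
    qed
    have "j * f = (\<Sum>y\<in>S. sg y (cf j y) * f)"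
      by (subst galg_expand[OF jS fin_subgroupD(1)[OF S]]) (simp add: sum_distrib_right)
    also have "\<dots> = (\<Sum>y\<in>S. sc (cf j y) * (sg y 1 * f))"
      by (intro sum.cong refl) (simp add: mult.assoc[symmetric] mult_single)
    also have "\<dots> = (\<Sum>y\<in>S. \<Sum>z\<in>S. sg (- z) 1 * (sc (cf j y) * \<pi> (z + y)))"
      by (intro sum.cong refl) (simp add: transl sum_distrib_left sc_mult_assoc)
    also have "\<dots> = (\<Sum>z\<in>S. sg (- z) 1 * (\<Sum>y\<in>S. sc (cf j y) * \<pi> (z + y)))"
      by (subst sum.swap) (simp add: sum_distrib_left)
    also have "\<dots> = (\<Sum>z\<in>S. sg (- z) 1 * (\<Sum>w\<in>S. sc (cf (sg z 1 * j) w) * \<pi> w))"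
    proof (rule sum.cong[OF refl], rule arg_cong2[where f="(*)", OF refl])
      fix z assume "z \<in> S"
      then show "(\<Sum>y\<in>S. sc (cf j y) * \<pi> (z + y)) = (\<Sum>w\<in>S. sc (cf (sg z 1 * j) w) * \<pi> w)"
        using sum_left_translate[OF S, of z "\<lambda>w. sc (cf (sg z 1 * j) w) * \<pi> w"]
        by (simp add: cf_sg_mult add.assoc[symmetric])
    qed
    finally have "j * f = \<dots>" .
    moreover have "sc (D * of_nat (card S)) * j = (\<Sum>z\<in>S. sg (- z) 1 * (sc D * (sg z 1 * j)))"
    proof -
      have "(\<Sum>z\<in>S. sg (- z) 1 * (sc D * (sg z 1 * j))) = (\<Sum>z\<in>S. sc D * j)"
        by (intro sum.cong refl) (simp add: sc_mult_assoc sg_mult_sg)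
      also have "\<dots> = sc (D * of_nat (card S)) * j"
        by (intro poly_mapping_eqI) (simp add: mult.assoc mult.left_commute)
      finally show ?thesis by simp
    qed
    ultimately have "j * f - sc (D * of_nat (card S)) * j
      = (\<Sum>z\<in>S. sg (- z) 1 * ((\<Sum>w\<in>S. sc (cf (sg z 1 * j) w) * \<pi> w) - sc D * (sg z 1 * j)))"
      by (simp add: sum_subtractf right_diff_distrib)
    moreover have "cdvd p \<dots>"
      by (intro cdvd_sum cdvd_sg_mult eq ideal galg_sg j)
    ultimately show ?thesis by simp
  qed
  moreover have "\<not> p dvd D * of_nat (card S)" using pp D card by blast
  ultimately show ?thesis using that by blast
qed

section \<open>Finite subgroups as groups with a carrier\<close>

definition grp :: "'g::group_add set \<Rightarrow> 'g monoid" where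
  "grp S = \<lparr>carrier = S, monoid.mult = (+), one = 0\<rparr>"

lemma grp_simps [simp]: "carrier (grp S) = S" "x \<otimes>\<^bsub>grp S\<^esub> y = x + y" "\<one>\<^bsub>grp S\<^esub> = 0"
  by (simp_all add: grp_def)

lemma group_grp: assumes "fin_subgroup S" shows "group (grp S)"
proof (rule groupI)
  fix x assume "x \<in> carrier (grp S)"
  then show "\<exists>y\<in>carrier (grp S). y \<otimes>\<^bsub>grp S\<^esub> x = \<one>\<^bsub>grp S\<^esub>"
    using fin_subgroupD(4)[OF assms] by (intro bexI[of _ "- x"]) auto
qed (use fin_subgroupD[OF assms] in \<open>auto simp: add.assoc\<close>)

lemma grp_inv: assumes "fin_subgroup S" "x \<in> S" shows "inv\<^bsub>grp S\<^esub> x = - x"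
proof -
  interpret group "grp S" by (rule group_grp[OF assms(1)])
  show ?thesis by (rule inv_equality) (use assms in \<open>auto simp: fin_subgroupD\<close>)
qed

lemma subgroup_grp_iff:
  assumes "fin_subgroup S" shows "subgroup C (grp S) \<longleftrightarrow> fin_subgroup C \<and> C \<subseteq> S"
proof
  assume C: "subgroup C (grp S)"
  note C' = subgroup.subset[OF C] subgroup.m_closed[OF C] subgroup.one_closed[OF C] subgroup.m_inv_closed[OF C]
  have "finite C" using C'(1) assms by (auto intro: finite_subset simp: fin_subgroupD)
  moreover have "- x \<in> C" if "x \<in> C" for x
    using C'(1) C'(4)[OF that] grp_inv[OF assms, of x] that by auto
  ultimately show "fin_subgroup C \<and> C \<subseteq> S" using C' by (auto simp: fin_subgroup_def)
next
  assume C: "fin_subgroup C \<and> C \<subseteq> S"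
  then show "subgroup C (grp S)"
    by (intro subgroup.intro) (auto simp: fin_subgroupD grp_inv[OF assms] subsetD)
qed

lemma card_subgroup_dvd:
  assumes "fin_subgroup S" "fin_subgroup C" "C \<subseteq> S" shows "card C dvd card S"
proof -
  interpret group "grp S" by (rule group_grp[OF assms(1)])
  have "subgroup C (grp S)" using assms by (simp add: subgroup_grp_iff)
  from lagrange[OF this] show ?thesis by (metis Coset.order_def dvd_triv_right grp_simps(1))
qed

section \<open>The ideal of subgroup sums and its annihilator\<close>

definition nontrivial_subgroups :: "'g::group_add set \<Rightarrow> 'g set set" where
  "nontrivial_subgroups S = {C. fin_subgroup C \<and> C \<subseteq> S \<and> C \<noteq> {0}}"

definition subgroup_sum :: "'g::group_add set \<Rightarrow> ('g \<Rightarrow>\<^sub>0 'k::comm_ring_1)" where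
  "subgroup_sum C = (\<Sum>t\<in>C. sg t 1)"

definition radon_kernel :: "'g::group_add set \<Rightarrow> ('g \<Rightarrow>\<^sub>0 'k::comm_ring_1) set" where
  "radon_kernel S = {h \<in> galg S. \<forall>C\<in>nontrivial_subgroups S. subgroup_sum C * h = 0}"

definition subgroup_sum_ideal :: "'g::group_add set \<Rightarrow> ('g \<Rightarrow>\<^sub>0 'k::comm_ring_1) set" where
  "subgroup_sum_ideal S =
     {(\<Sum>C\<in>nontrivial_subgroups S. a C * subgroup_sum C) | a. \<forall>C. a C \<in> galg S}"

lemma finite_nontrivial_subgroups: "fin_subgroup S \<Longrightarrow> finite (nontrivial_subgroups S)"
  by (rule finite_subset[of _ "Pow S"]) (auto simp: nontrivial_subgroups_def fin_subgroupD)

lemma nontrivial_subgroupsD: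
  assumes "C \<in> nontrivial_subgroups S"
  shows "fin_subgroup C" "C \<subseteq> S" "\<exists>c\<in>C. c \<noteq> 0"
  using assms fin_subgroupD(2)[of C] by (auto simp: nontrivial_subgroups_def)

lemma cf_subgroup_sum: "finite C \<Longrightarrow> cf (subgroup_sum C) x = (if x \<in> C then 1 else 0)"
  by (simp add: subgroup_sum_def lookup_sum lookup_single when_def)

lemma subgroup_sum_galg: "C \<subseteq> S \<Longrightarrow> subgroup_sum C \<in> galg S"
  unfolding subgroup_sum_def by (intro galg_sum galg_sg) auto

lemma cf_subgroup_sum_mult: "cf (subgroup_sum C * h) x = (\<Sum>t\<in>C. cf h (- t + x))"
  by (simp add: subgroup_sum_def sum_distrib_right lookup_sum cf_sg_mult)

lemma sg_mult_subgroup_sum: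
  assumes "fin_subgroup C" "c \<in> C"
  shows "sg c 1 * subgroup_sum C = (subgroup_sum C :: 'g::group_add \<Rightarrow>\<^sub>0 'k::comm_ring_1)"
proof -
  have "sg c 1 * subgroup_sum C = (\<Sum>t\<in>C. sg (c + t) (1::'k))"
    by (simp add: subgroup_sum_def sum_distrib_left mult_single)
  then show ?thesis using sum_left_translate[OF assms, of "\<lambda>t. sg t (1::'k)"] by (simp add: subgroup_sum_def)
qed

lemma subgroup_sum_square:
  assumes "fin_subgroup C"
  shows "subgroup_sum C * (subgroup_sum C * h) = of_nat (card C) * (subgroup_sum C * h)"
proof -
  have "subgroup_sum C * subgroup_sum C = (\<Sum>c\<in>C. sg c 1 * (subgroup_sum C :: _ \<Rightarrow>\<^sub>0 'b))"
    by (metis subgroup_sum_def sum_distrib_right)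
  also have "\<dots> = (\<Sum>c\<in>C. subgroup_sum C)"
    by (intro sum.cong refl sg_mult_subgroup_sum assms)
  finally show ?thesis by (simp add: mult.assoc[symmetric])
qed

lemma conjugate_subgroup:
  assumes "fin_subgroup C" shows "fin_subgroup ((\<lambda>t. x + t - x) ` C)"
  unfolding fin_subgroup_def
proof (intro conjI ballI)
  show "finite ((\<lambda>t. x + t - x) ` C)" using assms by (simp add: fin_subgroupD)
  show "0 \<in> (\<lambda>t. x + t - x) ` C" using assms by (intro image_eqI[of _ _ 0]) (auto simp: fin_subgroupD)
next
  fix a b assume "a \<in> (\<lambda>t. x + t - x) ` C" "b \<in> (\<lambda>t. x + t - x) ` C"
  then obtain s t where "s \<in> C" "t \<in> C" "a = x + s - x" "b = x + t - x" by blast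
  then show "a + b \<in> (\<lambda>t. x + t - x) ` C"
    by (intro image_eqI[of _ _ "s + t"])
      (auto simp: fin_subgroupD[OF assms] diff_conv_add_uminus add.assoc simp del: add_uminus_conv_diff)
next
  fix a assume "a \<in> (\<lambda>t. x + t - x) ` C"
  then obtain s where "s \<in> C" "a = x + s - x" by blast
  then show "- a \<in> (\<lambda>t. x + t - x) ` C"
    by (intro image_eqI[of _ _ "- s"])
      (auto simp: fin_subgroupD[OF assms] diff_conv_add_uminus minus_add add.assoc simp del: add_uminus_conv_diff)
qed

lemma inj_conjugation: "inj_on (\<lambda>t. x + t - x) C" for x :: "'g::group_add"
  by (rule inj_onI, drule arg_cong[where f = "\<lambda>u. u + x"]) simp

lemma conjugate_nontrivial_subgroup:
  assumes S: "fin_subgroup S" and x: "x \<in> S" and C: "C \<in> nontrivial_subgroups S"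
  shows "(\<lambda>t. x + t - x) ` C \<in> nontrivial_subgroups S"
proof -
  obtain c where c: "c \<in> C" "c \<noteq> 0" using nontrivial_subgroupsD[OF C] by blast
  have "x + c - x \<noteq> 0" using c(2)
    by (metis add_0_right add_left_cancel diff_eq_eq add.left_neutral)
  then have "(\<lambda>t. x + t - x) ` C \<noteq> {0}" using c(1) by blast
  moreover have "(\<lambda>t. x + t - x) ` C \<subseteq> S"
  proof clarify
    fix t assume "t \<in> C"
    then have "t \<in> S" using nontrivial_subgroupsD(2)[OF C] by blast
    then show "x + t - x \<in> S" by (intro fin_subgroupD(3,5)[OF S] x)
  qed
  ultimately show ?thesis
    using conjugate_subgroup[OF nontrivial_subgroupsD(1)[OF C]] by (simp add: nontrivial_subgroups_def)
qed

lemma subgroup_sum_conjugate: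
  "sg x 1 * subgroup_sum C = subgroup_sum ((\<lambda>t. x + t - x) ` C) * sg x 1"
  by (simp add: subgroup_sum_def sum.reindex[OF inj_conjugation] sum_distrib_left
      sum_distrib_right mult_single)

lemma subgroup_sum_sg:
  "subgroup_sum C * sg x 1 = sg x 1 * subgroup_sum ((\<lambda>t. - x + t - - x) ` C)"
proof -
  have "subgroup_sum C * sg x 1 = sg x 1 * (sg (- x) 1 * subgroup_sum C) * sg x 1"
    by (simp add: sg_mult_sg mult.assoc)
  also have "\<dots> = sg x 1 * subgroup_sum ((\<lambda>t. - x + t - - x) ` C) * (sg (- x) 1 * sg x 1)"
    by (simp only: subgroup_sum_conjugate[of "- x" C] mult.assoc)
  finally show ?thesis by (simp add: mult_single)
qed

text \<open>Group elements can be moved past \<open>\<sigma>\<^sub>C\<close> at the price of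
  conjugating \<open>C\<close>, and conjugates of nontrivial subgroups are again nontrivial
  subgroups.\<close>

lemma radon_kernel_left_ideal:
  assumes S: "fin_subgroup S" and a: "a \<in> galg S" and h: "h \<in> radon_kernel S"
  shows "a * h \<in> radon_kernel S"
proof -
  have "subgroup_sum C * (a * h) = 0" if C: "C \<in> nontrivial_subgroups S" for C
  proof -
    have "subgroup_sum C * (sg x c * h) = 0" if x: "x \<in> S" for x c
    proof -
      have "subgroup_sum C * (sg x c * h) = sc c * ((subgroup_sum C * sg x 1) * h)"
        by (subst sg_eq_sc_mult) (simp add: mult.assoc sc_mult_assoc)
      also have "\<dots> = sc c * (sg x 1 * (subgroup_sum ((\<lambda>t. - x + t - - x) ` C) * h))"
        unfolding subgroup_sum_sg by (simp add: mult.assoc)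
      also have "subgroup_sum ((\<lambda>t. - x + t - - x) ` C) * h = 0"
        using h conjugate_nontrivial_subgroup[OF S fin_subgroupD(4)[OF S x] C]
        by (simp add: radon_kernel_def)
      finally show ?thesis by simp
    qed
    then show ?thesis
      by (subst galg_expand[OF a fin_subgroupD(1)[OF S]]) (simp add: sum_distrib_right sum_distrib_left)
  qed
  then show ?thesis using assms by (simp add: radon_kernel_def galg_mult)
qed

lemma subgroup_sum_ideal_zero: "0 \<in> subgroup_sum_ideal S"
  unfolding subgroup_sum_ideal_def by (intro CollectI exI[of _ "\<lambda>_. 0"]) simp

lemma subgroup_sum_ideal_add:
  assumes "f \<in> subgroup_sum_ideal S" "g \<in> subgroup_sum_ideal S" shows "f + g \<in> subgroup_sum_ideal S"
proof -
  obtain a b where ab: "f = (\<Sum>C\<in>nontrivial_subgroups S. a C * subgroup_sum C)" "\<forall>C. a C \<in> galg S"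
      "g = (\<Sum>C\<in>nontrivial_subgroups S. b C * subgroup_sum C)" "\<forall>C. b C \<in> galg S"
    using assms by (auto simp: subgroup_sum_ideal_def)
  then show ?thesis unfolding subgroup_sum_ideal_def
    by (intro CollectI exI[of _ "\<lambda>C. a C + b C"]) (auto simp: distrib_right sum.distrib galg_add)
qed

lemma subgroup_sum_ideal_mult:
  assumes S: "fin_subgroup S" and c: "c \<in> galg S" and "f \<in> subgroup_sum_ideal S"
  shows "c * f \<in> subgroup_sum_ideal S"
proof -
  obtain a where a: "f = (\<Sum>C\<in>nontrivial_subgroups S. a C * subgroup_sum C)" "\<forall>C. a C \<in> galg S"
    using assms by (auto simp: subgroup_sum_ideal_def)
  then show ?thesis unfolding subgroup_sum_ideal_def
    by (intro CollectI exI[of _ "\<lambda>C. c * a C"]) (auto simp: sum_distrib_left mult.assoc galg_mult S c)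
qed

lemma subgroup_sum_in_ideal:
  assumes S: "fin_subgroup S" and "C \<in> nontrivial_subgroups S"
  shows "(subgroup_sum C :: 'g::group_add \<Rightarrow>\<^sub>0 'k::comm_ring_1) \<in> subgroup_sum_ideal S"
proof -
  have "(\<Sum>D\<in>nontrivial_subgroups S. (if D = C then 1 else 0) * subgroup_sum D)
      = (subgroup_sum C :: 'g \<Rightarrow>\<^sub>0 'k)"
    using assms finite_nontrivial_subgroups[OF S]
    by (subst sum.remove[of _ C]) (auto intro!: sum.neutral)
  then show ?thesis unfolding subgroup_sum_ideal_def
    by (intro CollectI exI[of _ "\<lambda>D. if D = C then 1 else 0"]) (auto simp: galg_one S)
qed

lemma subgroup_sum_ideal_galg:
  assumes S: "fin_subgroup S" shows "subgroup_sum_ideal S \<subseteq> galg S"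
  unfolding subgroup_sum_ideal_def
  by (auto intro!: galg_sum galg_mult S subgroup_sum_galg dest: nontrivial_subgroupsD)

text \<open>Maschke's theorem with \<open>p = 0\<close>, applied to the ideal \<open>J\<close> of
  subgroup sums, gives \<open>f \<in> J\<close> with \<open>j f = D j\<close> for all \<open>j \<in>
  J\<close>. Hence every \<open>\<sigma>\<^sub>C\<close> annihilates \<open>D - f\<close>, and
  \<open>D - f = 0\<close> means \<open>D \<in> J\<close>.\<close>

lemma radon_kernel_or_scalar:
  assumes S: "fin_subgroup S"
  shows "(\<exists>h \<in> radon_kernel S. h \<noteq> (0 :: _ \<Rightarrow>\<^sub>0 int)) \<or> (\<exists>D::int. D \<noteq> 0 \<and> sc D \<in> subgroup_sum_ideal S)"
proof -
  obtain D :: int and f where D: "\<not> 0 dvd D" "f \<in> subgroup_sum_ideal S"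
    and eq: "\<And>j. j \<in> subgroup_sum_ideal S \<Longrightarrow> cdvd 0 (j * f - sc D * j)"
    using maschke[of S 0 "subgroup_sum_ideal S :: ('a \<Rightarrow>\<^sub>0 int) set", OF S _ _ _ subgroup_sum_ideal_galg[OF S]
        subgroup_sum_ideal_zero subgroup_sum_ideal_add subgroup_sum_ideal_mult[OF S]]
      fin_subgroup_card_pos[OF S] by auto
  show ?thesis
  proof (cases "sc D - f = 0")
    case True
    then show ?thesis using D by auto
  next
    case False
    have "sc D - f \<in> radon_kernel S" unfolding radon_kernel_def
    proof (intro CollectI conjI ballI galg_diff galg_sc S)
      show "f \<in> galg S" using D(2) subgroup_sum_ideal_galg[OF S] by blast
      fix C assume "C \<in> nontrivial_subgroups S"
      from eq[OF subgroup_sum_in_ideal[OF S this]]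
      show "subgroup_sum C * (sc D - f) = 0" by (simp add: right_diff_distrib sc_commute)
    qed
    then show ?thesis using False by blast
  qed
qed

lemma int_prime_cases:
  assumes "Factorial_Ring.prime (p::int)"
  shows "\<not> p dvd 1" "p dvd a * b \<Longrightarrow> p dvd a \<or> p dvd b"
  using assms by (auto simp: prime_dvd_mult_iff)

text \<open>Membership of \<open>D\<close> in the ideal \<open>J\<close> is useless modulo
  \<open>p\<close> if \<open>p\<close> divides \<open>D\<close>; the scalar is improved as follows.
  Maschke's theorem modulo \<open>p\<close> gives \<open>f \<in> J\<close> and
  \<open>D\<^sub>0\<close> prime to \<open>p\<close> such that \<open>g = D\<^sub>0 - f\<close> is
  annihilated by \<open>J\<close> modulo \<open>p\<close>. Passing to powers of \<open>g\<close>
  improves this to \<open>\<sigma>\<^sub>C g\<^sup>N\<close> being divisible by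
  \<open>p\<^sup>N\<close>, hence so is \<open>D g\<^sup>N\<close>. For large \<open>N\<close> this
  forces \<open>p\<close> to divide \<open>g\<^sup>N\<close>, while \<open>g\<^sup>N\<close> is
  congruent to \<open>D\<^sub>0\<^sup>N\<close> modulo \<open>J\<close>; so \<open>E =
  D\<^sub>0\<^sup>N\<close> lies in \<open>J\<close> modulo \<open>p\<close>.\<close>

lemma scalar_mod_prime:
  assumes S: "fin_subgroup S" and p: "Factorial_Ring.prime (p::int)" and pS: "\<not> p dvd int (card S)"
    and D: "(D::int) \<noteq> 0" "sc D \<in> subgroup_sum_ideal S"
  shows "\<exists>E. \<not> p dvd E \<and> (\<exists>j\<in>subgroup_sum_ideal S. cdvd p (sc E - j))"
proof -
  let ?J = "subgroup_sum_ideal S :: ('a \<Rightarrow>\<^sub>0 int) set"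
  obtain D0 :: int and f where D0: "\<not> p dvd D0" and f: "f \<in> ?J"
    and eq: "\<And>j. j \<in> ?J \<Longrightarrow> cdvd p (j * f - sc D0 * j)"
    using maschke[of S p ?J, OF S _ _ _ subgroup_sum_ideal_galg[OF S]
        subgroup_sum_ideal_zero subgroup_sum_ideal_add subgroup_sum_ideal_mult[OF S]]
      int_prime_cases[OF p] pS by auto
  define g where "g = sc D0 - f"
  have fS: "f \<in> galg S" using f subgroup_sum_ideal_galg[OF S] by blast
  have gS: "g \<in> galg S" unfolding g_def by (intro galg_diff galg_sc S fS)
  have gN: "g ^ N \<in> galg S" for N by (induction N) (auto intro: galg_one galg_mult S gS)
  \<comment> \<open>In the induction step write \<open>\<sigma>\<^sub>C g = p h\<close>. Then
    \<open>|C| h = \<sigma>\<^sub>C h\<close> because \<open>\<sigma>\<^sub>C\<close> squares to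
    \<open>|C| \<sigma>\<^sub>C\<close>, and moving \<open>\<sigma>\<^sub>C\<close> past the group
    elements in \<open>h\<close> turns it into sums of conjugate subgroups, to which the induction
    hypothesis applies; finally \<open>|C|\<close> is prime to \<open>p\<close>.\<close>
  have div: "\<forall>C\<in>nontrivial_subgroups S. cdvd (p ^ N) (subgroup_sum C * g ^ N)" for N
  proof (induction N)
    case 0
    then show ?case by (simp add: cdvd_def)
  next
    case (Suc N)
    show ?case
    proof
      fix C assume C: "C \<in> nontrivial_subgroups S"
      note Cs = nontrivial_subgroupsD[OF C]
      have "cdvd p (- (subgroup_sum C * f - sc D0 * subgroup_sum C))"
        by (rule iffD2[OF cdvd_uminus eq[OF subgroup_sum_in_ideal[OF S C]]])
      also have "- (subgroup_sum C * f - sc D0 * subgroup_sum C) = subgroup_sum C * g"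
        by (simp add: g_def right_diff_distrib sc_commute)
      finally obtain h where h: "subgroup_sum C * g = sc p * h" by (rule cdvdE)
      have p0: "p \<noteq> 0" using p by auto
      have hS: "h \<in> galg S" unfolding galg_def
      proof (intro CollectI allI impI)
        fix x assume "cf h x \<noteq> 0"
        then have "cf (subgroup_sum C * g) x \<noteq> 0" using p0 by (simp add: h)
        then show "x \<in> S" using galg_mult[OF S subgroup_sum_galg[OF Cs(2)] gS] by (auto simp: galg_def)
      qed
      have ch: "subgroup_sum C * h = of_nat (card C) * h"
      proof (rule poly_mapping_eqI)
        fix x
        have "cf (subgroup_sum C * (sc p * h)) x = cf (of_nat (card C) * (sc p * h)) x"
          using subgroup_sum_square[OF Cs(1), of g] by (simp add: h)
        then show "cf (subgroup_sum C * h) x = cf (of_nat (card C) * h) x"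
          using p0 by (simp add: sc_mult_assoc)
      qed
      have "cdvd (p ^ N) (subgroup_sum C * (sg x c * g ^ N))" if x: "x \<in> S" for x c
      proof -
        have "subgroup_sum C * (sg x c * g ^ N) = sc c * ((subgroup_sum C * sg x 1) * g ^ N)"
          by (subst sg_eq_sc_mult) (simp add: mult.assoc sc_mult_assoc)
        also have "\<dots> = sc c * (sg x 1 * (subgroup_sum ((\<lambda>t. - x + t - - x) ` C) * g ^ N))"
          unfolding subgroup_sum_sg by (simp add: mult.assoc)
        finally show ?thesis
          using Suc.IH conjugate_nontrivial_subgroup[OF S fin_subgroupD(4)[OF S x] C]
          by (simp add: cdvd_sg_mult)
      qed
      then have "cdvd (p ^ N) (subgroup_sum C * (h * g ^ N))"
        by (subst galg_expand[OF hS fin_subgroupD(1)[OF S]])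
          (auto simp: sum_distrib_right sum_distrib_left intro: cdvd_sum)
      also have "subgroup_sum C * (h * g ^ N) = of_nat (card C) * (h * g ^ N)"
        by (simp add: mult.assoc[symmetric] ch)
      finally have dv: "p ^ N dvd int (card C) * cf (h * g ^ N) x" for x
        by (simp add: cdvd_def)
      have "card C dvd card S" by (rule card_subgroup_dvd[OF S Cs(1,2)])
      then have "\<not> p dvd int (card C)" using pS by (meson dvd_trans int_dvd_int_iff)
      then have "coprime (p ^ N) (int (card C))" using p
        by (simp add: coprime_power_left_iff prime_imp_coprime)
      then have "cdvd (p ^ N) (h * g ^ N)"
        using dv by (simp add: cdvd_def coprime_dvd_mult_right_iff)
      then have "cdvd (p * p ^ N) (sc p * (h * g ^ N))" by (rule cdvd_mult_sc)
      then show "cdvd (p ^ Suc N) (subgroup_sum C * g ^ Suc N)"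
        by (simp add: mult.assoc[symmetric] h)
    qed
  qed
  \<comment> \<open>Any exponent with \<open>p\<^sup>N > |D|\<close> will do.\<close>
  define N where "N = nat \<bar>D\<bar>"
  obtain a where a: "sc D = (\<Sum>C\<in>nontrivial_subgroups S. a C * subgroup_sum C)"
    using D by (auto simp: subgroup_sum_ideal_def)
  have "sc D * g ^ N = (\<Sum>C\<in>nontrivial_subgroups S. a C * (subgroup_sum C * g ^ N))"
    by (simp only: a sum_distrib_right mult.assoc)
  also have "cdvd (p ^ N) \<dots>" by (rule cdvd_sum, rule cdvd_mult_left) (use div in blast)
  finally have Dg: "p ^ N dvd D * cf (g ^ N) x" for x by (simp add: cdvd_def)
  have "\<not> p ^ N dvd D"
  proof
    assume "p ^ N dvd D"
    then have "p ^ N \<le> \<bar>D\<bar>" using dvd_imp_le_int[OF D(1)] abs_ge_self[of "p ^ N"] by fastforce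
    moreover have "\<bar>D\<bar> < 2 ^ N" using of_nat_less_two_power[of N, where ?'a = int] by (simp add: N_def)
    moreover have "(2::int) ^ N \<le> p ^ N" using prime_ge_2_int[OF p] by (intro power_mono) auto
    ultimately show False by linarith
  qed
  then have gp: "cdvd p (g ^ N)"
    unfolding cdvd_def using Dg p
    by (metis coprime_dvd_mult_left_iff coprime_power_left_iff prime_imp_coprime)
  \<comment> \<open>Modulo the left ideal \<open>J\<close> the element \<open>g\<close> is the
    scalar \<open>D\<^sub>0\<close>.\<close>
  have "\<exists>j\<in>?J. g ^ N = sc (D0 ^ N) - j" for N
  proof (induction N)
    case 0
    then show ?case using subgroup_sum_ideal_zero by (intro bexI[of _ 0]) auto
  next
    case (Suc N)
    then obtain j where j: "j \<in> ?J" "g ^ N = sc (D0 ^ N) - j" by blast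
    have "g ^ Suc N = g ^ N * sc D0 - g ^ N * f"
      by (simp only: power_Suc2) (simp add: g_def right_diff_distrib)
    also have "g ^ N * sc D0 = sc D0 * (sc (D0 ^ N) - j)" by (simp only: j(2) sc_commute)
    also have "\<dots> = sc (D0 ^ Suc N) - sc D0 * j" by (simp only: right_diff_distrib mult_single power_Suc) simp
    finally have "g ^ Suc N = sc (D0 ^ Suc N) - (sc D0 * j + g ^ N * f)" by simp
    moreover have "sc D0 * j + g ^ N * f \<in> ?J"
      by (intro subgroup_sum_ideal_add subgroup_sum_ideal_mult S galg_sc gN j f)
    ultimately show ?case by blast
  qed
  then obtain j where "j \<in> ?J" "g ^ N = sc (D0 ^ N) - j" by blast
  moreover have "\<not> p dvd D0 ^ N" using D0 p prime_dvd_power by blast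
  ultimately show ?thesis using gp by metis
qed

section \<open>Fixed-point-free modules\<close>

text \<open>The ring \<open>\<int>[S]\<close> acts on the abelian group \<open>A\<close> through
  conjugation. The image of any element of \<open>A\<close> under \<open>\<sigma>\<^sub>C\<close> is
  fixed by \<open>C\<close> and hence trivial, and \<open>p\<close> annihilates \<open>A\<close> as
  well. So \<open>E\<close>, which is a combination of subgroup sums modulo \<open>p\<close>,
  annihilates \<open>A\<close>; but \<open>E\<close> is prime to \<open>p\<close>.\<close>

lemma fixed_point_free_module_trivial:
  assumes S: "fin_subgroup S" and A: "fin_subgroup A" and comm: "\<And>a b. a \<in> A \<Longrightarrow> b \<in> A \<Longrightarrow> a + b = b + a"
    and normal: "\<And>x a. x \<in> S \<Longrightarrow> a \<in> A \<Longrightarrow> x + a - x \<in> A"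
    and fpf: "\<And>x a. x \<in> S \<Longrightarrow> x \<noteq> 0 \<Longrightarrow> a \<in> A \<Longrightarrow> x + a - x = a \<Longrightarrow> a = 0"
    and p: "Factorial_Ring.prime (p::int)" and torsion: "\<And>a. a \<in> A \<Longrightarrow> a [^]\<^bsub>grp A\<^esub> p = 0"
    and E: "\<not> p dvd E" and j: "j \<in> subgroup_sum_ideal S" "cdvd p (sc E - j)"
  shows "A = {0}"
proof -
  interpret R: group "grp A" by (rule group_grp[OF A])
  interpret R: comm_group "grp A" by unfold_locales (simp add: comm)
  have pow: "y [^]\<^bsub>grp A\<^esub> (n::int) \<in> A" if "y \<in> A" for y n
    using R.int_pow_closed[of y n] that by simp
  have "a = 0" if a: "a \<in> A" for a
  proof -
    \<comment> \<open>The action of a group algebra element on \<open>a\<close>: the sum of the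
      conjugates \<open>x a x\<^sup>-\<^sup>1\<close> with multiplicities
      \<open>f(x)\<close>.\<close>
    define \<Phi> where "\<Phi> f = finprod (grp A) (\<lambda>x. (x + a - x) [^]\<^bsub>grp A\<^esub> cf f x) S" for f :: "'a \<Rightarrow>\<^sub>0 int"
    have Pi: "(\<lambda>x. (x + a - x) [^]\<^bsub>grp A\<^esub> cf f x) \<in> S \<rightarrow> carrier (grp A)" for f :: "'a \<Rightarrow>\<^sub>0 int"
      using normal a pow by auto
    have closed: "\<Phi> f \<in> A" for f using R.finprod_closed[OF Pi[of f]] by (simp add: \<Phi>_def)
    have add: "\<Phi> (f + g) = \<Phi> f + \<Phi> g" for f g
    proof -
      have "\<Phi> (f + g) = finprod (grp A)
          (\<lambda>x. (x + a - x) [^]\<^bsub>grp A\<^esub> cf f x \<otimes>\<^bsub>grp A\<^esub> (x + a - x) [^]\<^bsub>grp A\<^esub> cf g x) S"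
        unfolding \<Phi>_def by (rule R.finprod_cong')
          (use normal a Pi[of f] Pi[of g] R.int_pow_mult in \<open>auto simp: lookup_add Pi_iff fin_subgroupD[OF A]\<close>)
      also have "\<dots> = \<Phi> f + \<Phi> g" using R.finprod_multf[OF Pi[of f] Pi[of g]] by (simp add: \<Phi>_def)
      finally show ?thesis .
    qed
    have zero: "\<Phi> f = 0" if "cdvd p f" for f
    proof -
      have "(x + a - x) [^]\<^bsub>grp A\<^esub> cf f x = \<one>\<^bsub>grp A\<^esub>" if x: "x \<in> S" for x
      proof -
        obtain k where "cf f x = p * k" using \<open>cdvd p f\<close> by (auto simp: cdvd_def)
        then show ?thesis
          using R.int_pow_pow[of "x + a - x" p k] torsion[OF normal[OF x a]] normal[OF x a] R.int_pow_one[of k]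
          by simp
      qed
      then show ?thesis unfolding \<Phi>_def by (subst R.finprod_one_eqI) auto
    qed
    have equivariant: "d + \<Phi> f - d = \<Phi> (sg d 1 * f)" if d: "d \<in> S" for d f
    proof -
      have hom: "group_hom (grp A) (grp A) (\<lambda>u. d + u - d)"
      proof (intro group_hom.intro group_hom_axioms.intro R.is_group homI)
        show "d + (x \<otimes>\<^bsub>grp A\<^esub> y) - d = (d + x - d) \<otimes>\<^bsub>grp A\<^esub> (d + y - d)" for x y
          by (simp add: diff_conv_add_uminus add.assoc del: add_uminus_conv_diff)
      qed (use normal d in auto)
      interpret h: group_hom "grp A" "grp A" "\<lambda>u. d + u - d" by (rule hom)
      have fin: "d + finprod (grp A) g T - d = finprod (grp A) (\<lambda>z. d + g z - d) T"
        if "finite T" "g \<in> T \<rightarrow> A" for g T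
        using that
      proof (induction T rule: finite_induct)
        case empty then show ?case by simp
      next
        case (insert t T)
        have "(\<lambda>z. d + g z - d) \<in> T \<rightarrow> A" using insert.prems normal d by auto
        moreover have "d + g t - d \<in> A" using insert.prems normal d by auto
        moreover have "finprod (grp A) g T \<in> A" using R.finprod_closed[of g T] insert.prems by auto
        ultimately show ?case
          using insert h.hom_mult[of "g t" "finprod (grp A) g T"] by simp
      qed
      have "d + \<Phi> f - d = finprod (grp A) (\<lambda>x. d + ((x + a - x) [^]\<^bsub>grp A\<^esub> cf f x) - d) S"
        unfolding \<Phi>_def by (rule fin) (use Pi[of f] fin_subgroupD[OF S] in auto)
      also have "\<dots> = finprod (grp A) (\<lambda>x. (\<lambda>z. (z + a - z) [^]\<^bsub>grp A\<^esub> cf (sg d 1 * f) z) (d + x)) S"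
      proof (rule R.finprod_cong')
        fix x assume x: "x \<in> S"
        have "d + ((x + a - x) [^]\<^bsub>grp A\<^esub> cf f x) - d = (d + (x + a - x) - d) [^]\<^bsub>grp A\<^esub> cf f x"
          using h.hom_int_pow[of "x + a - x" "cf f x"] normal[OF x a] by simp
        also have "d + (x + a - x) - d = (d + x) + a - (d + x)"
          by (simp add: diff_conv_add_uminus minus_add add.assoc del: add_uminus_conv_diff)
        finally show "d + ((x + a - x) [^]\<^bsub>grp A\<^esub> cf f x) - d
            = (\<lambda>z. (z + a - z) [^]\<^bsub>grp A\<^esub> cf (sg d 1 * f) z) (d + x)"
          by (simp add: cf_sg_mult add.assoc[symmetric])
      qed (use normal a pow d fin_subgroupD[OF S] in auto)
      also have "\<dots> = \<Phi> (sg d 1 * f)"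
        unfolding \<Phi>_def
        using R.finprod_reindex[of "\<lambda>z. (z + a - z) [^]\<^bsub>grp A\<^esub> cf (sg d 1 * f) z" "(+) d" S]
          Pi[of "sg d 1 * f"] bij_betw_left_translation[OF S d] by (simp add: bij_betw_def)
      finally show ?thesis .
    qed
    have sum0: "\<Phi> (sum g I) = 0" if "\<And>i. i \<in> I \<Longrightarrow> \<Phi> (g i) = 0" for g and I :: "'i set"
      using that by (induction I rule: infinite_finite_induct) (auto simp: add zero)
    have "\<Phi> (sg x c * subgroup_sum C) = 0" if x: "x \<in> S" and C: "C \<in> nontrivial_subgroups S" for x c C
    proof -
      note Cs = nontrivial_subgroupsD[OF C]
      obtain e where e: "e \<in> C" "e \<noteq> 0" using Cs by blast
      \<comment> \<open>Left multiplication by \<open>x e x\<^sup>-\<^sup>1\<close> fixes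
        \<open>x \<sigma>\<^sub>C\<close> when \<open>e \<in> C\<close>.\<close>
      define d where "d = x + e - x"
      have dS: "d \<in> S" unfolding d_def using Cs(2) e(1) x by (auto intro!: fin_subgroupD(3,5)[OF S])
      have "d \<noteq> 0"
      proof
        assume "d = 0"
        then have "x + e = x" by (simp add: d_def)
        then show False using add_left_imp_eq[of x e 0] e by simp
      qed
      have "sg d 1 * (sg x c * subgroup_sum C) = sg x c * (sg e 1 * subgroup_sum C)"
        by (simp add: mult.assoc[symmetric] mult_single d_def)
      also have "\<dots> = sg x c * subgroup_sum C" by (simp add: sg_mult_subgroup_sum Cs(1) e)
      finally have "d + \<Phi> (sg x c * subgroup_sum C) - d = \<Phi> (sg x c * subgroup_sum C)"
        by (simp add: equivariant[OF dS])
      then show ?thesis using fpf dS \<open>d \<noteq> 0\<close> closed by blast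
    qed
    then have "\<Phi> (b * subgroup_sum C) = 0" if b: "b \<in> galg S" and C: "C \<in> nontrivial_subgroups S" for b C
      by (subst galg_expand[OF b fin_subgroupD(1)[OF S]])
        (simp add: sum_distrib_right, intro sum0, use C in blast)
    then have "\<Phi> j = 0" using j(1) unfolding subgroup_sum_ideal_def by (auto intro!: sum0)
    moreover have "\<Phi> (sc E) = \<Phi> (sc E - j) + \<Phi> j" using add[of "sc E - j" j] by simp
    ultimately have "\<Phi> (sc E) = 0" using zero[OF j(2)] by simp
    moreover have "\<Phi> (sc E) = a [^]\<^bsub>grp A\<^esub> E"
    proof -
      have "\<Phi> (sc E) = finprod (grp A) (\<lambda>x. if 0 = x then (x + a - x) [^]\<^bsub>grp A\<^esub> E else \<one>\<^bsub>grp A\<^esub>) S"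
        unfolding \<Phi>_def
        by (rule R.finprod_cong') (use normal a pow in \<open>auto simp: lookup_single when_def fin_subgroupD[OF A]\<close>)
      also have "\<dots> = (0 + a - 0) [^]\<^bsub>grp A\<^esub> E"
        by (rule R.finprod_singleton) (use normal a pow fin_subgroupD[OF S] in auto)
      finally show ?thesis by simp
    qed
    ultimately have aE: "a [^]\<^bsub>grp A\<^esub> E = 0" by simp
    have "coprime p E" using p E by (simp add: prime_imp_coprime)
    then obtain u v where uv: "p * u + E * v = 1" 
      by (metis bezout_int coprime_iff_gcd_eq_1 mult.commute)
    have "a = a [^]\<^bsub>grp A\<^esub> (p * u + E * v)" using a uv by simp
    also have "\<dots> = (a [^]\<^bsub>grp A\<^esub> p) [^]\<^bsub>grp A\<^esub> u + (a [^]\<^bsub>grp A\<^esub> E) [^]\<^bsub>grp A\<^esub> v"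
      using a by (simp add: R.int_pow_mult R.int_pow_pow)
    also have "\<dots> = 0" using torsion[OF a] aE R.int_pow_one[of u] R.int_pow_one[of v] by simp
    finally show "a = 0" .
  qed
  then show ?thesis using fin_subgroupD(2)[OF A] by blast
qed

section \<open>Primitive idempotents\<close>

lemma sc_mult_eq_0_iff: "sc c * f = 0 \<longleftrightarrow> c = 0 \<or> f = 0"
  for f :: "'g::group_add \<Rightarrow>\<^sub>0 'k::idom"
proof
  assume z: "sc c * f = 0"
  have "cf f y = 0" if "c \<noteq> 0" for y
    using arg_cong[where f = "\<lambda>u. cf u y", OF z] that by simp
  then show "c = 0 \<or> f = 0" by (auto intro: poly_mapping_eqI)
qed auto

text \<open>The dimension of \<open>k[S]\<close> is \<open>|S|\<close>, in the form in which it
  bounds the size of independent families.\<close>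

lemma linear_dependence:
  fixes v :: "'i \<Rightarrow> ('g::group_add \<Rightarrow>\<^sub>0 'k::field)"
  assumes "finite S" "finite I" "card S < card I" "\<And>i. i \<in> I \<Longrightarrow> v i \<in> galg S"
  shows "\<exists>c. (\<exists>i\<in>I. c i \<noteq> 0) \<and> (\<Sum>i\<in>I. sc (c i) * v i) = 0"
  using assms
proof (induction S arbitrary: I v rule: finite_induct)
  case empty
  then obtain i where i: "i \<in> I" by fastforce
  have "v i = 0" if "i \<in> I" for i using empty(3)[OF that] by (intro poly_mapping_eqI) (auto simp: galg_def)
  then show ?case using i by (intro exI[of _ "\<lambda>_. 1"]) auto
next
  case (insert s S)
  show ?case
  proof (cases "\<forall>i\<in>I. cf (v i) s = 0")
    case True
    have "v i \<in> galg S" if "i \<in> I" for i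
      using insert.prems(3)[OF that] True that by (auto simp: galg_def)
    then show ?thesis using insert.IH[of I v] insert.prems insert.hyps by simp
  next
    case False
    then obtain i0 where i0: "i0 \<in> I" "cf (v i0) s \<noteq> 0" by blast
    define r where "r i = cf (v i) s / cf (v i0) s" for i
    define w where "w i = v i - sc (r i) * v i0" for i
    have "w i \<in> galg S" if "i \<in> I" for i
      unfolding galg_def
    proof (intro CollectI allI impI)
      fix x assume x: "cf (w i) x \<noteq> 0"
      have "cf (w i) s = 0" using i0 by (simp add: w_def r_def lookup_minus)
      moreover have "x \<in> insert s S"
        using x insert.prems(3)[OF that] insert.prems(3)[OF i0(1)]
        by (cases "cf (v i0) x = 0") (auto simp: w_def lookup_minus galg_def)
      ultimately show "x \<in> S" using x by auto
    qed
    moreover have "card S < card (I - {i0})" using insert i0 by simp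
    ultimately obtain c where c: "\<exists>i\<in>I - {i0}. c i \<noteq> 0" "(\<Sum>i\<in>I - {i0}. sc (c i) * w i) = 0"
      using insert.IH[of "I - {i0}" w] insert.prems by auto
    define c' where "c' = c(i0 := - (\<Sum>i\<in>I - {i0}. c i * r i))"
    have "(\<Sum>i\<in>I. sc (c' i) * v i) = sc (c' i0) * v i0 + (\<Sum>i\<in>I - {i0}. sc (c' i) * v i)"
      using i0 insert.prems by (simp add: sum.remove)
    also have "(\<Sum>i\<in>I - {i0}. sc (c' i) * v i) = (\<Sum>i\<in>I - {i0}. sc (c i) * w i + sc (c i * r i) * v i0)"
      by (rule sum.cong) (auto simp: c'_def w_def right_diff_distrib sc_mult_sc)
    also have "\<dots> = sc (\<Sum>i\<in>I - {i0}. c i * r i) * v i0"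
      by (intro poly_mapping_eqI) (simp add: sum.distrib c(2) lookup_sum sum_distrib_right)
    finally have "(\<Sum>i\<in>I. sc (c' i) * v i) = 0"
      by (simp add: c'_def single_uminus)
    moreover have "\<exists>i\<in>I. c' i \<noteq> 0" using c(1) by (auto simp: c'_def)
    ultimately show ?thesis by blast
  qed
qed

text \<open>Applies a multiplication law inside products that are associated to the right.\<close>

lemma absorb: "a * b = c \<Longrightarrow> a * (b * z) = c * z" for a :: "'r::semigroup_mult"
  by (simp add: mult.assoc[symmetric])

text \<open>Over the complex numbers a nonzero idempotent \<open>e\<close> generates a minimal
  left ideal exactly if the corner algebra \<open>e \<complex>[S] e\<close> consists of the
  multiples of \<open>e\<close>.\<close>

definition primitive :: "'g::group_add set \<Rightarrow> ('g \<Rightarrow>\<^sub>0 complex) \<Rightarrow> bool" where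
  "primitive S e \<longleftrightarrow> e \<in> galg S \<and> e * e = e \<and> e \<noteq> 0 \<and> (\<forall>a\<in>galg S. \<exists>c. e * a * e = sc c * e)"

lemma primitiveD:
  assumes "primitive S e"
  shows "e \<in> galg S" "e * e = e" "e \<noteq> 0" "a \<in> galg S \<Longrightarrow> \<exists>c. e * a * e = sc c * e"
  using assms by (auto simp: primitive_def)

lemma maschke_complex:
  fixes L :: "('g::group_add \<Rightarrow>\<^sub>0 complex) set"
  assumes S: "fin_subgroup S"
    and L: "L \<subseteq> galg S" "0 \<in> L" "\<And>f g. f \<in> L \<Longrightarrow> g \<in> L \<Longrightarrow> f + g \<in> L"
    and ideal: "\<And>a f. a \<in> galg S \<Longrightarrow> f \<in> L \<Longrightarrow> a * f \<in> L"
  obtains f where "f \<in> L" "\<And>j. j \<in> L \<Longrightarrow> j * f = j"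
proof -
  obtain D f where D: "\<not> 0 dvd D" "f \<in> L" and eq: "\<And>j. j \<in> L \<Longrightarrow> cdvd 0 (j * f - sc D * j)"
    using maschke[of S 0 L, OF S _ _ _ L ideal] fin_subgroup_card_pos[OF S] by auto
  have "sc (1 / D) * f \<in> L" by (intro ideal galg_sc S D)
  moreover have "j * (sc (1 / D) * f) = j" if "j \<in> L" for j
    using eq[OF that] D by (simp add: sc_mult_assoc[of j] sc_mult_sc)
  ultimately show ?thesis using that by blast
qed

text \<open>The powers of \<open>x\<close> are linearly dependent, so a nonzero polynomial
  vanishes at \<open>x\<close>. Splitting off linear factors \<open>X - l\<close> until the cofactor
  no longer vanishes at \<open>x\<close>, the value of this cofactor is an eigenvector for
  \<open>l\<close>.\<close>

lemma eigenvector_in_corner: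
  fixes e x :: "'g::group_add \<Rightarrow>\<^sub>0 complex"
  assumes S: "fin_subgroup S" and e: "e \<in> galg S" "e * e = e" "e \<noteq> 0"
    and x: "x \<in> galg S" "e * x = x" "x * e = x"
  shows "\<exists>l b. b \<in> galg S \<and> b \<noteq> 0 \<and> b * e = b \<and> b * x = sc l * b"
proof -
  \<comment> \<open>Evaluation of polynomials at \<open>x\<close> in the corner algebra, whose
    unit is \<open>e\<close>.\<close>
  define ev where "ev q = (\<Sum>i\<le>degree q. sc (coeff q i) * (e * x ^ i))" for q :: "complex poly"
  have ev: "ev q = (\<Sum>i\<le>n. sc (coeff q i) * (e * x ^ i))" if "degree q \<le> n" for q n
    unfolding ev_def by (rule sum.mono_neutral_left) (use that in \<open>auto simp: coeff_eq_0\<close>)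
  have xpow: "x ^ i \<in> galg S" for i
    by (induction i) (auto intro: galg_one galg_mult S x)
  have xpow_e: "e * x ^ i * e = e * x ^ i" for i
    by (cases i) (auto simp: e power_Suc2 mult.assoc x simp del: power_Suc)
  have step: "ev ([:-l, 1:] * r) = ev r * x - sc l * ev r" for l r
  proof -
    let ?n = "degree r"
    have eq: "[:-l, 1:] * r = pCons 0 r - smult l r" by simp
    have deg: "degree ([:-l, 1:] * r) \<le> Suc ?n"
      by (rule order.trans[OF degree_mult_le]) simp
    have "ev ([:-l, 1:] * r) = (\<Sum>i\<le>Suc ?n. sc (coeff (pCons 0 r) i) * (e * x ^ i) - sc l * (sc (coeff r i) * (e * x ^ i)))"
      unfolding ev[OF deg] unfolding eq
      by (intro sum.cong refl) (simp add: single_diff left_diff_distrib sc_mult_sc)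
    also have "\<dots> = (\<Sum>i\<le>Suc ?n. sc (coeff (pCons 0 r) i) * (e * x ^ i)) - sc l * ev r"
      by (simp only: sum_subtractf ev[of r "Suc ?n", OF le_SucI[OF order_refl]] sum_distrib_left)
    also have "(\<Sum>i\<le>Suc ?n. sc (coeff (pCons 0 r) i) * (e * x ^ i)) = ev r * x"
      by (simp only: sum.atMost_Suc_shift)
        (simp add: ev_def sum_distrib_right mult.assoc power_Suc2 del: power_Suc)
    finally show ?thesis .
  qed
  have main: "ev q = 0 \<Longrightarrow> q \<noteq> 0 \<Longrightarrow> \<exists>l b. b \<in> galg S \<and> b \<noteq> 0 \<and> b * e = b \<and> b * x = sc l * b" for q
  proof (induction "degree q" arbitrary: q rule: less_induct)
    case less
    show ?case
    proof (cases "degree q = 0")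
      case True
      then obtain c where "q = [:c:]" by (metis degree_eq_zeroE)
      then have "sc c * e = 0" "c \<noteq> 0" using less.prems by (auto simp: ev_def)
      then show ?thesis using e(3) by (simp add: sc_mult_eq_0_iff)
    next
      case False
      then have "\<not> constant (poly q)" by (simp add: constant_degree)
      then obtain l where "poly q l = 0" using fundamental_theorem_of_algebra by blast
      then obtain r where r: "q = [:-l, 1:] * r" by (metis poly_eq_0_iff_dvd dvdE)
      have r0: "r \<noteq> 0" using less.prems r by auto
      have dr: "degree r < degree q" using r0 unfolding r by (subst degree_mult_eq) auto
      show ?thesis
      proof (cases "ev r = 0")
        case True
        then show ?thesis using less.hyps[OF dr True r0] by blast
      next
        case False
        have "ev r * x = sc l * ev r" using step[of l r] less.prems(1) by (simp add: r)
        moreover have "ev r \<in> galg S" unfolding ev_def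
          by (intro galg_sum galg_mult S galg_sc e xpow)
        moreover have "ev r * e = ev r"
          unfolding ev_def sum_distrib_right by (intro sum.cong refl) (simp add: mult.assoc xpow_e[unfolded mult.assoc])
        ultimately show ?thesis using False by blast
      qed
    qed
  qed
  have "\<exists>c. (\<exists>i\<in>{..card S}. c i \<noteq> 0) \<and> (\<Sum>i\<in>{..card S}. sc (c i) * (e * x ^ i)) = 0"
    by (rule linear_dependence[of S]) (auto intro: galg_mult S e xpow fin_subgroupD(1)[OF S])
  then obtain c where c: "\<exists>i\<le>card S. c i \<noteq> 0" "(\<Sum>i\<le>card S. sc (c i) * (e * x ^ i)) = 0" by auto
  define q where "q = (\<Sum>i\<le>card S. monom (c i) i)"
  have cq: "coeff q i = (if i \<le> card S then c i else 0)" for i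
    by (simp add: q_def coeff_sum)
  have dq: "degree q \<le> card S" by (rule degree_le) (simp add: cq)
  have "ev q = 0" using c(2) by (simp add: ev[OF dq] cq)
  moreover have "q \<noteq> 0" using c(1) cq by (metis coeff_0)
  ultimately show ?thesis using main by blast
qed

text \<open>If \<open>x = e a e\<close> is not a multiple of \<open>e\<close>, the elements
  \<open>b\<close> of \<open>\<complex>[S] e\<close> with \<open>b x = l b\<close>, for an
  eigenvalue \<open>l\<close>, form a nonzero left ideal that differs from \<open>\<complex>[S]
  e\<close>. By Maschke's theorem it is generated by an idempotent.\<close>

lemma idempotent_splits:
  assumes S: "fin_subgroup S" and e: "e \<in> galg S" "e * e = e" "e \<noteq> 0" and np: "\<not> primitive S e"
  obtains g where "g \<in> galg S" "g * g = g" "e * g = g" "g * e = g" "g \<noteq> 0" "g \<noteq> e"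
proof -
  obtain a where a: "a \<in> galg S" "\<And>c. e * a * e \<noteq> sc c * e" using np e by (auto simp: primitive_def)
  define x where "x = e * a * e"
  have xS: "x \<in> galg S" unfolding x_def by (intro galg_mult S e a)
  have ex: "e * x = x" unfolding x_def by (simp add: mult.assoc absorb[OF e(2)])
  have xe: "x * e = x" unfolding x_def by (simp add: mult.assoc e(2))
  obtain l b where b: "b \<in> galg S" "b \<noteq> 0" "b * e = b" "b * x = sc l * b"
    using eigenvector_in_corner[OF S e xS ex xe] by blast
  define L where "L = {b \<in> galg S. b * e = b \<and> b * x = sc l * b}"
  obtain f where f: "f \<in> L" "\<And>j. j \<in> L \<Longrightarrow> j * f = j"
  proof (rule maschke_complex[OF S, of L])
    show "c * f \<in> L" if "c \<in> galg S" "f \<in> L" for c f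
    proof -
      have "c * f * x = sc l * (c * f)"
        using that by (simp add: L_def mult.assoc sc_mult_assoc)
      then show ?thesis using that by (auto simp: L_def mult.assoc intro: galg_mult S)
    qed
  qed (auto simp: L_def distrib_left distrib_right intro: galg_add)
  define g where "g = e * f"
  have gL: "g \<in> galg S" "g * x = sc l * g" "g * e = g"
    using f(1) by (auto simp: g_def L_def mult.assoc sc_mult_assoc intro: galg_mult S e)
  have fe: "f * e = f" and ff: "f * f = f" using f by (auto simp: L_def)
  have "g * g = g" unfolding g_def by (simp add: mult.assoc absorb[OF fe] ff)
  moreover have "e * g = g" unfolding g_def by (simp add: absorb[OF e(2)])
  moreover have "g \<noteq> 0"
  proof
    assume "g = 0"
    have "b * f = b" using f(2)[of b] b by (auto simp: L_def)
    then have "b * g = b" unfolding g_def by (simp add: absorb[OF b(3)])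
    then show False using b(2) \<open>g = 0\<close> by simp
  qed
  moreover have "g \<noteq> e" using gL(2) ex a(2)[of l] unfolding x_def[symmetric] by auto
  ultimately show ?thesis using that gL by blast
qed

definition orthogonal_idempotents ::
  "'g::group_add set \<Rightarrow> ('g \<Rightarrow>\<^sub>0 complex) \<Rightarrow> ('g \<Rightarrow>\<^sub>0 complex) set \<Rightarrow> bool" where
  "orthogonal_idempotents S e F \<longleftrightarrow> finite F \<and> (\<forall>E\<in>F. E \<in> galg S \<and> E * E = E \<and> E \<noteq> 0) \<and>
     (\<forall>E\<in>F. \<forall>E'\<in>F. E \<noteq> E' \<longrightarrow> E * E' = 0) \<and> \<Sum>F = e"

lemma orthogonal_idempotents_card:
  assumes S: "fin_subgroup S" and F: "orthogonal_idempotents S e F"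
  shows "card F \<le> card S"
proof (rule ccontr)
  assume "\<not> card F \<le> card S"
  then have "\<exists>c. (\<exists>E\<in>F. c E \<noteq> 0) \<and> (\<Sum>E\<in>F. sc (c E) * E) = 0"
    by (intro linear_dependence[of S] fin_subgroupD(1)[OF S]) (use F in \<open>auto simp: orthogonal_idempotents_def\<close>)
  then obtain c E where c: "E \<in> F" "c E \<noteq> 0" "(\<Sum>E\<in>F. sc (c E) * E) = 0" by blast
  have "(\<Sum>E'\<in>F. sc (c E') * E') * E = (\<Sum>E'\<in>F. if E' = E then sc (c E) * E else 0)"
    unfolding sum_distrib_right
    by (rule sum.cong) (use F c(1) in \<open>auto simp: orthogonal_idempotents_def mult.assoc\<close>)
  then have "sc (c E) * E = 0" using c F by (simp add: orthogonal_idempotents_def)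
  moreover have "E \<noteq> 0" using F c(1) by (auto simp: orthogonal_idempotents_def)
  ultimately show False using c(2) by (simp add: sc_mult_eq_0_iff)
qed

text \<open>In a family of orthogonal idempotents with sum \<open>e\<close> of maximal size, no
  member can be split.\<close>

lemma primitive_decomposition:
  assumes S: "fin_subgroup S" and e: "e \<in> galg S" "e * e = e"
  obtains F where "finite F" "\<And>E. E \<in> F \<Longrightarrow> primitive S E"
    "\<And>E E'. E \<in> F \<Longrightarrow> E' \<in> F \<Longrightarrow> E \<noteq> E' \<Longrightarrow> E * E' = 0" "\<Sum>F = e"
proof -
  have "orthogonal_idempotents S e ({e} - {0})" using e by (cases "e = 0") (auto simp: orthogonal_idempotents_def)
  then obtain F where F: "orthogonal_idempotents S e F"
    and max: "\<And>F'. orthogonal_idempotents S e F' \<Longrightarrow> card F' \<le> card F"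
    using ex_has_greatest_nat[of "orthogonal_idempotents S e" _ card "card S + 1"]
      orthogonal_idempotents_card[OF S] by (metis le_imp_less_Suc Suc_eq_plus1)
  note F' = F[unfolded orthogonal_idempotents_def]
  have "primitive S E" if E: "E \<in> F" for E
  proof (rule ccontr)
    assume np: "\<not> primitive S E"
    obtain g where g: "g \<in> galg S" "g * g = g" "E * g = g" "g * E = g" "g \<noteq> 0" "g \<noteq> E"
      using idempotent_splits[OF S _ _ _ np] F' E by blast
    have orth: "g * E' = 0" "E' * g = 0" "(E - g) * E' = 0" "E' * (E - g) = 0" if "E' \<in> F - {E}" for E'
    proof -
      have "E * E' = 0" "E' * E = 0" using F' E that by auto
      then show "g * E' = 0" "E' * g = 0"
        using absorb[OF g(4), of E'] absorb[OF \<open>E' * E = 0\<close>, of g] by (simp_all add: g(3))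
      then show "(E - g) * E' = 0" "E' * (E - g) = 0" using \<open>E * E' = 0\<close> \<open>E' * E = 0\<close>
        by (simp_all add: left_diff_distrib right_diff_distrib)
    qed
    have EE: "E * E = E" "E \<in> galg S" using F' E by auto
    have h: "(E - g) * (E - g) = E - g" "g * (E - g) = 0" "(E - g) * g = 0" "E - g \<in> galg S"
      using g EE by (auto simp: left_diff_distrib right_diff_distrib intro: galg_diff)
    have notin: "g \<notin> F - {E}" "E - g \<notin> F - {E}" "g \<noteq> E - g"
      using orth(1)[of g] orth(3)[of "E - g"] h g by auto
    have "orthogonal_idempotents S e (insert g (insert (E - g) (F - {E})))"
      unfolding orthogonal_idempotents_def
    proof (intro conjI)
      have "\<Sum>(insert g (insert (E - g) (F - {E}))) = g + ((E - g) + \<Sum>(F - {E}))"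
        using notin F' by simp
      also have "\<dots> = \<Sum>F" using sum.remove[of F E "\<lambda>x. x"] F' E by simp
      finally show "\<Sum>(insert g (insert (E - g) (F - {E}))) = e" using F' by simp
    qed (use F' g h orth in auto)
    from max[OF this] have "card (insert g (insert (E - g) (F - {E}))) \<le> card F" .
    moreover have "card (insert g (insert (E - g) (F - {E}))) = Suc (Suc (card (F - {E})))"
      using notin F' by simp
    moreover have "card F = Suc (card (F - {E}))" using F' E by (metis card.remove)
    ultimately show False by simp
  qed
  then show ?thesis using that[of F] F' by blast
qed

section \<open>Class sums and multiplicities\<close>

text \<open>The number \<open>pairing S x y\<close> is the sum of the \<open>(h x
  h\<^sup>-\<^sup>1 y)(0)\<close> over \<open>h \<in> S\<close>, which is the trace of the operator
  \<open>u \<mapsto> x u y\<close> on \<open>\<complex>[S]\<close>. For idempotents it is the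
  dimension of \<open>x \<complex>[S] y\<close>, that is, of the space of homomorphisms from
  \<open>\<complex>[S] x\<close> to \<open>\<complex>[S] y\<close>; it plays the part of the inner
  product of the characters of these modules.\<close>

definition class_sum :: "'g::group_add set \<Rightarrow> ('g \<Rightarrow>\<^sub>0 complex) \<Rightarrow> ('g \<Rightarrow>\<^sub>0 complex)" where
  "class_sum S x = (\<Sum>h\<in>S. sg h 1 * x * sg (- h) 1)"

definition pairing :: "'g::group_add set \<Rightarrow> ('g \<Rightarrow>\<^sub>0 complex) \<Rightarrow> ('g \<Rightarrow>\<^sub>0 complex) \<Rightarrow> complex" where
  "pairing S x y = cf (class_sum S x * y) 0"

lemma class_sum_galg: "fin_subgroup S \<Longrightarrow> x \<in> galg S \<Longrightarrow> class_sum S x \<in> galg S"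
  unfolding class_sum_def by (intro galg_sum galg_mult galg_sg) (auto intro: fin_subgroupD)

lemma class_sum_add: "class_sum S (x + y) = class_sum S x + class_sum S y"
  by (simp add: class_sum_def distrib_left distrib_right sum.distrib)

lemma class_sum_diff: "class_sum S (x - y) = class_sum S x - class_sum S y"
  by (simp add: class_sum_def left_diff_distrib right_diff_distrib sum_subtractf)

lemma class_sum_sum: "class_sum S (sum f I) = (\<Sum>i\<in>I. class_sum S (f i))"
  unfolding class_sum_def sum_distrib_left sum_distrib_right by (rule sum.swap)

lemma class_sum_sc: "class_sum S (sc c * x) = sc c * class_sum S x"
  by (simp add: class_sum_def sum_distrib_left mult.assoc sc_mult_assoc)

lemma class_sum_central:
  assumes S: "fin_subgroup S" and y: "y \<in> galg S"
  shows "class_sum S x * y = y * class_sum S x"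
proof -
  have "sg t c * class_sum S x = class_sum S x * sg t c" if t: "t \<in> S" for t c
  proof -
    have "sg t 1 * class_sum S x = (\<Sum>h\<in>S. sg (t + h) 1 * x * sg (- (t + h)) 1 * sg t 1)"
      unfolding class_sum_def sum_distrib_left
      by (intro sum.cong refl) (simp add: mult.assoc mult_single sg_mult_sg minus_add)
    also have "\<dots> = class_sum S x * sg t 1"
      using sum_left_translate[OF S t, of "\<lambda>h. sg h 1 * x * sg (- h) 1 * sg t 1"]
      by (simp add: class_sum_def sum_distrib_right)
    finally show ?thesis
      by (simp only: sg_eq_sc_mult[of t c] mult.assoc sc_mult_assoc[of "class_sum S x"])
  qed
  then show ?thesis
    by (subst (1 2) galg_expand[OF y fin_subgroupD(1)[OF S]]) (simp add: sum_distrib_left sum_distrib_right)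
qed

lemma class_sum_of_central:
  assumes S: "fin_subgroup S" and z: "\<And>h. h \<in> S \<Longrightarrow> sg h 1 * z = z * sg h 1"
  shows "class_sum S z = of_nat (card S) * z"
proof -
  have "class_sum S z = (\<Sum>h\<in>S. z)"
    unfolding class_sum_def by (intro sum.cong refl) (simp add: z mult.assoc mult_single)
  then show ?thesis by simp
qed

lemma pairing_linear:
  "pairing S (x + x') y = pairing S x y + pairing S x' y"
  "pairing S (x - x') y = pairing S x y - pairing S x' y"
  "pairing S (sc c * x) y = c * pairing S x y"
  "pairing S (sum f I) y = (\<Sum>i\<in>I. pairing S (f i) y)"
  "pairing S x (y + y') = pairing S x y + pairing S x y'"
  "pairing S x (y - y') = pairing S x y - pairing S x y'"
  "pairing S x (sc c * y) = c * pairing S x y"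
  "pairing S x (sum f I) = (\<Sum>i\<in>I. pairing S x (f i))"
  by (simp_all add: pairing_def class_sum_add class_sum_diff class_sum_sc class_sum_sum distrib_left
      distrib_right left_diff_distrib right_diff_distrib sum_distrib_left sum_distrib_right mult.assoc
      sc_mult_assoc lookup_add lookup_minus lookup_sum)

lemma pairing_commute:
  assumes S: "fin_subgroup S" and x: "x \<in> galg S" and y: "y \<in> galg S"
  shows "pairing S x y = pairing S y x"
proof -
  have "pairing S x y = (\<Sum>h\<in>S. cf (sg h 1 * x * sg (- h) 1 * y) 0)"
    by (simp add: pairing_def class_sum_def sum_distrib_right lookup_sum)
  also have "\<dots> = (\<Sum>h\<in>S. cf (sg (- h) 1 * y * sg (- (- h)) 1 * x) 0)"
  proof (intro sum.cong refl)
    fix h assume "h \<in> S"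
    then have "cf ((sg h 1 * x) * (sg (- h) 1 * y)) 0 = cf ((sg (- h) 1 * y) * (sg h 1 * x)) 0"
      by (intro cf_mult_commute_zero[OF S] galg_mult S galg_sg x y fin_subgroupD(4)[OF S])
    then show "cf (sg h 1 * x * sg (- h) 1 * y) 0 = cf (sg (- h) 1 * y * sg (- (- h)) 1 * x) 0"
      by (simp add: mult.assoc)
  qed
  also have "\<dots> = (\<Sum>h\<in>S. cf (sg h 1 * y * sg (- h) 1 * x) 0)"
    by (rule sum_invert[OF S, of "\<lambda>h. cf (sg h 1 * y * sg (- h) 1 * x) 0"])
  also have "\<dots> = pairing S y x"
    by (simp add: pairing_def class_sum_def sum_distrib_right lookup_sum)
  finally show ?thesis .
qed

lemma primitive_trace_nonzero:
  assumes S: "fin_subgroup S" and E: "primitive S E" shows "cf E 0 \<noteq> 0"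
proof -
  note E' = primitiveD[OF E]
  obtain y where y: "y \<in> galg S" "cf (E * y) 0 \<noteq> 0"
    using trace_form_nondegenerate[OF S E'(1,3)] by blast
  obtain c where c: "E * y * E = sc c * E" using E'(4)[OF y(1)] by blast
  have "cf (E * y) 0 = cf (E * (E * y)) 0" by (simp add: mult.assoc[symmetric] E')
  also have "\<dots> = cf (E * y * E) 0" by (intro cf_mult_commute_zero[OF S] galg_mult S E' y)
  also have "\<dots> = c * cf E 0" by (simp add: c)
  finally show ?thesis using y(2) by auto
qed

text \<open>A central element maps the corner of \<open>E\<close> into itself, so it acts on
  \<open>E\<close> as a scalar, which is found by taking traces.\<close>

lemma central_acts_by_scalar:
  assumes S: "fin_subgroup S" and E: "primitive S E" and z: "z \<in> galg S" "z * E = E * z"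
  shows "z * E = sc (cf (z * E) 0 / cf E 0) * E"
proof -
  note E' = primitiveD[OF E]
  obtain c where "E * z * E = sc c * E" using E'(4)[OF z(1)] by blast
  then have c: "z * E = sc c * E" using z(2) by (simp add: mult.assoc absorb[OF E'(2)] E'(2))
  then have "cf (z * E) 0 = c * cf E 0" by simp
  then show ?thesis using c primitive_trace_nonzero[OF S E] by simp
qed

text \<open>Schur's lemma. If \<open>E a F\<close> is nonzero for some \<open>a\<close>,
  nondegeneracy of the trace form gives \<open>b \<in> E \<complex>[S] F\<close> and \<open>c \<in>
  F \<complex>[S] E\<close> with \<open>b c = E\<close> and \<open>c b = F\<close>. Every \<open>E d
  F\<close> is then the multiple \<open>(d c)(0) / E(0)\<close> of \<open>b\<close>, every \<open>F
  d E\<close> is the multiple \<open>(b d)(0) / E(0)\<close> of \<open>c\<close>, and the terms of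
  the pairing add up to \<open>(b c)(0) / E(0) = 1\<close>.\<close>

lemma pairing_primitive:
  assumes S: "fin_subgroup S" and E: "primitive S E" and F: "primitive S F"
  shows "(pairing S E F = 0 \<and> (\<forall>a\<in>galg S. E * a * F = 0)) \<or> (pairing S E F = 1 \<and> (\<exists>b\<in>galg S. \<exists>c\<in>galg S. b * c = E \<and> c * b = F))"
proof -
  note E' = primitiveD[OF E] and F' = primitiveD[OF F]
  \<comment> \<open>Inserting \<open>E\<close> and \<open>F\<close> puts every term into the
    form \<open>E d F\<close> times \<open>F d' E\<close>.\<close>
  have expand: "pairing S E F = (\<Sum>h\<in>S. cf ((E * sg (- h) 1 * F) * (F * sg h 1 * E)) 0)"
  proof -
    have "pairing S E F = pairing S F E" by (rule pairing_commute[OF S E'(1) F'(1)])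
    also have "\<dots> = (\<Sum>h\<in>S. cf (sg h 1 * F * sg (- h) 1 * E) 0)"
      by (simp add: pairing_def class_sum_def sum_distrib_right lookup_sum)
    also have "\<dots> = (\<Sum>h\<in>S. cf (sg (- h) 1 * F * sg h 1 * E) 0)"
      using sum_invert[OF S, of "\<lambda>h. cf (sg h 1 * F * sg (- h) 1 * E) 0"] by simp
    also have "\<dots> = (\<Sum>h\<in>S. cf ((E * sg (- h) 1 * F) * (F * sg h 1 * E)) 0)"
    proof (intro sum.cong refl)
      fix h assume h: "h \<in> S"
      have "cf (sg (- h) 1 * F * sg h 1 * E) 0 = cf ((sg (- h) 1 * F * sg h 1 * E) * E) 0"
        using E'(2) by (simp add: mult.assoc)
      also have "\<dots> = cf (E * (sg (- h) 1 * F * sg h 1 * E)) 0"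
        by (intro cf_mult_commute_zero[OF S] galg_mult S E' F' galg_sg fin_subgroupD(4)[OF S] h)
      also have "E * (sg (- h) 1 * F * sg h 1 * E) = (E * sg (- h) 1 * F) * (F * sg h 1 * E)"
        by (simp add: mult.assoc absorb[OF F'(2)])
      finally show "cf (sg (- h) 1 * F * sg h 1 * E) 0 = cf ((E * sg (- h) 1 * F) * (F * sg h 1 * E)) 0" .
    qed
    finally show ?thesis .
  qed
  show ?thesis
  proof (cases "\<forall>a\<in>galg S. E * a * F = 0")
    case True
    then have "pairing S E F = 0"
      unfolding expand by (intro sum.neutral ballI) (simp add: galg_sg fin_subgroupD(4)[OF S])
    then show ?thesis using True by blast
  next
    case False
    then obtain a where a: "a \<in> galg S" "E * a * F \<noteq> 0" by blast
    define b where "b = E * a * F"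
    have b: "b \<in> galg S" "E * b = b" "b * F = b" "b \<noteq> 0"
      using a E' F' unfolding b_def by (auto intro: galg_mult S simp: mult.assoc absorb[OF E'(2)])
    obtain y where y: "y \<in> galg S" "cf (b * y) 0 \<noteq> 0"
      using trace_form_nondegenerate[OF S b(1,4)] by blast
    define c0 where "c0 = F * y * E"
    have c0: "c0 \<in> galg S" "F * c0 = c0" "c0 * E = c0"
      using y E' F' unfolding c0_def by (auto intro: galg_mult S simp: mult.assoc absorb[OF F'(2)])
    have bc0: "b * c0 = b * y * E" unfolding c0_def by (simp add: mult.assoc absorb[OF b(3)])
    have "cf (b * c0) 0 = cf (E * (b * y)) 0" unfolding bc0
      by (intro cf_mult_commute_zero[OF S] galg_mult S b y E')
    also have "\<dots> = cf (b * y) 0" by (simp add: mult.assoc[symmetric] b)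
    finally have "b * c0 \<noteq> 0" using y(2) by auto
    moreover obtain m where m: "b * c0 = sc m * E"
    proof -
      obtain m where "E * (b * y) * E = sc m * E" using E'(4)[OF galg_mult[OF S b(1) y(1)]] by blast
      then show ?thesis using that by (simp add: mult.assoc bc0 absorb[OF b(2)])
    qed
    ultimately have m0: "m \<noteq> 0" by auto
    define c where "c = sc (1 / m) * c0"
    have c: "c \<in> galg S" "F * c = c" "c * E = c"
      using c0 by (auto simp: c_def mult.assoc sc_mult_assoc intro: galg_mult galg_sc S)
    have bc: "b * c = E" using m m0 by (simp add: c_def sc_mult_assoc[of b] sc_mult_sc)
    obtain n where n: "c * b = sc n * F"
    proof -
      obtain n where "F * (c * b) * F = sc n * F" using F'(4)[OF galg_mult[OF S c(1) b(1)]] by blast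
      then show ?thesis using that by (simp add: mult.assoc absorb[OF c(2)] b(3))
    qed
    have "b = (b * c) * b" using bc b(2) by simp
    also have "\<dots> = b * (c * b)" by (rule mult.assoc)
    also have "\<dots> = sc n * b" by (simp add: n sc_mult_assoc b(3))
    finally have "sc (1 - n) * b = 0" by (simp add: single_diff left_diff_distrib)
    then have "n = 1" using b(4) by (simp add: sc_mult_eq_0_iff)
    then have cb: "c * b = F" using n by simp
    have E0: "cf E 0 \<noteq> 0" by (rule primitive_trace_nonzero[OF S E])
    have EhF: "E * d * F = sc (cf (d * c) 0 / cf E 0) * b" if d: "d \<in> galg S" for d
    proof -
      obtain t where t: "E * (d * c) * E = sc t * E" using E'(4)[OF galg_mult[OF S d c(1)]] by blast
      have "t * cf E 0 = cf (E * (d * c) * E) 0" by (simp add: t)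
      also have "\<dots> = cf (E * (E * (d * c))) 0"
        by (intro cf_mult_commute_zero[OF S] galg_mult S E' d c)
      also have "\<dots> = cf (E * (d * c)) 0" by (simp add: mult.assoc[symmetric] E')
      also have "\<dots> = cf ((d * c) * E) 0" by (intro cf_mult_commute_zero[OF S] galg_mult S E' d c)
      also have "\<dots> = cf (d * c) 0" by (simp add: mult.assoc c)
      finally have "t = cf (d * c) 0 / cf E 0" using E0 by (simp add: field_simps)
      moreover have "E * d * F = (E * (d * c) * E) * b"
        by (simp add: mult.assoc absorb[OF c(3)] b(2) cb)
      ultimately show ?thesis by (simp only: t) (simp add: mult.assoc b(2))
    qed
    have FhE: "F * d * E = sc (cf (b * d) 0 / cf E 0) * c" if d: "d \<in> galg S" for d
    proof -
      obtain t where t: "E * (b * d) * E = sc t * E" using E'(4)[OF galg_mult[OF S b(1) d]] by blast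
      have "t * cf E 0 = cf (E * (b * d) * E) 0" by (simp add: t)
      also have "\<dots> = cf (E * (E * (b * d))) 0"
        by (intro cf_mult_commute_zero[OF S] galg_mult S E' d b)
      also have "\<dots> = cf (b * d) 0" by (simp add: absorb[OF E'(2)] absorb[OF b(2)])
      finally have "t = cf (b * d) 0 / cf E 0" using E0 by (simp add: field_simps)
      moreover have "F * d * E = c * (E * (b * d) * E)"
        by (simp add: mult.assoc absorb[OF c(3)] absorb[OF b(2)] absorb[OF cb])
      ultimately show ?thesis using t c(3) by (simp add: sc_mult_assoc)
    qed
    have "pairing S E F = (\<Sum>h\<in>S. cf b (- h) * cf c h) / cf E 0"
      unfolding expand sum_divide_distrib
    proof (intro sum.cong refl)
      fix h assume h: "h \<in> S"
      have "E * sg (- h) 1 * F = sc (cf c h / cf E 0) * b"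
        using EhF[OF galg_sg[OF fin_subgroupD(4)[OF S h], of 1]] by (simp add: cf_sg_mult)
      moreover have "F * sg h 1 * E = sc (cf b (- h) / cf E 0) * c"
        using FhE[OF galg_sg[OF h, of 1]] by (simp add: cf_mult_sg)
      ultimately have "(E * sg (- h) 1 * F) * (F * sg h 1 * E)
          = sc (cf c h / cf E 0 * (cf b (- h) / cf E 0)) * (b * c)"
        by (simp add: sc_mult_assoc[of b] sc_mult_sc mult.assoc)
      then show "cf ((E * sg (- h) 1 * F) * (F * sg h 1 * E)) 0 = cf b (- h) * cf c h / cf E 0"
        using E0 by (simp add: bc)
    qed
    also have "(\<Sum>h\<in>S. cf b (- h) * cf c h) = cf (b * c) 0"
      using sum_invert[OF S, of "\<lambda>h. cf b (- h) * cf c h"] cf_mult[OF b(1) fin_subgroupD(1)[OF S], of c 0] by simp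
    finally have "pairing S E F = 1" using E0 by (simp add: bc)
    then show ?thesis using b(1) c(1) bc cb by blast
  qed
qed

lemma pairing_primitive_self:
  assumes S: "fin_subgroup S" and E: "primitive S E" shows "pairing S E E = 1"
proof -
  note E' = primitiveD[OF E]
  have "E * E * E \<noteq> 0" using E' by simp
  then show ?thesis using pairing_primitive[OF S E E] E'(1) by blast
qed

lemma sum_Nats: "(\<And>i. i \<in> I \<Longrightarrow> f i \<in> \<nat>) \<Longrightarrow> sum f I \<in> (\<nat> :: 'a::semiring_1 set)"
  by (induction I rule: infinite_finite_induct) auto

lemma pairing_idempotents_Nats:
  assumes S: "fin_subgroup S" and e: "e \<in> galg S" "e * e = e" and f: "f \<in> galg S" "f * f = f"
  shows "pairing S e f \<in> \<nat>"
proof -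
  obtain A where A: "\<And>E. E \<in> A \<Longrightarrow> primitive S E" "\<Sum>A = e"
    by (rule primitive_decomposition[OF S e]) blast
  obtain B where B: "\<And>E. E \<in> B \<Longrightarrow> primitive S E" "\<Sum>B = f"
    by (rule primitive_decomposition[OF S f]) blast
  have "pairing S E F \<in> \<nat>" if "E \<in> A" "F \<in> B" for E F
    using pairing_primitive[OF S A(1)[OF that(1)] B(1)[OF that(2)]] by auto
  then show ?thesis unfolding A(2)[symmetric] B(2)[symmetric] pairing_linear
    by (intro sum_Nats)
qed

section \<open>Frobenius' theorem on the kernel\<close>

lemma subgroup_sum_absorbs:
  assumes S: "fin_subgroup S" and a: "a \<in> galg S"
  shows "subgroup_sum S * a = sc (\<Sum>x\<in>S. cf a x) * (subgroup_sum S :: 'g::group_add \<Rightarrow>\<^sub>0 complex)"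
proof (rule poly_mapping_eqI)
  fix x
  show "cf (subgroup_sum S * a) x = cf (sc (\<Sum>x\<in>S. cf a x) * subgroup_sum S) x"
  proof (cases "x \<in> S")
    case True
    have "(\<Sum>t\<in>S. cf a (- t + x)) = (\<Sum>t\<in>S. cf a (t + x))"
      using sum_invert[OF S, of "\<lambda>t. cf a (t + x)"] by simp
    also have "\<dots> = (\<Sum>t\<in>S. cf a t)" by (rule sum_right_translate[OF S True])
    finally show ?thesis using True by (simp add: cf_subgroup_sum_mult cf_subgroup_sum fin_subgroupD(1)[OF S])
  next
    case False
    then have "subgroup_sum S * a \<in> galg S" by (intro galg_mult S subgroup_sum_galg a) auto
    then show ?thesis using False by (simp add: galgD cf_subgroup_sum fin_subgroupD(1)[OF S])
  qed
qed

text \<open>The idempotent of the trivial representation.\<close>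

definition mean :: "'g::group_add set \<Rightarrow> ('g \<Rightarrow>\<^sub>0 complex)" where
  "mean S = sc (1 / of_nat (card S)) * subgroup_sum S"

lemma mean_galg: "fin_subgroup S \<Longrightarrow> mean S \<in> galg S"
  unfolding mean_def by (intro galg_mult galg_sc subgroup_sum_galg) auto

lemma cf_mean: "fin_subgroup S \<Longrightarrow> cf (mean S) x = (if x \<in> S then 1 / of_nat (card S) else 0)"
  by (simp add: mean_def cf_subgroup_sum fin_subgroupD)

lemma subgroup_sum_eq_mean: "fin_subgroup S \<Longrightarrow> subgroup_sum S = sc (of_nat (card S)) * mean S"
  using fin_subgroup_card_pos[of S] by (simp only: mean_def sc_mult_sc) simp

lemma mean_absorbs:
  assumes S: "fin_subgroup S" and a: "a \<in> galg S"
  shows "mean S * a = sc (\<Sum>x\<in>S. cf a x) * mean S"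
  unfolding mean_def by (simp add: mult.assoc subgroup_sum_absorbs[OF assms] sc_mult_sc mult.commute)

lemma sum_cf_mean: "fin_subgroup S \<Longrightarrow> (\<Sum>x\<in>S. cf (mean S) x) = 1"
  using fin_subgroup_card_pos[of S] by (simp add: cf_mean)

lemma mean_idempotent: assumes S: "fin_subgroup S" shows "mean S * mean S = mean S"
  using mean_absorbs[OF S mean_galg[OF S]] sum_cf_mean[OF S] by simp

lemma mean_primitive: assumes S: "fin_subgroup S" shows "primitive S (mean S)"
proof -
  have "mean S \<noteq> 0"
  proof
    assume "mean S = 0"
    then show False using cf_mean[OF S, of 0] fin_subgroup_card_pos[OF S] fin_subgroupD(2)[OF S] by simp
  qed
  moreover have "\<exists>c. mean S * a * mean S = sc c * mean S" if "a \<in> galg S" for a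
    using mean_absorbs[OF S that] mean_idempotent[OF S] by (intro exI) (simp add: mult.assoc)
  ultimately show ?thesis using S by (simp add: primitive_def mean_galg mean_idempotent)
qed

lemma mean_central:
  assumes S: "fin_subgroup S" and h: "h \<in> S" shows "sg h 1 * mean S = mean S * sg h 1"
proof -
  have "sg h 1 * mean S = mean S"
    by (simp add: mean_def sc_mult_assoc[of "sg h 1"] sg_mult_subgroup_sum[OF S h])
  moreover have "(\<Sum>x\<in>S. cf (sg h (1::complex)) x) = 1"
    using h fin_subgroupD(1)[OF S] by (simp add: lookup_single when_def)
  then have "mean S * sg h 1 = mean S"
    using mean_absorbs[OF S galg_sg[OF h]] by simp
  ultimately show ?thesis by simp
qed

lemma class_sum_mean: "fin_subgroup S \<Longrightarrow> class_sum S (mean S) = subgroup_sum S"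
  by (simp add: class_sum_of_central mean_central subgroup_sum_eq_mean)

lemma cf_class_sum: "cf (class_sum S x) z = (\<Sum>h\<in>S. cf x (- h + z + h))"
  by (simp add: class_sum_def lookup_sum cf_sg_mult cf_mult_sg mult.assoc add.assoc)

lemma pairing_one:
  assumes S: "fin_subgroup S" shows "pairing S 1 x = of_nat (card S) * cf x 0"
proof -
  have "class_sum S 1 = of_nat (card S) * 1" by (rule class_sum_of_central[OF S]) simp
  then show ?thesis by (simp add: pairing_def)
qed

text \<open>The terms of the pairing over \<open>H\<close> with \<open>h \<in> G\<close> make up
  the pairing over \<open>G\<close>. For \<open>h\<close> outside \<open>G\<close> the subgroup
  \<open>G\<close> meets its conjugate by \<open>h\<close> only in the identity, so only the product
  of the coefficients at the identity survives. This is Mackey's formula for a malnormal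
  subgroup.\<close>

lemma pairing_malnormal:
  assumes H: "fin_subgroup H" and G: "fin_subgroup G" "G \<subseteq> H"
    and mal: "\<And>h g. h \<in> H \<Longrightarrow> h \<notin> G \<Longrightarrow> g \<in> G \<Longrightarrow> h + g - h \<in> G \<Longrightarrow> g = 0"
    and x: "x \<in> galg G" and y: "y \<in> galg G"
  shows "pairing H x y = pairing G x y + (of_nat (card H) - of_nat (card G)) * (cf x 0 * cf y 0)"
proof -
  have xH: "x \<in> galg H" and yH: "y \<in> galg H" using x y galg_mono[OF G(2)] by blast+
  let ?f = "\<lambda>h. cf (sg h 1 * x * sg (- h) 1 * y) 0"
  have eq: "?f h = cf x 0 * cf y 0" if h: "h \<in> H - G" for h
  proof -
    have "?f h = cf (y * (sg h 1 * x * sg (- h) 1)) 0"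
      by (rule cf_mult_commute_zero[OF H]) (use h in \<open>auto intro!: galg_mult H galg_sg xH yH fin_subgroupD(4)[OF H]\<close>)
    also have "\<dots> = (\<Sum>g\<in>G. cf y g * cf x (- h + (- g + h)))"
      by (simp add: cf_mult[OF y fin_subgroupD(1)[OF G(1)]] cf_sg_mult cf_mult_sg mult.assoc
          diff_conv_add_uminus add.assoc del: add_uminus_conv_diff)
    also have "\<dots> = (\<Sum>g\<in>G. if g = 0 then cf y 0 * cf x 0 else 0)"
    proof (intro sum.cong refl)
      fix g assume g: "g \<in> G"
      have "- h + (- g + h) \<notin> G" if "g \<noteq> 0"
      proof
        assume "- h + (- g + h) \<in> G"
        then have "- h + - g - - h \<in> G"
          by (simp add: add.assoc diff_conv_add_uminus del: add_uminus_conv_diff)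
        moreover have "- h \<in> H" "- h \<notin> G" using h fin_subgroup_minus_iff[OF H] fin_subgroup_minus_iff[OF G(1)] by auto
        ultimately have "- g = 0" using mal[of "- h" "- g"] fin_subgroupD(4)[OF G(1) g] by blast
        then show False using that by simp
      qed
      then show "cf y g * cf x (- h + (- g + h)) = (if g = 0 then cf y 0 * cf x 0 else 0)"
        using galgD[OF x] by auto
    qed
    also have "\<dots> = cf x 0 * cf y 0" using fin_subgroupD(1,2)[OF G(1)] by simp
    finally show ?thesis .
  qed
  have "pairing H x y = sum ?f H"
    by (simp add: pairing_def class_sum_def sum_distrib_right lookup_sum)
  also have "\<dots> = sum ?f G + sum ?f (H - G)"
    using sum.subset_diff[OF G(2) fin_subgroupD(1)[OF H], of ?f] by (simp add: add.commute)
  also have "sum ?f (H - G) = of_nat (card (H - G)) * (cf x 0 * cf y 0)"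
    using eq by simp
  also have "of_nat (card (H - G)) = (of_nat (card H) - of_nat (card G) :: complex)"
    using G(2) fin_subgroupD(1)[OF H] fin_subgroupD(1)[OF G(1)]
    by (simp add: card_Diff_subset of_nat_diff card_mono)
  also have "sum ?f G = pairing G x y"
    by (simp add: pairing_def class_sum_def sum_distrib_right lookup_sum)
  finally show ?thesis .
qed

text \<open>In the application \<open>I\<close> is a decomposition of \<open>1\<close> into
  primitive idempotents of \<open>\<complex>[H]\<close>, \<open>r\<close> is isomorphism of the left
  ideals they generate, \<open>D\<close> the dimension of these, and \<open>c\<close> the
  multiplicity of the irreducible module in a virtual module. A class of \<open>r\<close> has
  \<open>D\<close> members, so the norm is the sum of \<open>c\<^sup>2\<close> over the classes.
  Norm one leaves a single class with \<open>c = \<plusminus>1\<close>, and the sum of all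
  \<open>c\<close>, which counts dimensions, decides the sign.\<close>

lemma norm_one_multiplicities:
  fixes c :: "'i \<Rightarrow> int" and D :: "'i \<Rightarrow> nat" and r :: "'i \<Rightarrow> 'i \<Rightarrow> bool"
  assumes fin: "finite I" and D: "\<And>i. i \<in> I \<Longrightarrow> 0 < D i"
    and norm: "(\<Sum>i\<in>I. (real_of_int (c i))\<^sup>2 / real (D i)) = 1" and pos: "0 < (\<Sum>i\<in>I. c i)"
    and equiv: "\<And>i j. i \<in> I \<Longrightarrow> j \<in> I \<Longrightarrow> r i j \<Longrightarrow> c i = c j \<and> D i = D j"
    and count: "\<And>j. j \<in> I \<Longrightarrow> card {i \<in> I. r i j} = D j"
    and i: "i \<in> I"
  shows "0 \<le> c i"
proof -
  have "\<exists>j\<in>I. c j \<noteq> 0" using pos by (rule contrapos_pp) simp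
  then obtain j where j: "j \<in> I" "c j \<noteq> 0" by blast
  define T where "T = {i \<in> I. r i j}"
  have T: "T \<subseteq> I" "card T = D j" "\<And>i. i \<in> T \<Longrightarrow> c i = c j \<and> D i = D j"
    using count equiv j by (auto simp: T_def)
  have nn: "0 \<le> (real_of_int (c i))\<^sup>2 / real (D i)" for i by simp
  have "(\<Sum>i\<in>T. (real_of_int (c i))\<^sup>2 / real (D i)) = (\<Sum>i\<in>T. (real_of_int (c j))\<^sup>2 / real (D j))"
    by (intro sum.cong refl) (use T(3) in simp)
  also have "\<dots> = (real_of_int (c j))\<^sup>2" using T(2) D[OF j(1)] by simp
  finally have sT: "(\<Sum>i\<in>T. (real_of_int (c i))\<^sup>2 / real (D i)) = (real_of_int (c j))\<^sup>2" .
  have split: "1 = (\<Sum>i\<in>I - T. (real_of_int (c i))\<^sup>2 / real (D i)) + (real_of_int (c j))\<^sup>2"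
    using sum.subset_diff[OF T(1) fin, of "\<lambda>i. (real_of_int (c i))\<^sup>2 / real (D i)"] norm sT by simp
  have "1 \<le> (c j)\<^sup>2" using j(2) by (simp add: int_one_le_iff_zero_less)
  then have "1 \<le> (real_of_int (c j))\<^sup>2" by (metis of_int_1_le_iff of_int_power)
  then have "(\<Sum>i\<in>I - T. (real_of_int (c i))\<^sup>2 / real (D i)) = 0"
    using split sum_nonneg[of "I - T" "\<lambda>i. (real_of_int (c i))\<^sup>2 / real (D i)"] nn by fastforce
  then have zero: "c i = 0" if "i \<in> I - T" for i
    using sum_nonneg_eq_0_iff[of "I - T", OF _ nn] fin that D[of i] by auto
  have "(\<Sum>i\<in>I. c i) = (\<Sum>i\<in>T. c i)"
    by (rule sum.mono_neutral_right) (use fin T(1) zero in auto)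
  also have "\<dots> = (\<Sum>i\<in>T. c j)" by (intro sum.cong refl) (use T(3) in simp)
  also have "\<dots> = int (D j) * c j" using T(2) by simp
  finally have "0 < c j" using pos D[OF j(1)] by (simp add: zero_less_mult_iff)
  then show ?thesis using zero[of i] T(3)[of i] i by (cases "i \<in> T") auto
qed

definition frobenius_kernel :: "'g::group_add set \<Rightarrow> 'g set \<Rightarrow> 'g set" where
  "frobenius_kernel H G = {k \<in> H. \<forall>h\<in>H. h + k - h \<in> G \<longrightarrow> k = 0}"

lemma frobenius_kernel_minus:
  assumes H: "fin_subgroup H" and G: "fin_subgroup G" and k: "k \<in> frobenius_kernel H G"
  shows "- k \<in> frobenius_kernel H G"
  unfolding frobenius_kernel_def
proof (intro CollectI conjI ballI impI)
  show "- k \<in> H" using k by (auto simp: frobenius_kernel_def fin_subgroupD(4)[OF H])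
  fix h assume h: "h \<in> H" "h + - k - h \<in> G"
  have "- (h + - k - h) = h + k - h"
    by (simp add: diff_conv_add_uminus minus_add add.assoc del: add_uminus_conv_diff)
  then have "h + k - h \<in> G" using fin_subgroupD(4)[OF G h(2)] by simp
  then show "- k = 0" using k h(1) by (auto simp: frobenius_kernel_def)
qed

lemma frobenius_kernel_conjugate:
  assumes H: "fin_subgroup H" and x: "x \<in> H" and k: "k \<in> frobenius_kernel H G"
  shows "x + k - x \<in> frobenius_kernel H G"
  unfolding frobenius_kernel_def
proof (intro CollectI conjI ballI impI)
  show "x + k - x \<in> H" using k x by (auto simp: frobenius_kernel_def intro!: fin_subgroupD(3,5)[OF H])
  fix h assume h: "h \<in> H" "h + (x + k - x) - h \<in> G"
  have "h + (x + k - x) - h = (h + x) + k - (h + x)"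
    by (simp add: diff_conv_add_uminus minus_add add.assoc del: add_uminus_conv_diff)
  then have "k = 0" using k h fin_subgroupD(3)[OF H h(1) x] by (auto simp: frobenius_kernel_def)
  then show "x + k - x = 0" by simp
qed

text \<open>Frobenius' theorem. Let \<open>e\<close> run through orthogonal primitive idempotents
  of \<open>\<complex>[G]\<close> with sum \<open>1\<close>, of dimensions \<open>d(e)\<close>. Up
  to inversion of the argument, the character of \<open>G\<close> belonging to \<open>e\<close>
  extends to a class function \<open>\<theta> e\<close> of \<open>H\<close> that is constantly
  \<open>d(e)\<close> on \<open>K\<close>: induce the difference with \<open>d(e)\<close> trivial
  characters, and add these again on \<open>H\<close>. Its multiplicities \<open>c\<close> in the
  irreducible modules of \<open>H\<close> are integers, and Mackey's formula gives it norm one, so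
  they are nonnegative. The sum \<open>t\<close> of the \<open>\<theta> e\<close>, divided by
  \<open>|H|\<close>, has the coefficient \<open>1 / |K|\<close> on \<open>K\<close> and vanishes
  elsewhere. Its eigenvalues \<open>\<tau>\<close> on the irreducible modules lie in \<open>[0,
  1]\<close>, and since \<open>K\<close> is closed under inverses and has \<open>|H| / |G|\<close>
  elements, \<open>t\<close> and \<open>t\<^sup>2\<close> have the same trace. So every
  \<open>\<tau>\<close> is \<open>0\<close> or \<open>1\<close>, \<open>t\<close> is an idempotent,
  and as its coefficients are nonnegative, its support \<open>K\<close> is closed under the group
  operation.\<close>

theorem frobenius_kernel_subgroup:
  assumes H: "fin_subgroup H" and G: "fin_subgroup G" "G \<subseteq> H"
    and mal: "\<And>h g. h \<in> H \<Longrightarrow> h \<notin> G \<Longrightarrow> g \<in> G \<Longrightarrow> h + g - h \<in> G \<Longrightarrow> g = 0"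
  shows "fin_subgroup (frobenius_kernel H G)" "card (frobenius_kernel H G) * card G = card H"
proof -
  define K where "K = frobenius_kernel H G"
  define m where "m = (of_nat (card G) :: complex)"
  define n where "n = (of_nat (card H) :: complex)"
  have mn: "m \<noteq> 0" "n \<noteq> 0" using fin_subgroup_card_pos H G by (auto simp: m_def n_def)
  have finH: "finite H" and finG: "finite G" using fin_subgroupD(1) H G by blast+
  define f where "f = mean G"
  define s where "s = (subgroup_sum H :: 'a \<Rightarrow>\<^sub>0 complex)"
  have fG: "f \<in> galg G" "f * f = f" by (simp_all add: f_def mean_galg mean_idempotent G)
  have fH: "f \<in> galg H" using fG galg_mono[OF G(2)] by blast
  have f0: "cf f 0 = 1 / m" by (simp add: f_def cf_mean G m_def fin_subgroupD)
  have sH: "s \<in> galg H" by (simp add: s_def subgroup_sum_galg)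
  have s_class: "s = class_sum H (mean H)" by (simp add: s_def class_sum_mean H)
  have s_mult: "s * a = sc (\<Sum>x\<in>H. cf a x) * s" if "a \<in> galg H" for a
    unfolding s_def by (rule subgroup_sum_absorbs[OF H that])
  have s0: "cf s 0 = 1" by (simp add: s_def cf_subgroup_sum finH fin_subgroupD(2)[OF H])
  have sum_s: "(\<Sum>x\<in>H. cf s x) = n" by (simp add: s_def cf_subgroup_sum finH n_def)
  have sum_G: "(\<Sum>x\<in>H. cf a x) = (\<Sum>x\<in>G. cf a x)" if "a \<in> galg G" for a :: "'a \<Rightarrow>\<^sub>0 complex"
    by (rule sum.mono_neutral_right[OF finH G(2)]) (use that in \<open>auto simp: galgD\<close>)
  have sum_class: "(\<Sum>x\<in>H. cf (class_sum H a) x) = n * (\<Sum>x\<in>H. cf a x)" for a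
  proof -
    have "(\<Sum>x\<in>H. cf (class_sum H a) x) = (\<Sum>h\<in>H. \<Sum>x\<in>H. cf a (- h + x + h))"
      unfolding cf_class_sum by (rule sum.swap)
    also have "\<dots> = (\<Sum>h\<in>H. \<Sum>x\<in>H. cf a x)"
    proof (rule sum.cong[OF refl])
      fix h assume h: "h \<in> H"
      have "(\<Sum>x\<in>H. cf a (- h + x + h)) = (\<Sum>x\<in>H. cf a (x + h))"
        using sum_left_translate[OF H fin_subgroupD(4)[OF H h], of "\<lambda>x. cf a (x + h)"] by (simp add: add.assoc)
      then show "(\<Sum>x\<in>H. cf a (- h + x + h)) = (\<Sum>x\<in>H. cf a x)"
        using sum_right_translate[OF H h, of "cf a"] by simp
    qed
    finally show ?thesis by (simp add: n_def)
  qed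
  have cf_class0: "cf (class_sum H a) 0 = n * cf a 0" for a
    by (simp add: cf_class_sum n_def)
  obtain \<E> where \<E>: "finite \<E>" "\<And>E. E \<in> \<E> \<Longrightarrow> primitive H E" "\<Sum>\<E> = 1"
    by (rule primitive_decomposition[OF H galg_one[OF H], simplified]) blast
  obtain \<B> where \<B>: "finite \<B>" "\<And>e. e \<in> \<B> \<Longrightarrow> primitive G e" "\<Sum>\<B> = 1"
    by (rule primitive_decomposition[OF G(1) galg_one[OF G(1)], simplified]) blast
  note EH = primitiveD(1,2)[OF \<E>(2)] and eG = primitiveD(1,2)[OF \<B>(2)]
  have eH: "e \<in> galg H" if "e \<in> \<B>" for e using eG(1)[OF that] galg_mono[OF G(2)] by blast
  define d where "d e = m * cf e 0" for e :: "'a \<Rightarrow>\<^sub>0 complex"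
  have d_Nats: "d e \<in> \<nat>" if "e \<in> \<B>" for e
    using pairing_idempotents_Nats[OF G(1) galg_one[OF G(1)] _ eG[OF that]]
    by (simp add: pairing_one[OF G(1)] d_def m_def)
  have d_nz: "d e \<noteq> 0" if "e \<in> \<B>" for e
    using primitive_trace_nonzero[OF G(1) \<B>(2)[OF that]] mn by (simp add: d_def)
  define D where "D E = n * cf E 0" for E :: "'a \<Rightarrow>\<^sub>0 complex"
  have D_pairing: "D E = pairing H 1 E" for E by (simp add: D_def n_def pairing_one[OF H])
  have D_Nats: "D E \<in> \<nat>" if "E \<in> \<E>" for E
    using pairing_idempotents_Nats[OF H galg_one[OF H] _ EH[OF that]] by (simp add: D_pairing)
  have D_nz: "D E \<noteq> 0" if "E \<in> \<E>" for E
    using primitive_trace_nonzero[OF H \<E>(2)[OF that]] mn by (simp add: D_def)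
  \<comment> \<open>Forming \<open>class_sum H\<close> is induction to \<open>H\<close>;
    \<open>f\<close> and \<open>s\<close> stand for the trivial characters of \<open>G\<close> and
    \<open>H\<close>.\<close>
  define \<theta> where "\<theta> e = class_sum H (e - sc (d e) * f) + sc (d e) * s" for e
  have \<theta>H: "\<theta> e \<in> galg H" if "e \<in> \<B>" for e unfolding \<theta>_def
    by (intro galg_add galg_mult galg_sc H sH class_sum_galg galg_diff eH that fH)
  have \<theta>_central: "\<theta> e * a = a * \<theta> e" if "a \<in> galg H" for e a
    unfolding \<theta>_def s_class class_sum_sc[symmetric] class_sum_add[symmetric]
    by (rule class_sum_central[OF H that])
  define c where "c e E = cf (\<theta> e * E) 0" for e E
  have c_eq: "c e E = pairing H e E - d e * pairing H f E + d e * pairing H (mean H) E" for e E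
    by (simp add: c_def \<theta>_def s_class class_sum_diff class_sum_sc distrib_right left_diff_distrib
        lookup_add lookup_minus mult.assoc pairing_def)
  have c_Ints: "c e E \<in> \<int>" if e: "e \<in> \<B>" and E: "E \<in> \<E>" for e E
  proof -
    have "pairing H e E \<in> \<nat>" "pairing H f E \<in> \<nat>" "pairing H (mean H) E \<in> \<nat>"
      using pairing_idempotents_Nats[OF H _ _ EH[OF E]] eH[OF e] eG(2)[OF e] fH fG(2)
        mean_galg[OF H] mean_idempotent[OF H] by blast+
    then show ?thesis unfolding c_eq using d_Nats[OF e] Nats_subset_Ints
      by (intro Ints_add Ints_diff Ints_mult) blast+
  qed
  have \<theta>E: "\<theta> e * E = sc (c e E / cf E 0) * E" if "e \<in> \<B>" "E \<in> \<E>" for e E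
    unfolding c_def by (rule central_acts_by_scalar[OF H \<E>(2)[OF that(2)] \<theta>H[OF that(1)]
        \<theta>_central[OF EH(1)[OF that(2)]]])
  \<comment> \<open>Mackey's formula has no correction term here, because \<open>y = e - d(e)
    f\<close> vanishes at the identity.\<close>
  have norm: "cf (\<theta> e * \<theta> e) 0 = n" if e: "e \<in> \<B>" for e
  proof -
    define y where "y = e - sc (d e) * f"
    have yG: "y \<in> galg G" unfolding y_def by (intro galg_diff galg_mult galg_sc G eG e fG)
    have yH: "y \<in> galg H" using yG galg_mono[OF G(2)] by blast
    define \<epsilon> where "\<epsilon> = (\<Sum>x\<in>G. cf e x)"
    have y0: "cf y 0 = 0" using mn by (simp add: y_def lookup_minus d_def f0)
    have pef: "pairing G f e = \<epsilon>"
    proof -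
      have "class_sum G f * e = subgroup_sum G * e" by (simp add: f_def class_sum_mean G)
      also have "\<dots> = sc \<epsilon> * subgroup_sum G" unfolding \<epsilon>_def by (rule subgroup_sum_absorbs[OF G(1) eG(1)[OF e]])
      finally show ?thesis by (simp add: pairing_def cf_subgroup_sum finG fin_subgroupD(2)[OF G(1)])
    qed
    have "pairing G y y = 1 - 2 * d e * \<epsilon> + (d e)\<^sup>2"
      unfolding y_def pairing_linear
      using pairing_primitive_self[OF G(1) \<B>(2)[OF e]] pairing_primitive_self[OF G(1) mean_primitive[OF G(1)]]
        pef pairing_commute[OF G(1) eG(1)[OF e] fG(1)]
      by (simp add: f_def[symmetric] power2_eq_square algebra_simps)
    then have py: "pairing H y y = 1 - 2 * d e * \<epsilon> + (d e)\<^sup>2"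
      using pairing_malnormal[OF H G mal yG yG] y0 by simp
    have sum_y: "(\<Sum>x\<in>H. cf y x) = \<epsilon> - d e"
      unfolding sum_G[OF yG] using sum_cf_mean[OF G(1)]
      by (simp add: y_def lookup_minus sum_subtractf \<epsilon>_def sum_distrib_left[symmetric] f_def)
    have yy: "cf (class_sum H y * class_sum H y) 0 = n * pairing H y y"
    proof -
      have "class_sum H (class_sum H y) = of_nat (card H) * class_sum H y"
        by (rule class_sum_of_central[OF H]) (simp add: class_sum_central[OF H] galg_sg)
      then have "pairing H (class_sum H y) y = n * pairing H y y"
        by (simp add: pairing_def n_def mult.assoc)
      then show ?thesis
        using pairing_commute[OF H class_sum_galg[OF H yH] yH] by (simp add: pairing_def)
    qed
    have sy: "cf (s * class_sum H y) 0 = n * (\<epsilon> - d e)"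
      by (simp add: s_mult class_sum_galg H yH sum_class sum_y s0)
    have ss: "cf (s * s) 0 = n" by (simp add: s_mult sH sum_s s0)
    have ys: "class_sum H y * s = s * class_sum H y" by (rule class_sum_central[OF H sH])
    have "\<theta> e * \<theta> e = class_sum H y * class_sum H y + sc (2 * d e) * (s * class_sum H y) + sc ((d e)\<^sup>2) * (s * s)"
    proof -
      have "\<theta> e * \<theta> e = class_sum H y * class_sum H y + sc (d e) * (s * class_sum H y)
          + (sc (d e) * (s * class_sum H y) + sc (d e * d e) * (s * s))"
        unfolding \<theta>_def y_def[symmetric]
        by (simp add: distrib_left distrib_right mult.assoc sc_mult_assoc[of s] sc_mult_assoc[of "class_sum H y"] ys
            sc_mult_sc)
      also have "\<dots> = class_sum H y * class_sum H y + sc (2 * d e) * (s * class_sum H y) + sc ((d e)\<^sup>2) * (s * s)"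
        by (intro poly_mapping_eqI) (simp add: lookup_add power2_eq_square algebra_simps)
      finally show ?thesis .
    qed
    then show ?thesis by (simp add: lookup_add yy sy ss py) (simp add: algebra_simps power2_eq_square)
  qed
  have expand: "cf a 0 = (\<Sum>E\<in>\<E>. cf (a * E) 0)" for a
  proof -
    have "a = (\<Sum>E\<in>\<E>. a * E)" using \<E>(3) by (simp add: sum_distrib_left[symmetric])
    from arg_cong[where f = "\<lambda>u. cf u 0", OF this] show ?thesis by (simp only: lookup_sum)
  qed
  have sum_c: "(\<Sum>E\<in>\<E>. c e E) = d e" for e
  proof -
    have "(\<Sum>E\<in>\<E>. c e E) = cf (\<theta> e) 0" by (simp only: c_def expand[of "\<theta> e"])
    also have "\<dots> = n * (cf e 0 - d e * (1 / m)) + d e"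
      unfolding \<theta>_def lookup_add cf_class0 lookup_minus cf_sc_mult s0 f0 by simp
    finally show ?thesis using mn by (simp add: d_def)
  qed
  have sum_cc: "(\<Sum>E\<in>\<E>. (c e E)\<^sup>2 / D E) = 1" if e: "e \<in> \<B>" for e
  proof -
    have "n = (\<Sum>E\<in>\<E>. cf (\<theta> e * \<theta> e * E) 0)" by (simp only: expand[of "\<theta> e * \<theta> e", symmetric] norm[OF e])
    also have "\<dots> = (\<Sum>E\<in>\<E>. n * ((c e E)\<^sup>2 / D E))"
    proof (intro sum.cong refl)
      fix E assume E: "E \<in> \<E>"
      have "\<theta> e * \<theta> e * E = sc (c e E / cf E 0 * (c e E / cf E 0)) * E"
        by (simp add: mult.assoc \<theta>E[OF e E] sc_mult_assoc[of "\<theta> e"] sc_mult_sc)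
      then show "cf (\<theta> e * \<theta> e * E) 0 = n * ((c e E)\<^sup>2 / D E)"
        using D_nz[OF E] mn by (simp add: D_def power2_eq_square)
    qed
    finally have "n * 1 = n * (\<Sum>E\<in>\<E>. (c e E)\<^sup>2 / D E)"
      by (simp only: sum_distrib_left mult_1_right)
    then show ?thesis using mn(2) by (metis mult_left_cancel)
  qed
  define Di where "Di E = nat (floor (Re (D E)))" for E
  define ci where "ci e E = floor (Re (c e E))" for e E
  have Di: "D E = of_nat (Di E)" "0 < Di E" if "E \<in> \<E>" for E
    using D_Nats[OF that] D_nz[OF that] by (auto simp: Di_def elim!: Nats_cases)
  have ci: "c e E = of_int (ci e E)" if "e \<in> \<B>" "E \<in> \<E>" for e E
    using c_Ints[OF that] by (auto simp: ci_def elim!: Ints_cases)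
  have c_nonneg: "0 \<le> ci e E" if e: "e \<in> \<B>" and E: "E \<in> \<E>" for e E
  proof (rule norm_one_multiplicities[where I = \<E> and D = Di and r = "\<lambda>E F. pairing H E F = 1"])
    show "finite \<E>" "E \<in> \<E>" by fact+
    show "0 < Di F" if "F \<in> \<E>" for F using Di(2)[OF that] .
    have "complex_of_real (\<Sum>F\<in>\<E>. (real_of_int (ci e F))\<^sup>2 / real (Di F)) = (\<Sum>F\<in>\<E>. (c e F)\<^sup>2 / D F)"
      unfolding of_real_sum by (intro sum.cong refl) (simp add: ci[OF e] Di)
    then show "(\<Sum>F\<in>\<E>. (real_of_int (ci e F))\<^sup>2 / real (Di F)) = 1"
      unfolding sum_cc[OF e] by (metis of_real_eq_1_iff)
    have "of_int (\<Sum>F\<in>\<E>. ci e F) = d e"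
      unfolding of_int_sum sum_c[symmetric] by (intro sum.cong refl) (simp add: ci[OF e])
    moreover obtain k where k: "d e = of_nat k" using d_Nats[OF e] by (rule Nats_cases)
    ultimately have "(of_int (\<Sum>F\<in>\<E>. ci e F) :: complex) = of_int (int k)" by simp
    then have "(\<Sum>F\<in>\<E>. ci e F) = int k" by (simp only: of_int_eq_iff)
    moreover have "k \<noteq> 0" using d_nz[OF e] k by auto
    ultimately show "0 < (\<Sum>F\<in>\<E>. ci e F)" by simp
    show "ci e E = ci e F \<and> Di E = Di F" if EF: "E \<in> \<E>" "F \<in> \<E>" "pairing H E F = 1" for E F
    proof -
      obtain b c' where bc: "b \<in> galg H" "c' \<in> galg H" "b * c' = E" "c' * b = F"
        using pairing_primitive[OF H \<E>(2)[OF EF(1)] \<E>(2)[OF EF(2)]] EF(3) by auto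
      have "cf (\<theta> e * E) 0 = cf ((\<theta> e * b) * c') 0" by (simp add: bc(3)[symmetric] mult.assoc)
      also have "\<dots> = cf (c' * (\<theta> e * b)) 0" by (intro cf_mult_commute_zero[OF H] galg_mult H \<theta>H e bc)
      also have "c' * (\<theta> e * b) = \<theta> e * F"
        using \<theta>_central[OF bc(2), of e] by (simp add: bc(4)[symmetric] mult.assoc[symmetric])
      finally have "c e E = c e F" by (simp add: c_def)
      moreover have "cf E 0 = cf F 0"
        using cf_mult_commute_zero[OF H bc(1,2)] by (simp add: bc)
      ultimately show ?thesis by (simp add: ci_def Di_def D_def)
    qed
    show "card {E \<in> \<E>. pairing H E F = 1} = Di F" if F: "F \<in> \<E>" for F
    proof -
      have "(of_nat (card {E \<in> \<E>. pairing H E F = 1}) :: complex) = (\<Sum>E\<in>\<E>. if pairing H E F = 1 then 1 else 0)"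
        using \<E>(1) by (simp add: sum.If_cases Int_def)
      also have "\<dots> = (\<Sum>E\<in>\<E>. pairing H E F)"
        by (intro sum.cong refl) (use pairing_primitive[OF H \<E>(2) \<E>(2)[OF F]] in auto)
      also have "\<dots> = D F" by (simp add: pairing_linear(4)[symmetric] \<E>(3) D_pairing)
      finally show ?thesis using Di(1)[OF F] by simp
    qed
  qed
  define t where "t = sc (1 / n) * (\<Sum>e\<in>\<B>. \<theta> e)"
  have sum_d: "(\<Sum>e\<in>\<B>. d e) = m"
    using \<B>(3) by (simp add: d_def sum_distrib_left[symmetric] lookup_sum[symmetric])
  have sum_\<theta>: "(\<Sum>e\<in>\<B>. \<theta> e) = sc n - sc m * class_sum H f + sc m * s"
  proof -
    have "(\<Sum>e\<in>\<B>. \<theta> e) = class_sum H (\<Sum>e\<in>\<B>. e) - (\<Sum>e\<in>\<B>. sc (d e)) * class_sum H f + (\<Sum>e\<in>\<B>. sc (d e)) * s"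
      by (simp add: \<theta>_def sum.distrib class_sum_diff class_sum_sc sum_subtractf class_sum_sum sum_distrib_right)
    moreover have "(\<Sum>e\<in>\<B>. sc (d e)) = (sc m :: 'a \<Rightarrow>\<^sub>0 complex)"
      unfolding sum_d[symmetric] by (induction \<B> rule: infinite_finite_induct) (auto simp: single_add)
    moreover have "class_sum H (\<Sum>e\<in>\<B>. e) = sc n"
      unfolding \<B>(3) by (subst class_sum_of_central[OF H]) (auto simp: n_def)
    ultimately show ?thesis by simp
  qed
  have tH: "t \<in> galg H" unfolding t_def by (intro galg_mult galg_sc H galg_sum \<theta>H)
  have K_sub: "K \<subseteq> H" by (auto simp: K_def frobenius_kernel_def)
  \<comment> \<open>By malnormality, the elements that conjugate a given element of
    \<open>H\<close> outside \<open>K\<close> into \<open>G\<close> form one coset of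
    \<open>G\<close>.\<close>
  have t_coeff: "cf t x = (if x \<in> K then m / n else 0)" for x
  proof -
    have e1: "cf (sc n :: 'a \<Rightarrow>\<^sub>0 complex) x = (if x = 0 then n else 0)"
      by (auto simp: lookup_single when_def)
    have nt: "n * cf t x = (if x = 0 then n else 0) - m * cf (class_sum H f) x + m * (if x \<in> H then 1 else 0)"
      unfolding t_def sum_\<theta> using mn
      by (simp add: lookup_add lookup_minus e1 s_def cf_subgroup_sum finH)
    have cls: "cf (class_sum H f) x = of_nat (card {h \<in> H. - h + x + h \<in> G}) / m"
    proof -
      have "cf (class_sum H f) x = (\<Sum>h\<in>H. if - h + x + h \<in> G then 1 / m else 0)"
        unfolding cf_class_sum by (intro sum.cong refl) (simp add: f_def cf_mean G m_def)
      then show ?thesis using finH by (simp add: sum.If_cases Int_def)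
    qed
    consider "x = 0" | "x \<noteq> 0" "x \<in> H" "x \<in> K" | "x \<notin> H" | "x \<noteq> 0" "x \<in> H" "x \<notin> K" by blast
    then show ?thesis
    proof cases
      case 1
      then have "cf (class_sum H f) x = n / m" using cls fin_subgroupD(2)[OF G(1)] by (simp add: n_def)
      moreover have "x \<in> K" using 1 fin_subgroupD(2)[OF H] by (auto simp: K_def frobenius_kernel_def)
      ultimately show ?thesis using nt 1 mn fin_subgroupD(2)[OF H] by (simp add: field_simps)
    next
      case 2
      have "{h \<in> H. - h + x + h \<in> G} = {}"
      proof (rule ccontr)
        assume "{h \<in> H. - h + x + h \<in> G} \<noteq> {}"
        then obtain h where h: "h \<in> H" "- h + x - - h \<in> G" by auto
        then show False using 2 fin_subgroupD(4)[OF H h(1)] by (auto simp: K_def frobenius_kernel_def)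
      qed
      then have "cf (class_sum H f) x = 0" by (simp only: cls card.empty) simp
      then show ?thesis using nt 2 mn by (simp add: field_simps)
    next
      case 3
      have "{h \<in> H. - h + x + h \<in> G} = {}"
      proof (rule ccontr)
        assume "{h \<in> H. - h + x + h \<in> G} \<noteq> {}"
        then obtain h where h: "h \<in> H" "- h + x + h \<in> H" using G(2) by auto
        then show False
          using 3 fin_subgroup_add_cancel[OF H h(1)] fin_subgroup_add_cancel[OF H fin_subgroupD(4)[OF H h(1)]] by blast
      qed
      then have "cf (class_sum H f) x = 0" by (simp only: cls card.empty) simp
      moreover have "x \<noteq> 0" using 3 fin_subgroupD(2)[OF H] by auto
      ultimately show ?thesis using nt 3 mn K_sub by auto
    next
      case 4
      then obtain h0 where "h0 \<in> H" "h0 + x - h0 \<in> G" by (auto simp: K_def frobenius_kernel_def)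
      then have h0: "- h0 \<in> H" "- (- h0) + x + - h0 \<in> G" by (auto simp: fin_subgroupD(4)[OF H])
      define h1 where "h1 = - h0"
      note h1 = h0[folded h1_def]
      have "{h \<in> H. - h + x + h \<in> G} = (+) h1 ` G"
      proof (intro equalityI subsetI)
        fix h assume "h \<in> {h \<in> H. - h + x + h \<in> G}"
        then have h: "h \<in> H" "- h + x + h \<in> G" by auto
        have eq: "(- h + h1) + (- h1 + x + h1) - (- h + h1) = - h + x + h"
          by (simp add: diff_conv_add_uminus minus_add add.assoc del: add_uminus_conv_diff)
        have "- h1 + x + h1 \<noteq> 0"
        proof
          assume z: "- h1 + x + h1 = 0"
          have "x = h1 + (- h1 + x + h1) - h1" by (simp add: diff_conv_add_uminus add.assoc del: add_uminus_conv_diff)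
          then show False using z 4 by simp
        qed
        then have "- h + h1 \<in> G"
          using mal[of "- h + h1" "- h1 + x + h1"] h h1 eq fin_subgroupD(3,4)[OF H] by auto
        then have "- (- h + h1) \<in> G" by (rule fin_subgroupD(4)[OF G(1)])
        then show "h \<in> (+) h1 ` G"
          by (intro image_eqI[of _ _ "- (- h + h1)"]) (auto simp: minus_add add.assoc)
      next
        fix h assume "h \<in> (+) h1 ` G"
        then obtain g where g: "g \<in> G" "h = h1 + g" by blast
        have "- h + x + h = - g + (- h1 + x + h1) + g"
          by (simp add: g minus_add add.assoc diff_conv_add_uminus del: add_uminus_conv_diff)
        then show "h \<in> {h \<in> H. - h + x + h \<in> G}"
          using g h1 G(2) by (auto intro!: fin_subgroupD(3,4)[OF H] fin_subgroupD(3,4)[OF G(1)])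
      qed
      then have "card {h \<in> H. - h + x + h \<in> G} = card G" by (simp add: card_image)
      then have "cf (class_sum H f) x = 1" using mn by (simp only: cls) (simp add: m_def)
      then show ?thesis using nt 4 mn by simp
    qed
  qed
  have cardK: "of_nat (card K) * m = n"
  proof -
    have "(\<Sum>x\<in>H. cf t x) = of_nat (card K) * (m / n)"
    proof -
      have "(\<Sum>x\<in>H. cf t x) = (\<Sum>x\<in>K. m / n)"
        by (rule sum.mono_neutral_cong_right[OF finH K_sub]) (auto simp: t_coeff)
      then show ?thesis by simp
    qed
    moreover have "(\<Sum>x\<in>H. cf t x) = 1"
    proof -
      have "(\<Sum>x\<in>H. cf t x) = 1 / n * ((\<Sum>x\<in>H. cf (sc n) x) - m * (\<Sum>x\<in>H. cf (class_sum H f) x) + m * (\<Sum>x\<in>H. cf s x))"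
        unfolding t_def sum_\<theta>
        by (simp add: lookup_add lookup_minus sum_distrib_left[symmetric] sum.distrib sum_subtractf del: lookup_single)
          (simp add: sum_divide_distrib[symmetric] sum.distrib sum_subtractf sum_distrib_left)
      also have "(\<Sum>x\<in>H. cf (sc n) x) = n"
        using finH fin_subgroupD(2)[OF H] by (simp add: lookup_single when_def)
      also have "(\<Sum>x\<in>H. cf (class_sum H f) x) = n"
        unfolding sum_class sum_G[OF fG(1)] using sum_cf_mean[OF G(1)] by (simp add: f_def)
      also have "(\<Sum>x\<in>H. cf s x) = n" by (rule sum_s)
      finally show ?thesis using mn by simp
    qed
    ultimately show ?thesis using mn by (simp add: field_simps)
  qed
  have t0: "cf t 0 = m / n"
    using t_coeff[of 0] fin_subgroupD(2)[OF H] by (auto simp: K_def frobenius_kernel_def)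
  have tt0: "cf (t * t) 0 = m / n"
  proof -
    have "cf (t * t) 0 = (\<Sum>y\<in>H. cf t y * cf t (- y))" by (simp add: cf_mult[OF tH finH])
    also have "\<dots> = (\<Sum>y\<in>K. m / n * (m / n))"
    proof (rule sum.mono_neutral_cong_right[OF finH K_sub])
      fix y assume "y \<in> K"
      then have "- y \<in> K" unfolding K_def by (rule frobenius_kernel_minus[OF H G(1)])
      then show "cf t y * cf t (- y) = m / n * (m / n)" using \<open>y \<in> K\<close> by (simp add: t_coeff)
    qed (simp add: t_coeff)
    also have "\<dots> = (of_nat (card K) * m) * m / (n * n)" by simp
    finally show ?thesis using cardK mn by simp
  qed
  \<comment> \<open>The eigenvalue of \<open>t\<close> on the irreducible module
    \<open>\<complex>[H] E\<close>.\<close>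
  define \<tau> where "\<tau> E = real_of_int (\<Sum>e\<in>\<B>. ci e E) / real (Di E)" for E
  have tE: "t * E = sc (of_real (\<tau> E)) * E" if E: "E \<in> \<E>" for E
  proof -
    have "t * E = sc (1 / n) * (\<Sum>e\<in>\<B>. sc (c e E / cf E 0) * E)"
      by (simp add: t_def mult.assoc sum_distrib_right \<theta>E[OF _ E])
    also have "\<dots> = sc (1 / n * (\<Sum>e\<in>\<B>. c e E / cf E 0)) * E"
      by (intro poly_mapping_eqI) (simp add: lookup_sum sum_distrib_right)
    also have "1 / n * (\<Sum>e\<in>\<B>. c e E / cf E 0) = of_real (\<tau> E)"
    proof -
      have "of_real (\<tau> E) = (\<Sum>e\<in>\<B>. c e E) / D E"
        using Di(1)[OF E] ci[OF _ E] by (simp add: \<tau>_def)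
      then show ?thesis using mn by (simp add: D_def sum_divide_distrib[symmetric])
    qed
    finally show ?thesis .
  qed
  have \<tau>_nonneg: "0 \<le> \<tau> E" if "E \<in> \<E>" for E
    unfolding \<tau>_def using c_nonneg that by (auto intro!: divide_nonneg_nonneg sum_nonneg)
  \<comment> \<open>The difference \<open>f - mean H\<close> is an idempotent, so its
    multiplicities \<open>k\<close> are natural numbers.\<close>
  have \<tau>_le: "\<tau> E \<le> 1" if E: "E \<in> \<E>" for E
  proof -
    have "mean H * f = mean H"
      using mean_absorbs[OF H fH] sum_G[OF fG(1)] sum_cf_mean[OF G(1)] by (simp add: f_def)
    moreover have "f * mean H = mean H * f"
      using class_sum_central[OF H fH, of "mean H"] class_sum_mean[OF H] mn
      by (simp add: mean_def sc_mult_assoc[of f] mult.assoc)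
    ultimately have "(f - mean H) * (f - mean H) = f - mean H"
      by (simp add: left_diff_distrib right_diff_distrib fG mean_idempotent H)
    from pairing_idempotents_Nats[OF H galg_diff[OF fH mean_galg[OF H]] this EH[OF E]]
    obtain k where k: "pairing H f E - pairing H (mean H) E = of_nat k"
      by (auto simp: pairing_linear elim: Nats_cases)
    have "of_int (\<Sum>e\<in>\<B>. ci e E) = (\<Sum>e\<in>\<B>. c e E)" using ci[OF _ E] by simp
    also have "\<dots> = cf ((\<Sum>e\<in>\<B>. \<theta> e) * E) 0" by (simp add: c_def sum_distrib_right lookup_sum)
    also have "\<dots> = D E - m * (pairing H f E - pairing H (mean H) E)"
      unfolding sum_\<theta> by (simp add: distrib_right left_diff_distrib lookup_add lookup_minus mult.assoc
          D_def pairing_def s_class right_diff_distrib)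
    also have "\<dots> = of_int (int (Di E) - int (card G) * int k)"
      using Di(1)[OF E] k by (simp add: m_def)
    finally have "(\<Sum>e\<in>\<B>. ci e E) = int (Di E) - int (card G) * int k" by (simp only: of_int_eq_iff)
    then have "(\<Sum>e\<in>\<B>. ci e E) \<le> int (Di E)" by simp
    then show ?thesis using Di(2)[OF E] unfolding \<tau>_def
      by (simp add: divide_le_eq) (metis of_int_le_iff of_int_of_nat_eq of_int_sum)
  qed
  \<comment> \<open>The traces of \<open>t\<close> and \<open>t\<^sup>2\<close> agree, so the
    nonnegative numbers \<open>\<tau> - \<tau>\<^sup>2\<close>, weighted by dimensions, add up to
    zero.\<close>
  have t_idem: "t * t = t"
  proof -
    have ttE: "t * t * E = sc (of_real (\<tau> E * \<tau> E)) * E" if "E \<in> \<E>" for E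
      by (simp add: mult.assoc tE[OF that] sc_mult_assoc[of t] sc_mult_sc)
    have "(\<Sum>E\<in>\<E>. (\<tau> E - \<tau> E * \<tau> E) * real (Di E)) = 0"
    proof -
      have "complex_of_real (\<Sum>E\<in>\<E>. (\<tau> E - \<tau> E * \<tau> E) * real (Di E)) = (\<Sum>E\<in>\<E>. n * (cf (t * E) 0 - cf (t * t * E) 0))"
        unfolding of_real_sum
        by (intro sum.cong refl) (simp add: tE ttE Di(1)[symmetric], simp add: D_def algebra_simps)
      also have "\<dots> = n * (cf t 0 - cf (t * t) 0)"
        by (simp only: expand[of t] expand[of "t * t"] sum_subtractf sum_distrib_left right_diff_distrib)
      finally have "complex_of_real (\<Sum>E\<in>\<E>. (\<tau> E - \<tau> E * \<tau> E) * real (Di E)) = 0" by (simp add: t0 tt0)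
      then show ?thesis by (metis of_real_eq_0_iff)
    qed
    moreover have "0 \<le> (\<tau> E - \<tau> E * \<tau> E) * real (Di E)" if "E \<in> \<E>" for E
      using mult_left_mono[OF \<tau>_le[OF that] \<tau>_nonneg[OF that]] by (intro mult_nonneg_nonneg) auto
    ultimately have "(\<tau> E - \<tau> E * \<tau> E) * real (Di E) = 0" if "E \<in> \<E>" for E
      using sum_nonneg_eq_0_iff[OF \<E>(1), of "\<lambda>E. (\<tau> E - \<tau> E * \<tau> E) * real (Di E)"] that by simp
    then have \<tau>_idem: "\<tau> E * \<tau> E = \<tau> E" if "E \<in> \<E>" for E using Di(2)[OF that] that by force
    have "t * t * E = t * E" if "E \<in> \<E>" for E
      using ttE[OF that] tE[OF that] \<tau>_idem[OF that] by simp
    then have "(\<Sum>E\<in>\<E>. t * t * E) = (\<Sum>E\<in>\<E>. t * E)" by simp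
    then show ?thesis by (simp add: sum_distrib_left[symmetric] \<E>(3))
  qed
  have closed: "x + y \<in> K" if x: "x \<in> K" and y: "y \<in> K" for x y
  proof (rule ccontr)
    assume "x + y \<notin> K"
    define r where "r z = (if z \<in> K then 1 else 0 :: real)" for z
    have tr: "cf t z = m / n * of_real (r z)" for z by (simp add: t_coeff r_def)
    have "0 = cf (t * t) (x + y)" using t_idem t_coeff \<open>x + y \<notin> K\<close> by simp
    also have "\<dots> = (\<Sum>z\<in>H. (m / n) * (m / n) * of_real (r z * r (- z + (x + y))))"
      unfolding cf_mult[OF tH finH] by (intro sum.cong refl) (simp only: tr of_real_mult mult_ac)
    also have "\<dots> = (m / n) * (m / n) * of_real (\<Sum>z\<in>H. r z * r (- z + (x + y)))"
      by (simp only: of_real_sum sum_distrib_left)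
    finally have "0 = (m / n) * (m / n) * complex_of_real (\<Sum>z\<in>H. r z * r (- z + (x + y)))" .
    moreover have "(m / n) * (m / n) \<noteq> 0" using mn by simp
    ultimately have "complex_of_real (\<Sum>z\<in>H. r z * r (- z + (x + y))) = 0"
      by (metis mult_eq_0_iff)
    then have "(\<Sum>z\<in>H. r z * r (- z + (x + y))) = 0" by (simp only: of_real_eq_0_iff)
    moreover have "0 \<le> r z * r (- z + (x + y))" for z by (simp add: r_def)
    ultimately have "r x * r (- x + (x + y)) = 0"
      using sum_nonneg_eq_0_iff[OF finH, of "\<lambda>z. r z * r (- z + (x + y))"] x K_sub by auto
    then show False using x y by (simp add: r_def add.assoc[symmetric])
  qed
  show "fin_subgroup (frobenius_kernel H G)"
    unfolding fin_subgroup_def K_def[symmetric]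
  proof (intro conjI ballI closed)
    show "finite K" using K_sub finH by (rule finite_subset)
    show "0 \<in> K" using fin_subgroupD(2)[OF H] by (auto simp: K_def frobenius_kernel_def)
    show "- x \<in> K" if "x \<in> K" for x using that unfolding K_def by (rule frobenius_kernel_minus[OF H G(1)])
  qed
  show "card (frobenius_kernel H G) * card G = card H"
    using cardK unfolding K_def[symmetric] m_def n_def by (metis of_nat_eq_iff of_nat_mult)
qed

section \<open>An elementary abelian subgroup normalised by the complement\<close>

definition gconj :: "'g::group_add \<Rightarrow> 'g \<Rightarrow> 'g" where "gconj x t = x + t - x"

lemma gconj_simps [simp]: "gconj 0 t = t" "gconj x 0 = 0"
  by (simp_all add: gconj_def)

lemma gconj_add: "gconj x (s + t) = gconj x s + gconj x t"
  by (simp add: gconj_def diff_conv_add_uminus add.assoc del: add_uminus_conv_diff)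

lemma gconj_minus: "gconj x (- t) = - gconj x t"
  by (simp add: gconj_def diff_conv_add_uminus minus_add add.assoc del: add_uminus_conv_diff)

lemma gconj_gconj: "gconj x (gconj y t) = gconj (x + y) t"
  by (simp add: gconj_def diff_conv_add_uminus minus_add add.assoc del: add_uminus_conv_diff)

lemma gconj_inverse [simp]: "gconj (- x) (gconj x t) = t" "gconj x (gconj (- x) t) = t"
  by (simp_all add: gconj_gconj)

lemma gconj_eq_iff [simp]: "gconj x s = gconj x t \<longleftrightarrow> s = t"
  by (metis gconj_inverse(1))

lemma gconj_eq_0_iff [simp]: "gconj x t = 0 \<longleftrightarrow> t = 0"
  by (metis gconj_eq_iff gconj_simps(2))

lemma inj_gconj: "inj_on (gconj x) A"
  by (simp add: inj_on_def)

lemma gconj_image_iff: "t \<in> gconj x ` A \<longleftrightarrow> gconj (- x) t \<in> A"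
  by (metis gconj_inverse imageE image_eqI)

lemma gconj_closed: "fin_subgroup S \<Longrightarrow> x \<in> S \<Longrightarrow> t \<in> S \<Longrightarrow> gconj x t \<in> S"
  unfolding gconj_def by (intro fin_subgroupD(3,5))

lemma fin_subgroup_gconj_image: "fin_subgroup C \<Longrightarrow> fin_subgroup (gconj x ` C)"
  using conjugate_subgroup[of C x] by (simp add: gconj_def[abs_def])

lemma card_eq_fibres:
  assumes "finite A" "\<And>y. y \<in> f ` A \<Longrightarrow> card {x \<in> A. f x = y} = k"
  shows "card A = card (f ` A) * k"
proof -
  have "card A = (\<Sum>y\<in>f ` A. card {x \<in> A. f x = y})"
    using sum.image_gen[OF assms(1), of "\<lambda>_. 1::nat" f] by simp
  then show ?thesis using assms(2) by simp
qed

text \<open>The orbits that are not single points have sizes divisible by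
  \<open>p\<close>.\<close>

lemma p_group_fixed_points:
  assumes P: "fin_subgroup P" "card P = p ^ a" and p: "Factorial_Ring.prime (p::nat)" and Y: "finite Y"
    and act: "\<And>x y. x \<in> P \<Longrightarrow> y \<in> Y \<Longrightarrow> act x y \<in> Y" "\<And>y. y \<in> Y \<Longrightarrow> act 0 y = y"
    "\<And>x x' y. x \<in> P \<Longrightarrow> x' \<in> P \<Longrightarrow> y \<in> Y \<Longrightarrow> act (x + x') y = act x (act x' y)"
  shows "p dvd card (Y - {y \<in> Y. \<forall>x\<in>P. act x y = y})"
proof -
  define orb where "orb y = (\<lambda>x. act x y) ` P" for y
  define U where "U = Y - {y \<in> Y. \<forall>x\<in>P. act x y = y}"
  note P' = fin_subgroupD[OF P(1)]
  have inverse: "act (- x) (act x y) = y" if "x \<in> P" "y \<in> Y" for x y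
    using act(3)[of "- x" x y] act(2)[OF that(2)] that P' by simp
  have orb_eq: "orb z = orb y" if y: "y \<in> Y" and z: "z \<in> orb y" for y z
  proof -
    obtain x where x: "x \<in> P" "z = act x y" using z by (auto simp: orb_def)
    have "orb z \<subseteq> orb y"
    proof
      fix u assume "u \<in> orb z"
      then obtain v where v: "v \<in> P" "u = act v z" by (auto simp: orb_def)
      then have "u = act (v + x) y" using act(3)[OF v(1) x(1) y] x(2) by simp
      then show "u \<in> orb y" unfolding orb_def using P'(3)[OF v(1) x(1)] by blast
    qed
    moreover have "orb y \<subseteq> orb z"
    proof
      fix u assume "u \<in> orb y"
      then obtain v where v: "v \<in> P" "u = act v y" by (auto simp: orb_def)
      have "act (v + - x) z = act v (act (- x) z)"
        using act(3)[OF v(1) P'(4)[OF x(1)] act(1)[OF x(1) y]] x(2) by simp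
      also have "\<dots> = u" using inverse[OF x(1) y] x(2) v(2) by simp
      finally show "u \<in> orb z" unfolding orb_def using P'(3)[OF v(1) P'(4)[OF x(1)]] by blast
    qed
    ultimately show ?thesis by blast
  qed
  have self: "y \<in> orb y" if "y \<in> Y" for y
    unfolding orb_def using act(2)[OF that] P'(2) by (metis image_eqI)
  have orbY: "orb y \<subseteq> Y" if "y \<in> Y" for y using act(1) that by (auto simp: orb_def)
  have orbU: "orb y \<subseteq> U" if y: "y \<in> U" for y
  proof
    fix z assume z: "z \<in> orb y"
    have yY: "y \<in> Y" using y by (auto simp: U_def)
    show "z \<in> U"
    proof (rule ccontr)
      assume "z \<notin> U"
      then have "\<forall>x\<in>P. act x z = z" using z orbY[OF yY] by (auto simp: U_def)
      then have "orb z = {z}" using P'(2) by (auto simp: orb_def)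
      then have "orb y = {z}" "y = z" using orb_eq[OF yY z] self[OF yY] by auto
      then have "\<forall>x\<in>P. act x y = y" by (auto simp: orb_def)
      then show False using y by (auto simp: U_def)
    qed
  qed
  have dv: "p dvd card (orb y)" if y: "y \<in> U" for y
  proof -
    have yY: "y \<in> Y" using y by (auto simp: U_def)
    have "card P = card (orb y) * card {x \<in> P. act x y = y}"
      unfolding orb_def
    proof (rule card_eq_fibres[OF P'(1)])
      fix z assume "z \<in> (\<lambda>x. act x y) ` P"
      then obtain u where u: "u \<in> P" "z = act u y" by blast
      have "bij_betw ((+) u) {x \<in> P. act x y = y} {x \<in> P. act x y = z}"
      proof (rule bij_betw_byWitness[where f' = "(+) (- u)"])
        show "(+) u ` {x \<in> P. act x y = y} \<subseteq> {x \<in> P. act x y = z}"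
          using u act(3)[OF u(1) _ yY] P'(3) by auto
        show "(+) (- u) ` {x \<in> P. act x y = z} \<subseteq> {x \<in> P. act x y = y}"
          using u act(3)[OF P'(4)[OF u(1)] _ yY] P'(3)[OF P'(4)[OF u(1)]] inverse[OF u(1) yY] by auto
      qed (auto simp: add.assoc[symmetric])
      then show "card {x \<in> P. act x y = z} = card {x \<in> P. act x y = y}"
        by (rule bij_betw_same_card[symmetric])
    qed
    then have "card (orb y) dvd p ^ a" by (metis P(2) dvd_triv_left)
    then obtain i where i: "card (orb y) = p ^ i" using p by (auto simp: divides_primepow_nat)
    have "i \<noteq> 0"
    proof
      assume "i = 0"
      then obtain z where "orb y = {z}" using i by (auto simp: card_1_singleton_iff)
      then have "orb y = {y}" using self[OF yY] by auto
      then have "\<forall>x\<in>P. act x y = y" by (auto simp: orb_def)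
      then show False using y by (auto simp: U_def)
    qed
    then show ?thesis using i by simp
  qed
  have UU: "\<Union>(orb ` U) = U" using orbU self by (auto simp: U_def)
  have "p dvd card (\<Union>(orb ` U))"
  proof (rule dvd_partition)
    show "finite (\<Union>(orb ` U))" unfolding UU using Y by (simp add: U_def)
    show "\<forall>c\<in>orb ` U. p dvd card c" using dv by blast
    show "\<forall>c1\<in>orb ` U. \<forall>c2\<in>orb ` U. c1 \<noteq> c2 \<longrightarrow> c1 \<inter> c2 = {}"
    proof (intro ballI impI, rule ccontr)
      fix c1 c2 assume c: "c1 \<in> orb ` U" "c2 \<in> orb ` U" "c1 \<noteq> c2" "c1 \<inter> c2 \<noteq> {}"
      then obtain y1 y2 z where "y1 \<in> Y" "y2 \<in> Y" "c1 = orb y1" "c2 = orb y2" "z \<in> orb y1" "z \<in> orb y2"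
        by (auto simp: U_def)
      then show False using orb_eq c(3) by metis
    qed
  qed
  then show ?thesis unfolding UU by (simp add: U_def)
qed

lemma card_subgroup_product:
  assumes A: "fin_subgroup A" and B: "fin_subgroup B"
  shows "card A * card B = card ((\<lambda>(a, b). a + b) ` (A \<times> B)) * card (A \<inter> B)"
proof -
  note A' = fin_subgroupD[OF A] and B' = fin_subgroupD[OF B]
  have "card (A \<times> B) = card ((\<lambda>(a, b). a + b) ` (A \<times> B)) * card (A \<inter> B)"
  proof (rule card_eq_fibres[where f = "\<lambda>(a, b). a + b" and A = "A \<times> B" and k = "card (A \<inter> B)"])
    fix y assume "y \<in> (\<lambda>(a, b). a + b) ` (A \<times> B)"
    then obtain a b where ab: "a \<in> A" "b \<in> B" "y = a + b" by auto
    have "bij_betw (\<lambda>u. (a + u, - u + b)) (A \<inter> B) {x \<in> A \<times> B. (\<lambda>(a, b). a + b) x = y}"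
    proof (rule bij_betw_byWitness[where f' = "\<lambda>(a', b'). - a + a'"])
      show "(\<lambda>u. (a + u, - u + b)) ` (A \<inter> B) \<subseteq> {x \<in> A \<times> B. (\<lambda>(a, b). a + b) x = y}"
        using ab A' B' by (auto simp: add.assoc)
      have "- a + a' \<in> A \<inter> B" if "a' \<in> A" "b' \<in> B" "a' + b' = a + b" for a' b'
      proof -
        have "a' = a + b - b'" using that(3) by (metis add_diff_cancel)
        then have "- a + a' = b - b'"
          by (simp add: add.assoc[symmetric] diff_conv_add_uminus del: add_uminus_conv_diff)
        then show ?thesis using that ab A' B' by (metis IntI)
      qed
      then show "(\<lambda>(a', b'). - a + a') ` {x \<in> A \<times> B. (\<lambda>(a, b). a + b) x = y} \<subseteq> A \<inter> B"
        by (auto simp: ab(3))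
      show "\<forall>x\<in>{x \<in> A \<times> B. (\<lambda>(a, b). a + b) x = y}.
          (\<lambda>u. (a + u, - u + b)) (case x of (a', b') \<Rightarrow> - a + a') = x"
      proof
        fix x assume x: "x \<in> {x \<in> A \<times> B. (\<lambda>(a, b). a + b) x = y}"
        obtain a' b' where x': "x = (a', b')" by (cases x)
        then have "a' + b' = a + b" using x ab(3) by simp
        then have "b' = - a' + (a + b)" by (metis add.assoc add_0 left_minus)
        then show "(\<lambda>u. (a + u, - u + b)) (case x of (a', b') \<Rightarrow> - a + a') = x"
          by (simp add: x' minus_add add.assoc[symmetric])
      qed
    qed (auto simp: add.assoc[symmetric])
    then show "card {x \<in> A \<times> B. (\<lambda>(a, b). a + b) x = y} = card (A \<inter> B)"
      by (rule bij_betw_same_card[symmetric])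
  qed (use A' B' in auto)
  then show ?thesis by (simp add: card_cartesian_product)
qed

text \<open>Acting on the cosets of \<open>P\<close>, whose number is prime to \<open>p\<close>,
  the \<open>p\<close>-group \<open>Q\<close> fixes some coset \<open>k + P\<close>, and then
  \<open>Q\<close> is contained in the conjugate of \<open>P\<close> by \<open>k\<close>.\<close>

lemma sylow_conjugate:
  assumes K: "fin_subgroup K" and p: "Factorial_Ring.prime (p::nat)" and card: "card K = p ^ a * m" "\<not> p dvd m"
    and P: "fin_subgroup P" "P \<subseteq> K" "card P = p ^ a" and Q: "fin_subgroup Q" "Q \<subseteq> K" "card Q = p ^ a"
  shows "\<exists>k\<in>K. Q = gconj k ` P"
proof -
  note K' = fin_subgroupD[OF K] and P' = fin_subgroupD[OF P(1)] and Q' = fin_subgroupD[OF Q(1)]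
  define coset where "coset k = (+) k ` P" for k
  have coset_iff: "x \<in> coset k \<longleftrightarrow> - k + x \<in> P" for x k
    unfolding coset_def by (metis (no_types, lifting) add.assoc add_0 imageE image_eqI left_minus right_minus)
  have coset_eq: "coset x = coset k \<longleftrightarrow> x \<in> coset k" for x k
  proof
    assume "coset x = coset k"
    moreover have "x \<in> coset x" by (simp add: coset_iff P')
    ultimately show "x \<in> coset k" by simp
  next
    assume x: "x \<in> coset k"
    have "- k + z \<in> P \<longleftrightarrow> - x + z \<in> P" for z
    proof -
      have "- k + z = (- k + x) + (- x + z)" by (simp add: add.assoc[symmetric])
      then show ?thesis using fin_subgroup_add_cancel(1)[OF P(1)] x by (simp add: coset_iff)
    qed
    then show "coset x = coset k" by (auto simp: coset_iff)
  qed
  have "card K = card (coset ` K) * card P"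
  proof (rule card_eq_fibres[OF K'(1)])
    fix y assume "y \<in> coset ` K"
    then obtain k where k: "k \<in> K" "y = coset k" by blast
    have "{x \<in> K. coset x = y} = (+) k ` P"
      using k P(2) K'(3)[OF k(1)] by (auto simp: coset_eq coset_def[symmetric]) (auto simp: coset_def)
    then show "card {x \<in> K. coset x = y} = card P" by (simp add: card_image)
  qed
  then have cY: "card (coset ` K) = m" using card P(3) p by (simp add: mult.commute)
  define Fix where "Fix = {y \<in> coset ` K. \<forall>x\<in>Q. (+) x ` y = y}"
  have "p dvd card (coset ` K - Fix)" unfolding Fix_def
  proof (rule p_group_fixed_points[OF Q(1,3) p])
    show "finite (coset ` K)" using K' by simp
    show "(+) x ` y \<in> coset ` K" if x: "x \<in> Q" and y: "y \<in> coset ` K" for x y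
    proof -
      obtain k where "k \<in> K" "y = coset k" using y by blast
      then have "(+) x ` y = coset (x + k)" "x + k \<in> K"
        using x Q(2) K'(3) by (auto simp: coset_def image_image add.assoc)
      then show ?thesis by blast
    qed
    show "(+) 0 ` y = y" for y :: "'a set" by simp
    show "(+) (x + x') ` y = (+) x ` (+) x' ` y" for x x' and y :: "'a set"
      by (simp add: image_image add.assoc)
  qed
  then have "Fix \<noteq> {}" using cY card(2) by auto
  then obtain k where k: "k \<in> K" "\<And>x. x \<in> Q \<Longrightarrow> (+) x ` coset k = coset k" by (auto simp: Fix_def)
  have "Q \<subseteq> gconj k ` P"
  proof
    fix x assume x: "x \<in> Q"
    have "k \<in> coset k" by (simp add: coset_iff P')
    then have "x + k \<in> coset k" using k(2)[OF x] by blast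
    then have "gconj (- k) x \<in> P" by (simp add: coset_iff gconj_def add.assoc)
    then show "x \<in> gconj k ` P" by (simp add: gconj_image_iff)
  qed
  moreover have "card (gconj k ` P) = card Q" by (simp add: card_image inj_gconj P(3) Q(3))
  ultimately have "Q = gconj k ` P" using P' by (intro card_subset_eq) auto
  then show ?thesis using k(1) by blast
qed

lemma sylow_exists:
  assumes S: "fin_subgroup S" and p: "Factorial_Ring.prime (p::nat)" and "card S = p ^ a * m"
  obtains C where "fin_subgroup C" "C \<subseteq> S" "card C = p ^ a"
proof -
  have "\<exists>C. subgroup C (grp S) \<and> card C = p ^ a"
    by (rule sylow_thm[OF p group_grp[OF S]]) (use assms in \<open>auto simp: Coset.order_def fin_subgroupD\<close>)
  then show ?thesis using that by (auto simp: subgroup_grp_iff[OF S])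
qed

lemma grp_nat_pow_cong: "x [^]\<^bsub>grp S\<^esub> (n::nat) = x [^]\<^bsub>grp T\<^esub> n"
  by (simp add: nat_pow_def)

lemma gconj_nat_pow: "gconj x (t [^]\<^bsub>grp S\<^esub> (n::nat)) = gconj x t [^]\<^bsub>grp T\<^esub> n"
  by (induction n) (simp_all add: nat_pow_def gconj_add)

text \<open>A subgroup \<open>N\<close> as large as the product of \<open>G\<close> with a part of
  the kernel contains a conjugate of \<open>G\<close>; in the proof below it is the normaliser of a
  Sylow subgroup. Count the pairs of \<open>x \<in> H\<close> and a nonidentity element of
  \<open>N\<close> that lies in the conjugate of \<open>G\<close> by \<open>x\<close>. Every element
  of \<open>N\<close> outside the kernel occurs with \<open>|G|\<close> choices of \<open>x\<close>,
  which gives \<open>|N| (|G| - 1)\<close> pairs. On the other hand the double coset \<open>N x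
  G\<close> contributes \<open>|N| |G| w / (w + 1)\<close> pairs when \<open>N\<close> meets that
  conjugate in \<open>w + 1\<close> elements, which is at least half of \<open>|N| |G|\<close>
  unless \<open>w = 0\<close>. So a single double coset contributes, and for it \<open>w + 1 =
  |G|\<close>.\<close>

lemma complement_in_large_subgroup:
  assumes H: "fin_subgroup H" and G: "fin_subgroup G" "G \<subseteq> H"
    and mal: "\<And>h g. h \<in> H \<Longrightarrow> h \<notin> G \<Longrightarrow> g \<in> G \<Longrightarrow> gconj h g \<in> G \<Longrightarrow> g = 0"
    and ntG: "1 < card G"
    and N: "fin_subgroup N" "N \<subseteq> H" and cN: "card N = card G * card (N \<inter> frobenius_kernel H G)"
  shows "\<exists>h\<in>H. gconj h ` G \<subseteq> N"
proof -
  define m where "m = card G"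
  note H' = fin_subgroupD[OF H] and G' = fin_subgroupD[OF G(1)] and N' = fin_subgroupD[OF N(1)]
  let ?K = "frobenius_kernel H G"
  define S where "S x = N \<inter> gconj x ` G" for x
  define w where "w x = card (S x - {0})" for x
  define T where "T x = {n + x + g | n g. n \<in> N \<and> g \<in> G}" for x
  have S0: "0 \<in> S x" for x by (simp add: S_def N' gconj_image_iff G')
  have finS: "finite (S x)" for x by (simp add: S_def N')
  have cS: "card (S x) = Suc (w x)" for x using S0 finS unfolding w_def by (metis card.remove)
  have TH: "T x \<subseteq> H" if "x \<in> H" for x using that N(2) G(2) by (auto simp: T_def intro!: H'(3))
  have finT: "finite (T x)" for x
    by (rule finite_subset[of _ "(\<lambda>(n, g). n + x + g) ` (N \<times> G)"]) (auto simp: T_def N' G')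
  have cT: "card (T x) * Suc (w x) = card N * m" for x
  proof -
    have "card N * card (gconj x ` G) = card ((\<lambda>(a, b). a + b) ` (N \<times> gconj x ` G)) * card (N \<inter> gconj x ` G)"
      by (rule card_subgroup_product[OF N(1) fin_subgroup_gconj_image[OF G(1)]])
    moreover have "T x = (\<lambda>u. u + x) ` (\<lambda>(a, b). a + b) ` (N \<times> gconj x ` G)"
      by (force simp: T_def gconj_def image_iff add.assoc diff_conv_add_uminus simp del: add_uminus_conv_diff)
    then have "card (T x) = card ((\<lambda>(a, b). a + b) ` (N \<times> gconj x ` G))"
      by (simp add: card_image inj_on_def)
    ultimately show ?thesis by (simp add: card_image inj_gconj m_def cS[symmetric] S_def)
  qed
  have wT: "w y = w x" if y: "y \<in> T x" for x y
  proof -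
    obtain n g where ng: "n \<in> N" "g \<in> G" "y = n + x + g" using y by (auto simp: T_def)
    have "S y - {0} = gconj n ` (S x - {0})"
    proof (rule Set.set_eqI)
      fix z
      have "gconj (- y) z = gconj (- g) (gconj (- x) (gconj (- n) z))"
        by (simp add: ng gconj_gconj minus_add add.assoc diff_conv_add_uminus del: add_uminus_conv_diff)
      then have "gconj (- y) z \<in> G \<longleftrightarrow> gconj (- x) (gconj (- n) z) \<in> G"
        using gconj_closed[OF G(1)] G'(4)[OF ng(2)] ng(2) by (metis gconj_inverse(2))
      moreover have "z \<in> N \<longleftrightarrow> gconj (- n) z \<in> N"
        using gconj_closed[OF N(1)] N'(4)[OF ng(1)] ng(1) by (metis gconj_inverse(2))
      ultimately show "z \<in> S y - {0} \<longleftrightarrow> z \<in> gconj n ` (S x - {0})"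
        by (simp add: S_def gconj_image_iff)
    qed
    then show ?thesis by (simp add: w_def card_image inj_gconj)
  qed
  have self: "x \<in> T x" for x
    unfolding T_def using N'(2) G'(2) by (intro CollectI exI[of _ 0]) auto
  have disj: "T x \<inter> T y = {}" if y: "y \<notin> T x" for x y
  proof (rule ccontr)
    assume "T x \<inter> T y \<noteq> {}"
    then obtain n g n' g' where e: "n \<in> N" "g \<in> G" "n' \<in> N" "g' \<in> G" "n + x + g = n' + y + g'"
      by (auto simp: T_def)
    have "y = - n' + (n' + y + g') + - g'" by (simp add: add.assoc)
    also have "\<dots> = (- n' + n) + x + (g + - g')" unfolding e(5)[symmetric]
      by (simp add: add.assoc diff_conv_add_uminus del: add_uminus_conv_diff)
    finally have "y \<in> T x" unfolding T_def using e G'(3,4) N'(3,4) by blast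
    then show False using y by simp
  qed
  have total: "(\<Sum>x\<in>H. w x) = card N * (m - 1)"
  proof -
    have "(\<Sum>x\<in>H. w x) = (\<Sum>x\<in>H. \<Sum>z\<in>N - {0}. if gconj (- x) z \<in> G then 1 else 0)"
    proof (intro sum.cong refl)
      fix x
      have "S x - {0} = {z \<in> N - {0}. gconj (- x) z \<in> G}" by (auto simp: S_def gconj_image_iff)
      then show "w x = (\<Sum>z\<in>N - {0}. if gconj (- x) z \<in> G then 1 else 0)"
        using N' by (simp add: w_def sum.If_cases Int_def)
    qed
    also have "\<dots> = (\<Sum>z\<in>N - {0}. card {x \<in> H. gconj (- x) z \<in> G})"
      by (subst sum.swap) (use H' in \<open>simp add: sum.If_cases Int_def\<close>)
    also have "\<dots> = (\<Sum>z\<in>N - {0}. if z \<in> ?K then 0 else m)"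
    proof (intro sum.cong refl)
      fix z assume z: "z \<in> N - {0}"
      show "card {x \<in> H. gconj (- x) z \<in> G} = (if z \<in> ?K then 0 else m)"
      proof (cases "z \<in> ?K")
        case True
        have "{x \<in> H. gconj (- x) z \<in> G} = {}"
        proof -
          have "\<forall>h\<in>H. gconj h z \<in> G \<longrightarrow> z = 0"
            using True by (simp add: frobenius_kernel_def gconj_def)
          then show ?thesis using z H'(4) by blast
        qed
        then show ?thesis using True by (simp only: card.empty if_True)
      next
        case False
        then obtain h where h: "h \<in> H" "gconj h z \<in> G"
          using z N(2) by (auto simp: frobenius_kernel_def gconj_def)
        have "{x \<in> H. gconj (- x) z \<in> G} = (+) (- h) ` G"
        proof (intro equalityI subsetI)
          fix x assume "x \<in> {x \<in> H. gconj (- x) z \<in> G}"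
          then have x: "x \<in> H" "gconj (- x) z \<in> G" by auto
          have "gconj (h + x) (gconj (- x) z) = gconj h z"
            by (simp add: gconj_gconj add.assoc)
          then have "h + x \<in> G"
            using mal[of "h + x" "gconj (- x) z"] x h z H'(3) by auto
          then show "x \<in> (+) (- h) ` G" by (intro image_eqI[of _ _ "h + x"]) (auto simp: add.assoc[symmetric])
        next
          fix x assume "x \<in> (+) (- h) ` G"
          then obtain g where g: "g \<in> G" "x = - h + g" by blast
          then have "gconj (- x) z = gconj (- g) (gconj h z)" by (simp add: gconj_gconj minus_add)
          then show "x \<in> {x \<in> H. gconj (- x) z \<in> G}"
            using g h G(2) H'(3)[OF H'(4)[OF h(1)]] gconj_closed[OF G(1) G'(4)[OF g(1)] h(2)] by auto
        qed
        then show ?thesis using False by (simp add: card_image m_def)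
      qed
    qed
    also have "\<dots> = card (N - ?K) * m"
    proof -
      have "{z \<in> N - {0}. z \<notin> ?K} = N - ?K" using H'(2) by (auto simp: frobenius_kernel_def)
      moreover have "(N - {0}) \<inter> {z. z \<notin> ?K} = {z \<in> N - {0}. z \<notin> ?K}" by auto
      ultimately show ?thesis using N' by (simp add: sum.If_cases Compl_eq)
    qed
    also have "card (N - ?K) = card N - card (N \<inter> ?K)" using N' by (simp add: card_Diff_subset_Int)
    also have "(card N - card (N \<inter> ?K)) * m = card N * (m - 1)"
      using cN by (simp add: m_def[symmetric] algebra_simps diff_mult_distrib diff_mult_distrib2)
    finally show ?thesis .
  qed
  have Npos: "0 < card N" by (rule fin_subgroup_card_pos[OF N(1)])
  have m1: "1 < m" using ntG by (simp add: m_def)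
  have "\<exists>h\<in>H. w h \<noteq> 0"
  proof (rule ccontr)
    assume "\<not> (\<exists>h\<in>H. w h \<noteq> 0)"
    then show False using total Npos m1 by simp
  qed
  then obtain h where h: "h \<in> H" "0 < w h" by blast
  have half: "card N * m \<le> 2 * (card (T x) * w x)" if "0 < w x" for x
  proof -
    have "card (T x) * 1 \<le> card (T x) * w x" using that by (intro mult_le_mono) auto
    then show ?thesis unfolding cT[of x, symmetric] by simp
  qed
  have sumT: "(\<Sum>y\<in>T x. w y) = card (T x) * w x" for x using wT by simp
  have others: "w y = 0" if y: "y \<in> H - T h" for y
  proof (rule ccontr)
    assume "w y \<noteq> 0"
    then have "card N * m \<le> 2 * (card (T y) * w y)" using half by simp
    moreover have "card N * m \<le> 2 * (card (T h) * w h)" using half h by simp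
    moreover have "(\<Sum>x\<in>T h \<union> T y. w x) \<le> (\<Sum>x\<in>H. w x)"
      by (rule sum_mono2) (use H' TH h y in auto)
    moreover have "(\<Sum>x\<in>T h \<union> T y. w x) = card (T h) * w h + card (T y) * w y"
      using sum.union_disjoint[OF finT[of h] finT[of y] disj[of y h], of w] y sumT by simp
    ultimately have "card N * m \<le> card N * (m - 1)" using total by linarith
    then show False using Npos m1 by simp
  qed
  have "(\<Sum>x\<in>H. w x) = (\<Sum>x\<in>T h. w x)"
    by (rule sum.mono_neutral_right) (use H' TH[OF h(1)] others in auto)
  then have "card (T h) * w h = card N * (m - 1)" using total by (simp add: sumT)
  then have "card (T h) + card N * (m - 1) = card N * m" using cT[of h] by simp
  moreover have "card N * m = card N + card N * (m - 1)" using m1 by (cases m) auto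
  ultimately have "card (T h) = card N" by linarith
  then have "card N * Suc (w h) = card N * m" using cT[of h] by simp
  then have "Suc (w h) = m" using Npos by (simp only: mult_cancel1) simp
  then have "card (S h) = card (gconj h ` G)" by (simp add: cS card_image inj_gconj m_def)
  moreover have "S h \<subseteq> gconj h ` G" by (auto simp: S_def)
  ultimately have "S h = gconj h ` G" using G' by (intro card_subset_eq) auto
  then show ?thesis using h(1) by (auto simp: S_def)
qed

text \<open>Let \<open>p\<close> be a prime divisor of \<open>|K|\<close> and \<open>P\<close> a
  Sylow \<open>p\<close>-subgroup of \<open>K\<close>. By the Frattini argument the normaliser
  \<open>N\<close> of \<open>P\<close> in \<open>H\<close> satisfies \<open>K N = H\<close>, so
  \<open>N\<close> has the size that makes it contain a conjugate of \<open>G\<close>. The elements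
  of the centre of \<open>P\<close> that \<open>p\<close> annihilates form a subgroup normalised by
  \<open>N\<close>; conjugating it back gives \<open>A\<close>. Centralisers of nonidentity elements
  of \<open>G\<close> lie in \<open>G\<close>, so \<open>G\<close> acts on \<open>K\<close> without
  fixed points.\<close>

theorem frobenius_elementary_abelian_subgroup:
  assumes H: "fin_subgroup H" and G: "fin_subgroup G" "G \<subseteq> H"
    and mal: "\<And>h g. h \<in> H \<Longrightarrow> h \<notin> G \<Longrightarrow> g \<in> G \<Longrightarrow> h + g - h \<in> G \<Longrightarrow> g = 0"
    and ntG: "G \<noteq> {0}" and proper: "G \<noteq> H"
  obtains p A where "Factorial_Ring.prime (p::nat)" "\<not> p dvd card G" "fin_subgroup A" "A \<noteq> {0}"
    "\<And>a b. a \<in> A \<Longrightarrow> b \<in> A \<Longrightarrow> a + b = b + a" "\<And>a. a \<in> A \<Longrightarrow> a [^]\<^bsub>grp A\<^esub> p = 0"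
    "\<And>g a. g \<in> G \<Longrightarrow> a \<in> A \<Longrightarrow> g + a - g \<in> A"
    "\<And>g a. g \<in> G \<Longrightarrow> g \<noteq> 0 \<Longrightarrow> a \<in> A \<Longrightarrow> g + a - g = a \<Longrightarrow> a = 0"
proof -
  note H' = fin_subgroupD[OF H] and G' = fin_subgroupD[OF G(1)]
  define K where "K = frobenius_kernel H G"
  have K: "fin_subgroup K" unfolding K_def
    by (rule frobenius_kernel_subgroup(1)[OF H G]) (rule mal)
  have cK: "card K * card G = card H" unfolding K_def
    by (rule frobenius_kernel_subgroup(2)[OF H G]) (rule mal)
  note K' = fin_subgroupD[OF K]
  have KH: "K \<subseteq> H" by (auto simp: K_def frobenius_kernel_def)
  have conjK: "gconj h k \<in> K" if "h \<in> H" "k \<in> K" for h k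
    using frobenius_kernel_conjugate[OF H that[unfolded K_def]] by (simp add: K_def gconj_def)
  have cG: "1 < card G"
  proof -
    have "{0} \<subset> G" using ntG G'(2) by auto
    from psubset_card_mono[OF G'(1) this] show ?thesis by simp
  qed
  have fpf: "k = 0" if g: "g \<in> G" "g \<noteq> 0" and k: "k \<in> K" "gconj g k = k" for g k
  proof -
    have "g + k = k + g" using k(2) by (metis gconj_def diff_add_cancel)
    then have "gconj k g = g" by (simp only: gconj_def) (metis add_diff_cancel)
    then have "k \<in> G" using mal[of k g] g k KH by (auto simp: gconj_def)
    then have "0 + k - 0 \<in> G" by simp
    then show "k = 0" using k(1) H'(2) by (fastforce simp: K_def frobenius_kernel_def)
  qed
  have "card K \<noteq> 1"
  proof
    assume "card K = 1"
    then have "card G = card H" using cK by simp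
    then show False using proper G(2) H'(1) by (metis card_subset_eq)
  qed
  then obtain p where p: "Factorial_Ring.prime p" "p dvd card K" using prime_factor_nat by blast
  have p2: "2 \<le> p" by (rule prime_ge_2_nat[OF p(1)])
  \<comment> \<open>A subgroup of \<open>G\<close> of order \<open>p\<close> would fix a number
    of elements of \<open>K\<close> divisible by \<open>p\<close>, but it only fixes
    \<open>0\<close>.\<close>
  have pG: "\<not> p dvd card G"
  proof
    assume "p dvd card G"
    then obtain l where "card G = p ^ 1 * l" by (auto simp: dvd_def)
    from sylow_exists[OF G(1) p(1) this]
    obtain C where C: "fin_subgroup C" "C \<subseteq> G" "card C = p ^ 1" by blast
    have "p dvd card (K - {k \<in> K. \<forall>x\<in>C. gconj x k = k})"
    proof (rule p_group_fixed_points[OF C(1,3) p(1) K'(1)])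
      show "gconj x k \<in> K" if "x \<in> C" "k \<in> K" for x k using conjK that C(2) G(2) by auto
    qed (simp_all add: gconj_gconj)
    moreover have "{k \<in> K. \<forall>x\<in>C. gconj x k = k} = {0}"
    proof -
      have "C \<noteq> {0}" using C(3) p2 by auto
      then obtain x where "x \<in> C" "x \<noteq> 0" using fin_subgroupD(2)[OF C(1)] by blast
      then show ?thesis using fpf[of x] C(2) K'(2) by auto
    qed
    ultimately have "p dvd card K - 1" using K' by simp
    moreover have "0 < card K" by (rule fin_subgroup_card_pos[OF K])
    ultimately have "p dvd 1" using p(2) by (metis dvd_diffD1 Suc_leI One_nat_def)
    then show False using p2 by simp
  qed
  obtain a m where am: "card K = p ^ a * m" "\<not> p dvd m"
    using fin_subgroup_card_pos[OF K] p2
    by (metis multiplicity_decompose' not_is_unit_0 less_numeral_extra(3) prime_elem_not_unit prime_imp_prime_elem p(1))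
  have a0: "a \<noteq> 0" using am p(2) by (cases a) auto
  obtain P where P: "fin_subgroup P" "P \<subseteq> K" "card P = p ^ a" using sylow_exists[OF K p(1) am(1)] .
  note P' = fin_subgroupD[OF P(1)]
  define N where "N = {h \<in> H. gconj h ` P = P}"
  have NH: "N \<subseteq> H" by (auto simp: N_def)
  have N: "fin_subgroup N" unfolding fin_subgroup_def
  proof (intro conjI ballI)
    show "finite N" using NH H' by (auto intro: finite_subset)
    show "0 \<in> N" using H' by (simp add: N_def)
    show "x + y \<in> N" if "x \<in> N" "y \<in> N" for x y
    proof -
      have "gconj (x + y) ` P = gconj x ` gconj y ` P" by (simp add: image_image gconj_gconj)
      then show ?thesis using that H'(3) by (auto simp: N_def)
    qed
    show "- x \<in> N" if "x \<in> N" for x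
    proof -
      have "gconj (- x) ` P = gconj (- x) ` gconj x ` P" using that by (simp add: N_def)
      also have "\<dots> = P" by (simp add: image_image)
      finally show ?thesis using that H'(4) by (simp add: N_def)
    qed
  qed
  have frattini: "(\<lambda>(a, b). a + b) ` (K \<times> N) = H"
  proof (intro equalityI subsetI)
    fix h assume h: "h \<in> H"
    have "gconj h ` P \<subseteq> K" using conjK[OF h] P(2) by auto
    then obtain k where k: "k \<in> K" "gconj h ` P = gconj k ` P"
      using sylow_conjugate[OF K p(1) am P fin_subgroup_gconj_image[OF P(1)]]
      by (metis P(3) card_image inj_gconj)
    have "gconj (- k + h) ` P = gconj (- k) ` gconj h ` P" by (simp add: image_image gconj_gconj)
    also have "\<dots> = P" by (simp add: k(2) image_image)
    finally have "- k + h \<in> N" using h k(1) KH H'(3,4) by (auto simp: N_def)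
    then show "h \<in> (\<lambda>(a, b). a + b) ` (K \<times> N)"
      using k(1) by (intro image_eqI[of _ _ "(k, - k + h)"]) (auto simp: add.assoc[symmetric])
  qed (use KH NH H'(3) in auto)
  have cN: "card N = card G * card (N \<inter> frobenius_kernel H G)"
  proof -
    have "card K * card N = card H * card (K \<inter> N)"
      using card_subgroup_product[OF K N] frattini by simp
    also have "\<dots> = card K * (card G * card (N \<inter> K))" by (simp add: cK[symmetric] Int_commute)
    finally show ?thesis using fin_subgroup_card_pos[OF K] by (simp add: K_def)
  qed
  obtain h where h: "h \<in> H" "gconj h ` G \<subseteq> N"
    using complement_in_large_subgroup[OF H G _ cG N NH cN] mal unfolding gconj_def by blast
  define Z where "Z = {z \<in> P. \<forall>x\<in>P. gconj x z = z}"
  have Z_comm: "z + x = x + z" if "z \<in> Z" "x \<in> P" for z x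
  proof -
    have "gconj x z + x = z + x" using that by (simp add: Z_def)
    then show ?thesis by (simp add: gconj_def)
  qed
  have Z: "fin_subgroup Z" unfolding fin_subgroup_def
    using P' by (auto simp: Z_def gconj_add gconj_minus)
  have ZP: "Z \<subseteq> P" by (auto simp: Z_def)
  have "p dvd card (P - Z)" unfolding Z_def
  proof (rule p_group_fixed_points[OF P(1,3) p(1) P'(1)])
    show "gconj x k \<in> P" if "x \<in> P" "k \<in> P" for x k using gconj_closed[OF P(1) that] .
  qed (simp_all add: gconj_gconj)
  moreover have "p dvd card P" using a0 by (simp add: P(3))
  moreover have "card P = card (P - Z) + card Z"
    using ZP P'(1) by (metis card_Diff_subset card_mono finite_subset le_add_diff_inverse2)
  ultimately have "p dvd card Z" by (metis dvd_add_right_iff)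
  then obtain l where "card Z = p ^ 1 * l" by (auto simp: dvd_def)
  from sylow_exists[OF Z p(1) this]
  obtain C where C: "fin_subgroup C" "C \<subseteq> Z" "card C = p ^ 1" by blast
  have "C \<noteq> {0}" using C(3) p2 by auto
  then obtain c where c: "c \<in> C" "c \<noteq> 0" using fin_subgroupD(2)[OF C(1)] by blast
  define \<Omega> where "\<Omega> = {z \<in> Z. z [^]\<^bsub>grp Z\<^esub> p = 0}"
  have "c [^]\<^bsub>grp C\<^esub> p = 0"
  proof -
    interpret C: group "grp C" by (rule group_grp[OF C(1)])
    show ?thesis using C.pow_order_eq_1[of c] c C(3) by (simp add: Coset.order_def)
  qed
  then have c\<Omega>: "c \<in> \<Omega>" using c C(2) grp_nat_pow_cong[of C c p Z] by (auto simp: \<Omega>_def)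
  interpret Z: group "grp Z" by (rule group_grp[OF Z])
  note Z' = fin_subgroupD[OF Z]
  have \<Omega>: "fin_subgroup \<Omega>" unfolding fin_subgroup_def
  proof (intro conjI ballI)
    show "finite \<Omega>" using Z' by (simp add: \<Omega>_def)
    show "0 \<in> \<Omega>" using Z'(2) Z.nat_pow_one[of p] by (simp add: \<Omega>_def)
    show "x + y \<in> \<Omega>" if "x \<in> \<Omega>" "y \<in> \<Omega>" for x y
      using that Z.pow_mult_distrib[of x y p] Z_comm[of x y] ZP Z'(3) by (auto simp: \<Omega>_def)
    show "- x \<in> \<Omega>" if "x \<in> \<Omega>" for x
    proof -
      have x: "x \<in> Z" "x [^]\<^bsub>grp Z\<^esub> p = 0" using that by (auto simp: \<Omega>_def)
      have "(- x) [^]\<^bsub>grp Z\<^esub> p = inv\<^bsub>grp Z\<^esub> (x [^]\<^bsub>grp Z\<^esub> p)"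
        using Z.nat_pow_inv[of x p] x(1) by (simp add: grp_inv[OF Z])
      then show ?thesis using x Z' grp_inv[OF Z Z'(2)] by (simp add: \<Omega>_def)
    qed
  qed
  have N\<Omega>: "gconj n z \<in> \<Omega>" if n: "n \<in> N" and z: "z \<in> \<Omega>" for n z
  proof -
    have zP: "z \<in> P" "z \<in> Z" using z ZP by (auto simp: \<Omega>_def)
    have nP: "gconj n ` P = P" using n by (simp add: N_def)
    have "gconj x (gconj n z) = gconj n z" if x: "x \<in> P" for x
    proof -
      obtain y where y: "y \<in> P" "x = gconj n y" using x nP by blast
      have "gconj x (gconj n z) = gconj n (gconj y z)"
        by (simp add: y gconj_gconj) (simp add: gconj_def)
      then show ?thesis using zP(2) y(1) by (simp add: Z_def)
    qed
    moreover have "gconj n z \<in> P" using nP zP(1) by blast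
    ultimately have "gconj n z \<in> Z" by (simp add: Z_def)
    moreover have "gconj n z [^]\<^bsub>grp Z\<^esub> p = 0"
      using z gconj_nat_pow[of n Z z p Z] by (simp add: \<Omega>_def)
    ultimately show ?thesis by (simp add: \<Omega>_def)
  qed
  define A where "A = gconj (- h) ` \<Omega>"
  show ?thesis
  proof (rule that[of p A])
    show "fin_subgroup A" unfolding A_def by (rule fin_subgroup_gconj_image[OF \<Omega>])
    have "gconj (- h) c \<in> A" using c\<Omega> by (simp add: A_def)
    then show "A \<noteq> {0}" using c(2) by auto
    show "a + b = b + a" if "a \<in> A" "b \<in> A" for a b
      using that Z_comm ZP by (auto simp: A_def \<Omega>_def gconj_add[symmetric])
    show "a [^]\<^bsub>grp A\<^esub> p = 0" if "a \<in> A" for a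
    proof -
      obtain z where "a = gconj (- h) z" "z [^]\<^bsub>grp Z\<^esub> p = 0" using \<open>a \<in> A\<close> by (auto simp: A_def \<Omega>_def)
      then show ?thesis using gconj_nat_pow[of "- h" Z z p A] by simp
    qed
    show "g + a - g \<in> A" if g: "g \<in> G" and a: "a \<in> A" for g a
    proof -
      obtain z where z: "z \<in> \<Omega>" "a = gconj (- h) z" using a by (auto simp: A_def)
      have "gconj g a = gconj (- h) (gconj (gconj h g) z)"
        by (simp add: z gconj_gconj) (simp add: gconj_def diff_conv_add_uminus add.assoc[symmetric] del: add_uminus_conv_diff)
      moreover have "gconj h g \<in> N" using h(2) g by blast
      ultimately show ?thesis using N\<Omega>[OF _ z(1)] by (simp add: A_def gconj_def)
    qed
    show "a = 0" if "g \<in> G" "g \<noteq> 0" "a \<in> A" "g + a - g = a" for g a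
    proof (rule fpf[OF that(1,2)])
      show "a \<in> K" using that(3) conjK[OF H'(4)[OF h(1)]] ZP P(2) by (auto simp: A_def \<Omega>_def)
      show "gconj g a = a" using that(4) by (simp add: gconj_def)
    qed
  qed (use p pG in auto)
qed

section \<open>Integral and complex Radon kernels\<close>

lemma cf_map_of_int: "cf (Poly_Mapping.map of_int c) x = of_int (cf c x)"
  for c :: "'g \<Rightarrow>\<^sub>0 int"
  by (simp add: Poly_Mapping.map.rep_eq when_def)

lemma map_of_int_mult:
  fixes a b :: "'g::group_add \<Rightarrow>\<^sub>0 int"
  assumes "a \<in> galg S" "finite S"
  shows "Poly_Mapping.map of_int (a * b) = Poly_Mapping.map of_int a * (Poly_Mapping.map of_int b :: 'g \<Rightarrow>\<^sub>0 'k::comm_ring_1)"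
proof -
  have "Poly_Mapping.map of_int a \<in> (galg S :: ('g \<Rightarrow>\<^sub>0 'k) set)" using assms(1) by (auto simp: galg_def cf_map_of_int) (metis of_int_0)
  then show ?thesis using assms
    by (intro poly_mapping_eqI) (simp add: cf_map_of_int cf_mult)
qed

lemma map_of_int_subgroup_sum:
  "finite C \<Longrightarrow> Poly_Mapping.map of_int (subgroup_sum C) = subgroup_sum C"
  by (intro poly_mapping_eqI) (simp add: cf_map_of_int cf_subgroup_sum)

text \<open>If the integral Radon kernel is zero, a nonzero integer is a combination of subgroup
  sums. This identity persists over the complex numbers, where it annihilates the Radon
  kernel.\<close>

lemma radon_kernel_complex_iff_int:
  assumes S: "fin_subgroup S"
  shows "(\<exists>h\<in>radon_kernel S. h \<noteq> (0 :: 'g::group_add \<Rightarrow>\<^sub>0 complex)) \<longleftrightarrow>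
     (\<exists>h\<in>radon_kernel S. h \<noteq> (0 :: 'g \<Rightarrow>\<^sub>0 int))"
proof
  assume "\<exists>h\<in>radon_kernel S. h \<noteq> (0 :: 'g \<Rightarrow>\<^sub>0 int)"
  then obtain h :: "'g \<Rightarrow>\<^sub>0 int" where h: "h \<in> radon_kernel S" "h \<noteq> 0" by blast
  have "Poly_Mapping.map of_int h \<in> (radon_kernel S :: ('g \<Rightarrow>\<^sub>0 complex) set)"
    unfolding radon_kernel_def
  proof (intro CollectI conjI ballI)
    show "Poly_Mapping.map of_int h \<in> (galg S :: ('g \<Rightarrow>\<^sub>0 complex) set)"
      using h(1) by (auto simp: radon_kernel_def galg_def cf_map_of_int)
    fix C assume C: "C \<in> nontrivial_subgroups S"
    note Cs = nontrivial_subgroupsD[OF C]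
    have "subgroup_sum C * Poly_Mapping.map of_int h
        = (Poly_Mapping.map of_int (subgroup_sum C * h) :: 'g \<Rightarrow>\<^sub>0 complex)"
      using map_of_int_mult[OF subgroup_sum_galg[OF order_refl], of C h, where ?'k = complex] fin_subgroupD(1)[OF Cs(1)]
      by (simp add: map_of_int_subgroup_sum)
    also have "subgroup_sum C * h = 0" using h(1) C by (simp add: radon_kernel_def)
    finally show "subgroup_sum C * Poly_Mapping.map of_int h = (0 :: 'g \<Rightarrow>\<^sub>0 complex)"
      by (simp add: poly_mapping_eqI cf_map_of_int)
  qed
  moreover have "Poly_Mapping.map of_int h \<noteq> (0 :: 'g \<Rightarrow>\<^sub>0 complex)"
  proof
    assume z: "Poly_Mapping.map of_int h = (0 :: 'g \<Rightarrow>\<^sub>0 complex)"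
    have "cf h x = 0" for x
      using arg_cong[where f = "\<lambda>u. cf u x", OF z] by (simp add: cf_map_of_int)
    then show False using nonzero_cf[OF h(2)] by simp
  qed
  ultimately show "\<exists>h\<in>radon_kernel S. h \<noteq> (0 :: 'g \<Rightarrow>\<^sub>0 complex)" by blast
next
  assume "\<exists>h\<in>radon_kernel S. h \<noteq> (0 :: 'g \<Rightarrow>\<^sub>0 complex)"
  then obtain h :: "'g \<Rightarrow>\<^sub>0 complex" where h: "h \<in> radon_kernel S" "h \<noteq> 0" by blast
  show "\<exists>h\<in>radon_kernel S. h \<noteq> (0 :: 'g \<Rightarrow>\<^sub>0 int)"
  proof (rule ccontr)
    assume "\<not> ?thesis"
    then obtain D :: int where D: "D \<noteq> 0" "sc D \<in> (subgroup_sum_ideal S :: ('g \<Rightarrow>\<^sub>0 int) set)"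
      using radon_kernel_or_scalar[OF S] by blast
    then obtain a :: "'g set \<Rightarrow> 'g \<Rightarrow>\<^sub>0 int"
      where a: "sc D = (\<Sum>C\<in>nontrivial_subgroups S. a C * subgroup_sum C)" "\<And>C. a C \<in> galg S"
      by (auto simp: subgroup_sum_ideal_def)
    let ?m = "Poly_Mapping.map of_int :: ('g \<Rightarrow>\<^sub>0 int) \<Rightarrow> ('g \<Rightarrow>\<^sub>0 complex)"
    have "sc (of_int D) = ?m (sc D)"
      by (intro poly_mapping_eqI) (simp add: cf_map_of_int lookup_single when_def)
    also have "\<dots> = (\<Sum>C\<in>nontrivial_subgroups S. ?m (a C * subgroup_sum C))"
      by (intro poly_mapping_eqI) (simp add: a(1) cf_map_of_int lookup_sum)
    also have "\<dots> = (\<Sum>C\<in>nontrivial_subgroups S. ?m (a C) * subgroup_sum C)"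
    proof (intro sum.cong refl)
      fix C assume "C \<in> nontrivial_subgroups S"
      from fin_subgroupD(1)[OF nontrivial_subgroupsD(1)[OF this]]
      show "?m (a C * subgroup_sum C) = ?m (a C) * subgroup_sum C"
        using map_of_int_mult[OF a(2) fin_subgroupD(1)[OF S], where ?'k = complex] by (simp add: map_of_int_subgroup_sum)
    qed
    finally have "sc (of_int D) * h = (\<Sum>C\<in>nontrivial_subgroups S. ?m (a C) * (subgroup_sum C * h))"
      by (simp only: sum_distrib_right mult.assoc)
    also have "\<dots> = 0" using h(1) by (intro sum.neutral ballI) (simp add: radon_kernel_def)
    finally show False using D(1) h(2) by (simp only: sc_mult_eq_0_iff) simp
  qed
qed

text \<open>A Frobenius complement \<open>G\<close> acts without fixed points on a nonzero
  elementary abelian group \<open>A\<close> of order prime to \<open>|G|\<close>. If the Radon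
  kernel of \<open>G\<close> were zero, an integer prime to \<open>p\<close> would be a combination
  of subgroup sums modulo \<open>p\<close>, and such an integer annihilates
  \<open>A\<close>.\<close>

theorem frobenius_radon_kernel:
  assumes H: "fin_subgroup H" and G: "fin_subgroup G" "G \<subseteq> H"
    and mal: "\<And>h g. h \<in> H \<Longrightarrow> h \<notin> G \<Longrightarrow> g \<in> G \<Longrightarrow> h + g - h \<in> G \<Longrightarrow> g = 0"
    and ntG: "G \<noteq> {0}" and proper: "G \<noteq> H"
  shows "\<exists>h\<in>radon_kernel G. h \<noteq> (0 :: 'g::group_add \<Rightarrow>\<^sub>0 complex)"
  unfolding radon_kernel_complex_iff_int[OF G(1)]
proof (rule ccontr)
  assume "\<not> (\<exists>h\<in>radon_kernel G. h \<noteq> (0 :: 'g \<Rightarrow>\<^sub>0 int))"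
  then obtain D :: int where D: "D \<noteq> 0" "sc D \<in> (subgroup_sum_ideal G :: ('g \<Rightarrow>\<^sub>0 int) set)"
    using radon_kernel_or_scalar[OF G(1)] by blast
  obtain p A where p: "Factorial_Ring.prime (p::nat)" "\<not> p dvd card G" and A: "fin_subgroup A" "A \<noteq> {0}"
    and comm: "\<And>a b. a \<in> A \<Longrightarrow> b \<in> A \<Longrightarrow> a + b = b + a" and tors: "\<And>a. a \<in> A \<Longrightarrow> a [^]\<^bsub>grp A\<^esub> p = 0"
    and norm: "\<And>g a. g \<in> G \<Longrightarrow> a \<in> A \<Longrightarrow> g + a - g \<in> A"
    and fpf: "\<And>g a. g \<in> G \<Longrightarrow> g \<noteq> 0 \<Longrightarrow> a \<in> A \<Longrightarrow> g + a - g = a \<Longrightarrow> a = 0"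
    by (rule frobenius_elementary_abelian_subgroup[OF H G _ ntG proper]) (use mal in blast)+
  have pi: "Factorial_Ring.prime (int p)" "\<not> int p dvd int (card G)" using p by auto
  obtain E j where E: "\<not> int p dvd E" "j \<in> subgroup_sum_ideal G" "cdvd (int p) (sc E - j)"
    using scalar_mod_prime[OF G(1) pi D] by blast
  have "A = {0}"
    by (rule fixed_point_free_module_trivial[OF G(1) A(1) comm norm fpf pi(1) _ E])
      (simp_all add: int_pow_int tors)
  then show False using A(2) by simp
qed

section \<open>Transport between abstract groups and subgroups of a universal type\<close>

text \<open>Every finite group embeds into the permutations of the natural numbers. Written
  additively, these form one type of class \<open>group_add\<close>, over which the convolution
  rings of the preceding sections are available for groups with carriers in an arbitrary
  type.\<close>

typedef nat_perm = "{f :: nat \<Rightarrow> nat. bij f}"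
  morphisms perm_fun Abs_nat_perm
  by (rule exI[of _ id]) simp

lemma bij_perm_fun: "bij (perm_fun p)"
  using perm_fun[of p] by simp

instantiation nat_perm :: group_add
begin

definition "0 = Abs_nat_perm id"
definition "p + q = Abs_nat_perm (perm_fun p \<circ> perm_fun q)"
definition "- p = Abs_nat_perm (inv_into UNIV (perm_fun p))"
definition "p - q = p + - (q :: nat_perm)"

lemma perm_fun_zero: "perm_fun 0 = id"
  by (simp add: zero_nat_perm_def Abs_nat_perm_inverse)

lemma perm_fun_add: "perm_fun (p + q) = perm_fun p \<circ> perm_fun q"
  by (simp add: plus_nat_perm_def Abs_nat_perm_inverse bij_comp bij_perm_fun)

lemma perm_fun_minus: "perm_fun (- p) = inv_into UNIV (perm_fun p)"
  by (simp add: uminus_nat_perm_def Abs_nat_perm_inverse bij_imp_bij_inv bij_perm_fun)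

instance
proof
  fix a b c :: nat_perm
  show "a + b + c = a + (b + c)"
    by (simp add: perm_fun_inject[symmetric] perm_fun_add comp_assoc)
  show "0 + a = a" "a + 0 = a" by (simp_all add: perm_fun_inject[symmetric] perm_fun_add perm_fun_zero)
  show "- a + a = 0"
    using bij_perm_fun[of a]
    by (simp add: perm_fun_inject[symmetric] perm_fun_add perm_fun_zero perm_fun_minus bij_is_inj)
  show "a + - b = a - b" by (simp add: minus_nat_perm_def)
qed

end

locale group_embedding = group G for G (structure) +
  fixes \<iota> :: "'a \<Rightarrow> 'g::group_add"
  assumes finite_carrier: "finite (carrier G)"
    and inj_emb: "inj_on \<iota> (carrier G)"
    and emb_mult: "\<And>x y. x \<in> carrier G \<Longrightarrow> y \<in> carrier G \<Longrightarrow> \<iota> (x \<otimes> y) = \<iota> x + \<iota> y"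

text \<open>Cayley's theorem: number the elements of the group and let it act on the numbers by
  left multiplication.\<close>

lemma group_embedding_exists:
  assumes "group G" and fin: "finite (carrier G)"
  obtains \<iota> :: "'a \<Rightarrow> nat_perm" where "group_embedding G \<iota>"
proof -
  interpret group G by fact
  obtain \<beta> n where \<beta>: "bij_betw \<beta> (carrier G) {0..<n::nat}"
    using ex_bij_betw_finite_nat[OF fin] by blast
  define \<gamma> where "\<gamma> = inv_into (carrier G) \<beta>"
  have \<gamma>\<beta>: "\<gamma> (\<beta> x) = x" if "x \<in> carrier G" for x
    using that \<beta> by (simp add: \<gamma>_def bij_betw_inv_into_left)
  have \<beta>\<gamma>: "\<beta> (\<gamma> k) = k" if "k < n" for k
    using that \<beta> by (simp add: \<gamma>_def bij_betw_inv_into_right)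
  have \<gamma>: "\<gamma> k \<in> carrier G" if "k < n" for k
    using that bij_betw_inv_into[OF \<beta>] by (auto simp: \<gamma>_def bij_betw_def)
  have \<beta>n: "\<beta> x < n" if "x \<in> carrier G" for x using that \<beta> by (auto simp: bij_betw_def)
  define L where "L x k = (if k < n then \<beta> (x \<otimes>\<^bsub>G\<^esub> \<gamma> k) else k)" for x k
  have L_mult: "L (x \<otimes>\<^bsub>G\<^esub> y) k = L x (L y k)" if "x \<in> carrier G" "y \<in> carrier G" for x y k
    using that \<gamma> \<beta>n by (simp add: L_def \<gamma>\<beta> m_assoc)
  have L_one: "L \<one>\<^bsub>G\<^esub> k = k" for k using \<gamma> \<beta>\<gamma> by (simp add: L_def)
  have bij: "bij (L x)" if x: "x \<in> carrier G" for x
    by (rule bij_betw_byWitness[where f' = "L (inv\<^bsub>G\<^esub> x)"])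
      (use L_mult[of x "inv\<^bsub>G\<^esub> x"] L_mult[of "inv\<^bsub>G\<^esub> x" x] x L_one in auto)
  define \<iota> where "\<iota> x = Abs_nat_perm (L x)" for x
  have \<iota>: "perm_fun (\<iota> x) = L x" if "x \<in> carrier G" for x
    using bij[OF that] by (simp add: \<iota>_def Abs_nat_perm_inverse)
  have "group_embedding G \<iota>"
  proof
    show "inj_on \<iota> (carrier G)"
    proof (rule inj_onI)
      fix x y assume xy: "x \<in> carrier G" "y \<in> carrier G" "\<iota> x = \<iota> y"
      have "L x (\<beta> \<one>\<^bsub>G\<^esub>) = L y (\<beta> \<one>\<^bsub>G\<^esub>)" using \<iota>[OF xy(1)] \<iota>[OF xy(2)] xy(3) by simp
      then have "\<beta> x = \<beta> y" using \<beta>n[OF one_closed] xy(1,2) by (simp add: L_def \<gamma>\<beta>)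
      then show "x = y" using \<gamma>\<beta> xy(1,2) by metis
    qed
    show "\<iota> (x \<otimes>\<^bsub>G\<^esub> y) = \<iota> x + \<iota> y" if "x \<in> carrier G" "y \<in> carrier G" for x y
      using that by (auto simp: perm_fun_inject[symmetric] perm_fun_add \<iota> L_mult)
  qed (rule fin)
  then show ?thesis using that by blast
qed

context group_embedding
begin

abbreviation S where "S \<equiv> \<iota> ` carrier G"

lemma emb_one: "\<iota> \<one> = 0"
  using emb_mult[of \<one> \<one>] add_left_imp_eq[of "\<iota> \<one>" "\<iota> \<one>" 0] by simp

lemma emb_inv: "x \<in> carrier G \<Longrightarrow> \<iota> (inv x) = - \<iota> x"
  using emb_mult[of "inv x" x] emb_one by (simp add: eq_neg_iff_add_eq_0)

lemma emb_eq_iff: "x \<in> carrier G \<Longrightarrow> y \<in> carrier G \<Longrightarrow> \<iota> x = \<iota> y \<longleftrightarrow> x = y"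
  using inj_emb by (auto simp: inj_on_eq_iff)

lemma emb_eq_0_iff: "x \<in> carrier G \<Longrightarrow> \<iota> x = 0 \<longleftrightarrow> x = \<one>"
  using emb_eq_iff[of x \<one>] emb_one by simp

lemma fin_subgroup_emb:
  assumes "subgroup C G" shows "fin_subgroup (\<iota> ` C)"
  unfolding fin_subgroup_def
proof (intro conjI ballI)
  note C = subgroup.subset[OF assms] subgroup.m_closed[OF assms] subgroup.one_closed[OF assms]
    subgroup.m_inv_closed[OF assms]
  show "finite (\<iota> ` C)" using C(1) finite_carrier by (auto intro: finite_subset)
  show "0 \<in> \<iota> ` C" using C(3) emb_one by (metis image_eqI)
  fix x assume "x \<in> \<iota> ` C"
  then obtain a where a: "a \<in> C" "x = \<iota> a" by blast
  show "- x \<in> \<iota> ` C"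
    using a C(1) C(4)[OF a(1)] emb_inv[of a] by (intro image_eqI[of _ _ "inv a"]) auto
  fix y assume "y \<in> \<iota> ` C"
  then obtain b where b: "b \<in> C" "y = \<iota> b" by blast
  show "x + y \<in> \<iota> ` C"
    using a b C(2)[OF a(1) b(1)] emb_mult[OF subsetD[OF C(1) a(1)] subsetD[OF C(1) b(1)]]
    by (intro image_eqI[of _ _ "a \<otimes> b"]) auto
qed

lemma fin_subgroup_S: "fin_subgroup S"
  by (rule fin_subgroup_emb[OF subgroup_self])

lemma nontrivial_subgroups_S_iff:
  "C' \<in> nontrivial_subgroups S \<longleftrightarrow> (\<exists>C. subgroup C G \<and> C \<noteq> {\<one>} \<and> C' = \<iota> ` C)"
proof
  assume C': "C' \<in> nontrivial_subgroups S"
  note Cs = fin_subgroupD[OF nontrivial_subgroupsD(1)[OF C']] nontrivial_subgroupsD[OF C']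
  define C where "C = {x \<in> carrier G. \<iota> x \<in> C'}"
  have im: "C' = \<iota> ` C" using Cs(7) by (auto simp: C_def)
  have "subgroup C G"
    by (rule subgroupI) (use Cs in \<open>auto simp: C_def emb_mult emb_inv emb_one intro: exI[of _ \<one>]\<close>)
  moreover have "C \<noteq> {\<one>}" using im Cs(8) emb_one by auto
  ultimately show "\<exists>C. subgroup C G \<and> C \<noteq> {\<one>} \<and> C' = \<iota> ` C" using im by blast
next
  assume "\<exists>C. subgroup C G \<and> C \<noteq> {\<one>} \<and> C' = \<iota> ` C"
  then obtain C where C: "subgroup C G" "C \<noteq> {\<one>}" "C' = \<iota> ` C" by blast
  have "\<iota> ` C \<noteq> {0}"
  proof
    assume z: "\<iota> ` C = {0}"
    have "x = \<one>" if "x \<in> C" for x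
      using that z subgroup.subset[OF C(1)] emb_eq_0_iff by blast
    then show False using C(2) subgroup.one_closed[OF C(1)] by blast
  qed
  then show "C' \<in> nontrivial_subgroups S"
    using fin_subgroup_emb[OF C(1)] C(3) subgroup.subset[OF C(1)] by (auto simp: nontrivial_subgroups_def)
qed

text \<open>Left multiplication by a subgroup sum adds up the values of \<open>h\<close> on right
  cosets \<open>C + y\<close>; inverting the argument turns them into the left cosets \<open>x
  C\<close> of the Radon transform.\<close>

lemma radon_kernel_S_iff:
  assumes h: "h \<in> galg S"
  shows "h \<in> radon_kernel S \<longleftrightarrow>
    (\<forall>C. subgroup C G \<and> C \<noteq> {\<one>} \<longrightarrow> (\<forall>x\<in>carrier G. (\<Sum>t\<in>C. cf h (\<iota> (inv (x \<otimes> t)))) = 0))"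
proof -
  have sums: "subgroup_sum (\<iota> ` C) * h = 0 \<longleftrightarrow> (\<forall>x\<in>carrier G. (\<Sum>t\<in>C. cf h (\<iota> (inv (x \<otimes> t)))) = 0)"
    if C: "subgroup C G" for C
  proof -
    note CG = subgroup.subset[OF C]
    have eq: "cf (subgroup_sum (\<iota> ` C) * h) (\<iota> (inv x)) = (\<Sum>t\<in>C. cf h (\<iota> (inv (x \<otimes> t))))"
      if x: "x \<in> carrier G" for x
    proof -
      have "cf (subgroup_sum (\<iota> ` C) * h) (\<iota> (inv x)) = (\<Sum>t\<in>C. cf h (- \<iota> t + \<iota> (inv x)))"
        using CG inj_emb by (simp add: cf_subgroup_sum_mult sum.reindex inj_on_subset)
      also have "\<dots> = (\<Sum>t\<in>C. cf h (\<iota> (inv (x \<otimes> t))))"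
        by (intro sum.cong refl) (use x CG in \<open>auto simp: inv_mult_group emb_mult emb_inv\<close>)
      finally show ?thesis .
    qed
    have gal: "subgroup_sum (\<iota> ` C) * h \<in> galg S"
      by (intro galg_mult fin_subgroup_S subgroup_sum_galg h) (use CG in auto)
    show ?thesis
    proof
      assume "subgroup_sum (\<iota> ` C) * h = 0"
      then show "\<forall>x\<in>carrier G. (\<Sum>t\<in>C. cf h (\<iota> (inv (x \<otimes> t)))) = 0" using eq by simp
    next
      assume z: "\<forall>x\<in>carrier G. (\<Sum>t\<in>C. cf h (\<iota> (inv (x \<otimes> t)))) = 0"
      have "cf (subgroup_sum (\<iota> ` C) * h) y = 0" for y
      proof (cases "y \<in> S")
        case True
        then obtain x where x: "x \<in> carrier G" "y = \<iota> x" by blast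
        then show ?thesis using eq[of "inv x"] z by simp
      qed (use galgD[OF gal] in auto)
      then show "subgroup_sum (\<iota> ` C) * h = 0" by (intro poly_mapping_eqI) simp
    qed
  qed
  have ker: "h \<in> radon_kernel S \<longleftrightarrow> (\<forall>C'\<in>nontrivial_subgroups S. subgroup_sum C' * h = 0)"
    by (simp add: radon_kernel_def h)
  show ?thesis
  proof
    assume L: "h \<in> radon_kernel S"
    show "\<forall>C. subgroup C G \<and> C \<noteq> {\<one>} \<longrightarrow> (\<forall>x\<in>carrier G. (\<Sum>t\<in>C. cf h (\<iota> (inv (x \<otimes> t)))) = 0)"
    proof (intro allI impI)
      fix C assume C: "subgroup C G \<and> C \<noteq> {\<one>}"
      then have "\<iota> ` C \<in> nontrivial_subgroups S" unfolding nontrivial_subgroups_S_iff by (intro exI[of _ C]) simp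
      then have "subgroup_sum (\<iota> ` C) * h = 0" using L ker by simp
      then show "\<forall>x\<in>carrier G. (\<Sum>t\<in>C. cf h (\<iota> (inv (x \<otimes> t)))) = 0" using sums[of C] C by simp
    qed
  next
    assume R: "\<forall>C. subgroup C G \<and> C \<noteq> {\<one>} \<longrightarrow> (\<forall>x\<in>carrier G. (\<Sum>t\<in>C. cf h (\<iota> (inv (x \<otimes> t)))) = 0)"
    show "h \<in> radon_kernel S" unfolding ker
    proof
      fix C' assume "C' \<in> nontrivial_subgroups S"
      then obtain C where C: "subgroup C G" "C \<noteq> {\<one>}" "C' = \<iota> ` C" unfolding nontrivial_subgroups_S_iff by (elim exE conjE)
      then show "subgroup_sum C' * h = 0" using sums[OF C(1)] R by simp
    qed
  qed
qed

lemma galg_of_function: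
  obtains h :: "'g \<Rightarrow>\<^sub>0 complex" where "h \<in> galg S" "\<And>x. x \<in> carrier G \<Longrightarrow> cf h (\<iota> (inv x)) = f x"
proof
  let ?h = "\<Sum>y\<in>carrier G. sg (\<iota> (inv y)) (f y)"
  show "?h \<in> galg S" by (intro galg_sum galg_sg) auto
  fix x assume x: "x \<in> carrier G"
  have "cf ?h (\<iota> (inv x)) = (\<Sum>y\<in>carrier G. if y = x then f x else 0)"
    unfolding lookup_sum
  proof (intro sum.cong refl)
    fix y assume "y \<in> carrier G"
    then have "\<iota> (inv y) = \<iota> (inv x) \<longleftrightarrow> y = x" using x by (metis emb_eq_iff inv_closed inv_inv)
    then show "cf (sg (\<iota> (inv y)) (f y)) (\<iota> (inv x)) = (if y = x then f x else 0)"
      by (simp add: lookup_single when_def)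
  qed
  then show "cf ?h (\<iota> (inv x)) = f x" using x finite_carrier by simp
qed

end

section \<open>The Radon transform in terms of subgroups\<close>

context group
begin

lemma GammaD:
  assumes "\<gamma> \<in> Gamma G n"
  shows "group_hom (integer_mod_group n) G \<gamma>" "\<exists>t\<in>carrier (integer_mod_group n). \<gamma> t \<noteq> \<one>"
  using assms by (auto simp: Gamma_def group_hom_def group_hom_axioms_def is_group)

lemma power_in_Gamma:
  assumes x: "x \<in> carrier G" "x \<noteq> \<one>" "x [^] n = \<one>" and n: "0 < n"
  shows "(\<lambda>t::int. x [^] t) \<in> Gamma G n" "2 \<le> n"
proof -
  have d: "int (ord x) dvd int n" using pow_eq_id[OF x(1)] x(3) by simp
  show n2: "2 \<le> n"
  proof (rule ccontr)
    assume "\<not> 2 \<le> n"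
    then have "n = 1" using n by simp
    then show False using x by simp
  qed
  have "(\<lambda>t::int. x [^] t) \<in> hom (integer_mod_group n) G"
  proof (rule homI)
    fix s t :: int
    have "x [^] ((s + t) mod int n) = x [^] (s + t)"
      by (subst int_pow_eq[OF x(1)]) (metis d dvd_minus_mod dvd_trans)
    then show "x [^] (s \<otimes>\<^bsub>integer_mod_group n\<^esub> t) = x [^] s \<otimes> x [^] t"
      using x(1) by (simp add: int_pow_mult)
  qed (use x in auto)
  moreover have "1 \<in> carrier (integer_mod_group n)" using n2 by (simp add: carrier_integer_mod_group)
  moreover have "x [^] (1::int) \<noteq> \<one>" using x by simp
  ultimately show "(\<lambda>t::int. x [^] t) \<in> Gamma G n" unfolding Gamma_def by blast
qed

text \<open>Each \<open>\<gamma> t\<close> permutes \<open>C\<close> by right multiplication. So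
  the sum over the coset \<open>y C\<close>, repeated for every \<open>t\<close>, regroups into sums
  over \<open>t\<close> that vanish by assumption.\<close>

lemma subgroup_sum_zero_of_Gamma:
  fixes F :: "'a \<Rightarrow> complex"
  assumes C: "subgroup C G" "finite C" and n: "0 < n" and \<gamma>: "\<And>t. t \<in> carrier (integer_mod_group n) \<Longrightarrow> \<gamma> t \<in> C"
    and zero: "\<And>x. x \<in> carrier G \<Longrightarrow> (\<Sum>t\<in>carrier (integer_mod_group n). F (x \<otimes> \<gamma> t)) = 0"
    and y: "y \<in> carrier G"
  shows "(\<Sum>c\<in>C. F (y \<otimes> c)) = 0"
proof -
  let ?Z = "carrier (integer_mod_group n)"
  note CG = subgroup.subset[OF C(1)]
  have "of_nat (card ?Z) * (\<Sum>c\<in>C. F (y \<otimes> c)) = (\<Sum>t\<in>?Z. \<Sum>c\<in>C. F (y \<otimes> c \<otimes> \<gamma> t))"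
  proof -
    have "(\<Sum>c\<in>C. F (y \<otimes> c \<otimes> \<gamma> t)) = (\<Sum>c\<in>C. F (y \<otimes> c))" if t: "t \<in> ?Z" for t
    proof -
      have g: "\<gamma> t \<in> C" using \<gamma>[OF t] .
      have "bij_betw (\<lambda>c. c \<otimes> \<gamma> t) C C"
        by (rule bij_betw_byWitness[where f' = "\<lambda>c. c \<otimes> inv (\<gamma> t)"])
          (use g CG in \<open>auto simp: m_assoc subsetD intro!: subgroup.m_closed[OF C(1)] subgroup.m_inv_closed[OF C(1)]\<close>)
      from sum.reindex_bij_betw[OF this, of "\<lambda>c. F (y \<otimes> c)"]
      have "(\<Sum>c\<in>C. F (y \<otimes> (c \<otimes> \<gamma> t))) = (\<Sum>c\<in>C. F (y \<otimes> c))" .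
      moreover have "(\<Sum>c\<in>C. F (y \<otimes> c \<otimes> \<gamma> t)) = (\<Sum>c\<in>C. F (y \<otimes> (c \<otimes> \<gamma> t)))"
        by (intro sum.cong refl) (use y g CG in \<open>auto simp: m_assoc subsetD\<close>)
      ultimately show ?thesis by simp
    qed
    then show ?thesis by simp
  qed
  also have "\<dots> = (\<Sum>c\<in>C. \<Sum>t\<in>?Z. F (y \<otimes> c \<otimes> \<gamma> t))" by (rule sum.swap)
  also have "\<dots> = 0"
  proof (rule sum.neutral, intro ballI)
    fix c assume "c \<in> C"
    then show "(\<Sum>t\<in>?Z. F (y \<otimes> c \<otimes> \<gamma> t)) = 0" using y CG by (intro zero) auto
  qed
  finally have "of_nat (card ?Z) * (\<Sum>c\<in>C. F (y \<otimes> c)) = 0" .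
  moreover have "card ?Z \<noteq> 0" using n by (simp add: carrier_integer_mod_group)
  ultimately show ?thesis by simp
qed

text \<open>Take for \<open>C\<close> the image of \<open>\<gamma>\<close>: the value of the Radon
  transform, repeated for every \<open>c \<in> C\<close>, regroups into sums over cosets of
  \<open>C\<close>.\<close>

lemma radon_zero_of_subgroup_sums:
  assumes fin: "finite (carrier G)" and n: "0 < n" and \<gamma>: "\<gamma> \<in> Gamma G n" and x: "x \<in> carrier G"
    and zero: "\<And>C x. subgroup C G \<Longrightarrow> C \<noteq> {\<one>} \<Longrightarrow> x \<in> carrier G \<Longrightarrow> (\<Sum>t\<in>C. f (x \<otimes> t)) = 0"
  shows "radon G n f x \<gamma> = 0"
proof -
  let ?Z = "carrier (integer_mod_group n)"
  interpret h: group_hom "integer_mod_group n" G \<gamma> by (rule GammaD(1)[OF \<gamma>])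
  define C where "C = \<gamma> ` ?Z"
  have C: "subgroup C G" unfolding C_def by (rule h.img_is_subgroup)
  note CG = subgroup.subset[OF C]
  have finC: "finite C" using CG fin by (rule finite_subset)
  have "C \<noteq> {\<one>}" using GammaD(2)[OF \<gamma>] by (auto simp: C_def)
  have "of_nat (card C) * radon G n f x \<gamma> = (\<Sum>c\<in>C. \<Sum>t\<in>?Z. f (x \<otimes> \<gamma> t \<otimes> c))"
  proof -
    have "(\<Sum>t\<in>?Z. f (x \<otimes> \<gamma> t \<otimes> c)) = radon G n f x \<gamma>" if "c \<in> C" for c
    proof -
      obtain s where s: "s \<in> ?Z" "c = \<gamma> s" using \<open>c \<in> C\<close> by (auto simp: C_def)
      have "bij_betw (\<lambda>t. t \<otimes>\<^bsub>integer_mod_group n\<^esub> s) ?Z ?Z"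
        by (rule bij_betw_byWitness[where f' = "\<lambda>t. t \<otimes>\<^bsub>integer_mod_group n\<^esub> inv\<^bsub>integer_mod_group n\<^esub> s"])
          (use s h.G.m_assoc h.G.m_closed h.G.inv_closed in \<open>auto simp del: mult_integer_mod_group inv_integer_mod_group\<close>)
      from sum.reindex_bij_betw[OF this, of "\<lambda>t. f (x \<otimes> \<gamma> t)"]
      have "radon G n f x \<gamma> = (\<Sum>t\<in>?Z. f (x \<otimes> \<gamma> (t \<otimes>\<^bsub>integer_mod_group n\<^esub> s)))"
        by (simp add: radon_def)
      also have "\<dots> = (\<Sum>t\<in>?Z. f (x \<otimes> \<gamma> t \<otimes> c))"
        by (intro sum.cong refl) (use s x h.hom_mult in \<open>simp add: m_assoc del: mult_integer_mod_group\<close>)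
      finally show ?thesis by simp
    qed
    then show ?thesis by simp
  qed
  also have "\<dots> = (\<Sum>t\<in>?Z. \<Sum>c\<in>C. f (x \<otimes> \<gamma> t \<otimes> c))" by (rule sum.swap)
  also have "\<dots> = 0"
  proof (rule sum.neutral, intro ballI)
    fix t assume "t \<in> ?Z"
    then show "(\<Sum>c\<in>C. f (x \<otimes> \<gamma> t \<otimes> c)) = 0" using x by (intro zero C \<open>C \<noteq> {\<one>}\<close>) auto
  qed
  finally have "of_nat (card C) * radon G n f x \<gamma> = 0" .
  moreover have "card C \<noteq> 0" using subgroup.one_closed[OF C] finC by auto
  ultimately show ?thesis by simp
qed

text \<open>A nontrivial subgroup contains a nontrivial cyclic one, and the Radon transform
  provides the sums over the cosets of the latter.\<close>

lemma subgroup_sums_zero_of_radon: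
  assumes fin: "finite (carrier G)"
    and zero: "\<And>n x \<gamma>. 2 \<le> n \<Longrightarrow> x \<in> carrier G \<Longrightarrow> \<gamma> \<in> Gamma G n \<Longrightarrow> radon G n f x \<gamma> = 0"
    and C: "subgroup C G" "C \<noteq> {\<one>}" and x: "x \<in> carrier G"
  shows "(\<Sum>t\<in>C. f (x \<otimes> t)) = 0"
proof -
  obtain c where c: "c \<in> C" "c \<noteq> \<one>" using C subgroup.one_closed[OF C(1)] by blast
  have cG: "c \<in> carrier G" using subgroup.subset[OF C(1)] c by blast
  have finC: "finite C" using subgroup.subset[OF C(1)] fin by (rule finite_subset)
  have n: "0 < ord c" using ord_ge_1[OF fin cG] by simp
  note \<gamma> = power_in_Gamma[OF cG c(2) pow_ord_eq_1[OF cG] n]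
  show ?thesis
  proof (rule subgroup_sum_zero_of_Gamma[OF C(1) finC n])
    show "c [^] (t::int) \<in> C" for t by (rule subgroup_int_pow_closed[OF C(1) c(1)])
    show "(\<Sum>t\<in>carrier (integer_mod_group (ord c)). f (y \<otimes> c [^] t)) = 0" if "y \<in> carrier G" for y
      using zero[OF \<gamma>(2) that \<gamma>(1)] by (simp add: radon_def)
  qed (rule x)
qed

end

theorem (in group_embedding) radon_injective_iff:
  "radon_injective G \<longleftrightarrow> (\<forall>h\<in>radon_kernel S. h = (0 :: 'g \<Rightarrow>\<^sub>0 complex))"
proof
  assume inj: "radon_injective G"
  show "\<forall>h\<in>radon_kernel S. h = (0 :: 'g \<Rightarrow>\<^sub>0 complex)"
  proof
    fix h :: "'g \<Rightarrow>\<^sub>0 complex" assume h: "h \<in> radon_kernel S"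
    then have hS: "h \<in> galg S" by (simp add: radon_kernel_def)
    define f where "f x = cf h (\<iota> (inv x))" for x
    have "radon G n f x \<gamma> = 0" if "2 \<le> n" "x \<in> carrier G" "\<gamma> \<in> Gamma G n" for n x \<gamma>
      by (rule radon_zero_of_subgroup_sums[OF finite_carrier _ that(3,2)])
        (use that h in \<open>auto simp: radon_kernel_S_iff[OF hS] f_def\<close>)
    then have z: "f x = 0" if "x \<in> carrier G" for x using inj that unfolding radon_injective_def by blast
    show "h = 0"
    proof (rule poly_mapping_eqI)
      fix y
      show "cf h y = cf 0 y"
      proof (cases "y \<in> S")
        case True
        then obtain x where "x \<in> carrier G" "y = \<iota> x" by blast
        then show ?thesis using z[of "inv x"] by (simp add: f_def)
      qed (use galgD[OF hS] in auto)
    qed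
  qed
next
  assume ker: "\<forall>h\<in>radon_kernel S. h = (0 :: 'g \<Rightarrow>\<^sub>0 complex)"
  show "radon_injective G" unfolding radon_injective_def
  proof (intro allI impI ballI)
    fix f x assume z: "\<forall>n\<ge>2. \<forall>x\<in>carrier G. \<forall>\<gamma>\<in>Gamma G n. radon G n f x \<gamma> = 0" and x: "x \<in> carrier G"
    obtain h :: "'g \<Rightarrow>\<^sub>0 complex" where h: "h \<in> galg S" "\<And>x. x \<in> carrier G \<Longrightarrow> cf h (\<iota> (inv x)) = f x"
      using galg_of_function[where f = f] by blast
    have "h \<in> radon_kernel S" unfolding radon_kernel_S_iff[OF h(1)]
    proof (intro allI impI ballI)
      fix C x assume C: "subgroup C G \<and> C \<noteq> {\<one>}" and x: "x \<in> carrier G"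
      have "(\<Sum>t\<in>C. cf h (\<iota> (inv (x \<otimes> t)))) = (\<Sum>t\<in>C. f (x \<otimes> t))"
        by (intro sum.cong refl h(2)) (use C x subgroup.subset in blast)
      also have "\<dots> = 0" by (rule subgroup_sums_zero_of_radon[OF finite_carrier]) (use z C x in auto)
      finally show "(\<Sum>t\<in>C. cf h (\<iota> (inv (x \<otimes> t)))) = 0" .
    qed
    then show "f x = 0" using ker h(2)[OF x] by auto
  qed
qed

text \<open>A point stabilizer \<open>T\<close> of a Frobenius group is malnormal: if
  \<open>g\<close> and its conjugate by \<open>h\<close> both fix \<open>x\<close>, then
  \<open>g\<close> fixes \<open>x\<close> and \<open>h\<^sup>-\<^sup>1 x\<close>, and these are
  different points if \<open>h\<close> is not in \<open>T\<close>. It is a proper subgroup, as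
  otherwise transitivity would leave a single point and \<open>T\<close> would be trivial.\<close>

theorem frobenius_complement_not_radon_injective:
  assumes G: "group G" and fin: "finite (carrier G)" and nt: "carrier G \<noteq> {\<one>\<^bsub>G\<^esub>}" and F: "frobenius_complement G"
  shows "\<not> radon_injective G"
proof -
  obtain X :: "nat set" and H x where XH: "frobenius_perm_group X H" and x: "x \<in> X"
    and iso: "G \<cong> (BijGroup X)\<lparr>carrier := stabilizer ((BijGroup X)\<lparr>carrier := H\<rparr>) (\<lambda>h. h) x\<rparr>"
    using F unfolding frobenius_complement_def by blast
  define B where "B = (BijGroup X)\<lparr>carrier := H\<rparr>"
  define T where "T = stabilizer B (\<lambda>h. h) x"
  have T: "T = {h \<in> H. h x = x}" by (simp add: T_def stabilizer_def B_def)
  have finX: "finite X" and sub: "subgroup H (BijGroup X)" and trans: "transitive_action B X (\<lambda>h. h)"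
    and fp: "\<And>h y z. h \<in> H \<Longrightarrow> h \<noteq> \<one>\<^bsub>BijGroup X\<^esub> \<Longrightarrow> y \<in> X \<Longrightarrow> z \<in> X \<Longrightarrow> h y = y \<Longrightarrow> h z = z \<Longrightarrow> y = z"
    using XH unfolding frobenius_perm_group_def B_def by blast+
  interpret B: group B unfolding B_def by (rule group.subgroup_imp_group[OF group_BijGroup sub])
  have carB [simp]: "carrier B = H" by (simp add: B_def)
  have HB: "H \<subseteq> Bij X" using subgroup.subset[OF sub] by (simp add: BijGroup_def)
  have multB: "(a \<otimes>\<^bsub>B\<^esub> b) y = a (b y)" if "a \<in> H" "b \<in> H" "y \<in> X" for a b y
    using that HB by (simp add: B_def BijGroup_def subsetD compose_eq)
  have oneB: "\<one>\<^bsub>B\<^esub> y = y" if "y \<in> X" for y using that by (simp add: B_def BijGroup_def)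
  have mapX: "a y \<in> X" if "a \<in> H" "y \<in> X" for a y using that HB Bij_imp_funcset by blast
  have "finite (Bij X)"
    by (rule finite_subset[OF _ finite_PiE[OF finX, of "\<lambda>_. X"]])
      (use finX Bij_imp_funcset Bij_imp_extensional in \<open>auto simp: PiE_def\<close>)
  then have finH: "finite H" using HB finite_subset by blast
  obtain \<iota> :: "(nat \<Rightarrow> nat) \<Rightarrow> nat_perm" where emb: "group_embedding B \<iota>"
    using group_embedding_exists[OF B.is_group] finH by auto
  interpret E: group_embedding B \<iota> by (rule emb)
  have act: "group_action B X (\<lambda>h. h)" using trans by (simp add: transitive_action_def)
  have Tsub: "subgroup T B" unfolding T_def by (rule group_action.stabilizer_subgroup[OF act x])
  obtain \<theta> where \<theta>: "\<theta> \<in> iso G (B\<lparr>carrier := T\<rparr>)" using iso by (auto simp: is_iso_def T_def B_def)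
  have \<theta>_bij: "bij_betw \<theta> (carrier G) T" and \<theta>_hom: "\<theta> \<in> hom G (B\<lparr>carrier := T\<rparr>)"
    using \<theta> by (auto simp: iso_def)
  have TH: "T \<subseteq> H" by (auto simp: T)
  have \<theta>H: "\<theta> a \<in> H" if "a \<in> carrier G" for a using \<theta>_bij TH that by (auto simp: bij_betw_def)
  interpret emb: group_embedding G "\<iota> \<circ> \<theta>"
  proof (intro group_embedding.intro group_embedding_axioms.intro G fin)
    show "inj_on (\<iota> \<circ> \<theta>) (carrier G)"
    proof (rule comp_inj_on)
      show "inj_on \<theta> (carrier G)" using \<theta>_bij by (simp add: bij_betw_def)
      show "inj_on \<iota> (\<theta> ` carrier G)" using \<theta>_bij TH by (intro inj_on_subset[OF E.inj_emb]) (simp add: bij_betw_def)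
    qed
    show "(\<iota> \<circ> \<theta>) (a \<otimes>\<^bsub>G\<^esub> b) = (\<iota> \<circ> \<theta>) a + (\<iota> \<circ> \<theta>) b" if "a \<in> carrier G" "b \<in> carrier G" for a b
      using hom_mult[OF \<theta>_hom that] \<theta>H that by (simp add: E.emb_mult)
  qed
  have im: "(\<iota> \<circ> \<theta>) ` carrier G = \<iota> ` T" using \<theta>_bij unfolding bij_betw_def by (metis image_comp)
  have ntT: "\<iota> ` T \<noteq> {0}"
  proof
    assume z: "\<iota> ` T = {0}"
    have "a = \<one>\<^bsub>G\<^esub>" if "a \<in> carrier G" for a
      using that z im emb.emb_eq_0_iff by blast
    then show False using nt group.is_monoid[OF G] monoid.one_closed by blast
  qed
  have mal: "g = 0" if h: "h \<in> \<iota> ` H" "h \<notin> \<iota> ` T" and g: "g \<in> \<iota> ` T" "h + g - h \<in> \<iota> ` T" for h g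
  proof -
    obtain a b where a: "a \<in> H" "h = \<iota> a" and b: "b \<in> T" "g = \<iota> b" using h g by blast
    have bH: "b \<in> H" using b TH by blast
    have aT: "a \<notin> T" using h(2) a by blast
    have ia: "inv\<^bsub>B\<^esub> a \<in> H" using B.inv_closed[of a] a(1) by simp
    have "h + g - h = \<iota> (a \<otimes>\<^bsub>B\<^esub> b \<otimes>\<^bsub>B\<^esub> inv\<^bsub>B\<^esub> a)"
      using a b bH ia by (simp add: E.emb_mult E.emb_inv B.m_closed[simplified])
    moreover obtain u where u: "u \<in> T" "h + g - h = \<iota> u" using g(2) by blast
    moreover have "a \<otimes>\<^bsub>B\<^esub> b \<otimes>\<^bsub>B\<^esub> inv\<^bsub>B\<^esub> a \<in> carrier B"
      using a(1) bH ia by (intro B.m_closed) simp_all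
    moreover have "u \<in> carrier B" using u(1) TH by auto
    ultimately have "a \<otimes>\<^bsub>B\<^esub> b \<otimes>\<^bsub>B\<^esub> inv\<^bsub>B\<^esub> a \<in> T"
      using E.emb_eq_iff[of "a \<otimes>\<^bsub>B\<^esub> b \<otimes>\<^bsub>B\<^esub> inv\<^bsub>B\<^esub> a" u] by simp
    then have "a (b ((inv\<^bsub>B\<^esub> a) x)) = x"
      using a bH ia x mapX B.m_closed[of a b] by (simp add: T multB)
    then have "(inv\<^bsub>B\<^esub> a) (a (b ((inv\<^bsub>B\<^esub> a) x))) = (inv\<^bsub>B\<^esub> a) x" by simp
    then have fix1: "b ((inv\<^bsub>B\<^esub> a) x) = (inv\<^bsub>B\<^esub> a) x"
      using multB[OF ia a(1) mapX[OF bH mapX[OF ia x]]] B.l_inv[of a] a(1) oneB mapX[OF bH mapX[OF ia x]] by simp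
    have fix2: "b x = x" using b by (simp add: T)
    have "(inv\<^bsub>B\<^esub> a) x \<noteq> x"
    proof
      assume "(inv\<^bsub>B\<^esub> a) x = x"
      then have "a x = x" using multB[OF a(1) ia x] B.r_inv[of a] a(1) oneB[OF x] by simp
      then show False using aT a(1) by (simp add: T)
    qed
    then have "b = \<one>\<^bsub>B\<^esub>" using fp[OF bH _ mapX[OF ia x] x fix1 fix2] by (auto simp: B_def)
    then show "g = 0" using b E.emb_one by simp
  qed
  have proper: "\<iota> ` T \<noteq> \<iota> ` H"
  proof
    assume "\<iota> ` T = \<iota> ` H"
    then have TH': "T = H" using E.inj_emb TH by (simp add: inj_on_image_eq_iff)
    have Xx: "y = x" if y: "y \<in> X" for y
      using transitive_action.unique_orbit[OF trans x y] TH' by (auto simp: T)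
    have "b = \<one>\<^bsub>B\<^esub>" if b: "b \<in> T" for b
    proof (rule extensionalityI[of _ X])
      show "b \<in> extensional X" using b TH HB Bij_imp_extensional by blast
      show "\<one>\<^bsub>B\<^esub> \<in> extensional X" by (simp add: B_def BijGroup_def)
      show "b y = \<one>\<^bsub>B\<^esub> y" if "y \<in> X" for y using b Xx[OF that] oneB[OF x] by (simp add: T)
    qed
    then have "\<iota> ` T \<subseteq> {0}" using E.emb_one by auto
    then show False using ntT fin_subgroupD(2)[OF E.fin_subgroup_emb[OF Tsub]] by blast
  qed
  have "\<exists>h\<in>radon_kernel (\<iota> ` T). h \<noteq> (0 :: nat_perm \<Rightarrow>\<^sub>0 complex)"
    by (rule frobenius_radon_kernel[OF E.fin_subgroup_S E.fin_subgroup_emb[OF Tsub]])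
      (use TH mal ntT proper in auto)
  then show ?thesis unfolding emb.radon_injective_iff im by blast
qed

section \<open>Matrix representations\<close>

lemma matvec_index:
  assumes "A \<in> carrier_mat d d" "v \<in> carrier_vec d" "i < d"
  shows "(A *\<^sub>v v) $ i = (\<Sum>k<d. A $$ (i, k) * v $ k)"
  using assms by (auto simp: scalar_prod_def lessThan_atLeast0)

lemma matvec_zero: "A \<in> carrier_mat d d \<Longrightarrow> A *\<^sub>v 0\<^sub>v d = (0\<^sub>v d :: complex vec)"
  by (intro eq_vecI) (auto simp: scalar_prod_def)

lemma matvec_sum_swap:
  fixes A :: "complex mat"
  assumes "A \<in> carrier_mat d d" "\<And>t. t \<in> T \<Longrightarrow> v t \<in> carrier_vec d" "u \<in> carrier_vec d"
    and "\<And>k. k < d \<Longrightarrow> u $ k = (\<Sum>t\<in>T. v t $ k)" and "i < d"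
  shows "(A *\<^sub>v u) $ i = (\<Sum>t\<in>T. (A *\<^sub>v v t) $ i)"
proof -
  have "(A *\<^sub>v u) $ i = (\<Sum>k<d. \<Sum>t\<in>T. A $$ (i, k) * v t $ k)"
    unfolding matvec_index[OF assms(1,3,5)] by (intro sum.cong refl) (simp add: assms(4) sum_distrib_left)
  also have "\<dots> = (\<Sum>t\<in>T. \<Sum>k<d. A $$ (i, k) * v t $ k)" by (rule sum.swap)
  also have "\<dots> = (\<Sum>t\<in>T. (A *\<^sub>v v t) $ i)"
    by (intro sum.cong refl) (simp add: matvec_index[OF assms(1) assms(2) assms(5)])
  finally show ?thesis .
qed

lemma finsum_matvec:
  fixes f :: "'t \<Rightarrow> complex mat"
  assumes "finite T" "\<And>t. t \<in> T \<Longrightarrow> f t \<in> carrier_mat d d" "v \<in> carrier_vec d" "i < d"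
  shows "finsum (ring_mat TYPE(complex) d ()) f T \<in> carrier_mat d d"
    "(finsum (ring_mat TYPE(complex) d ()) f T *\<^sub>v v) $ i = (\<Sum>t\<in>T. (f t *\<^sub>v v) $ i)"
proof -
  interpret R: ring "ring_mat TYPE(complex) d ()" by (rule ring_mat)
  have closed: "finsum (ring_mat TYPE(complex) d ()) f T' \<in> carrier_mat d d" if "T' \<subseteq> T" for T'
    using R.finsum_closed[of f T'] assms(2) that by (auto simp: ring_mat_simps)
  then show "finsum (ring_mat TYPE(complex) d ()) f T \<in> carrier_mat d d" by blast
  have "T' \<subseteq> T \<Longrightarrow> (finsum (ring_mat TYPE(complex) d ()) f T' *\<^sub>v v) $ i = (\<Sum>t\<in>T'. (f t *\<^sub>v v) $ i)" for T'
  proof (induction T' rule: infinite_finite_induct)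
    case (infinite T')
    then show ?case using assms(1) finite_subset by blast
  next
    case empty
    then show ?case using assms(3,4) by (simp add: ring_mat_simps)
  next
    case (insert t T')
    have "f \<in> T' \<rightarrow> carrier (ring_mat TYPE(complex) d ())" "f t \<in> carrier (ring_mat TYPE(complex) d ())"
      using assms(2) insert.prems by (auto simp: ring_mat_simps)
    from R.finsum_insert[OF insert.hyps(1,2) this]
    have "finsum (ring_mat TYPE(complex) d ()) f (insert t T') = f t + finsum (ring_mat TYPE(complex) d ()) f T'"
      by (simp add: ring_mat_simps)
    moreover have "f t \<in> carrier_mat d d" "finsum (ring_mat TYPE(complex) d ()) f T' \<in> carrier_mat d d"
      using assms(2) insert.prems closed by auto
    ultimately show ?case using insert assms(3,4) by (simp add: add_mult_distrib_mat_vec)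
  qed
  then show "(finsum (ring_mat TYPE(complex) d ()) f T *\<^sub>v v) $ i = (\<Sum>t\<in>T. (f t *\<^sub>v v) $ i)" by blast
qed

lemma GL_carrier: "carrier (GL d) = {A \<in> carrier_mat d d. \<exists>B\<in>carrier_mat d d. B * A = 1\<^sub>m d \<and> A * B = 1\<^sub>m d}"
  by (auto simp: units_of_carrier Units_def ring_mat_simps)

lemma (in group) representationD:
  assumes "representation G \<rho>"
  shows "x \<in> carrier G \<Longrightarrow> \<rho> x \<in> carrier_mat (deg G \<rho>) (deg G \<rho>)"
    "x \<in> carrier G \<Longrightarrow> y \<in> carrier G \<Longrightarrow> \<rho> (x \<otimes> y) = \<rho> x * \<rho> y"
    "\<rho> \<one> = 1\<^sub>m (deg G \<rho>)"
proof -
  let ?d = "deg G \<rho>"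
  have hom: "\<rho> \<in> hom G (GL ?d)" using assms by (simp add: representation_def)
  show c: "x \<in> carrier G \<Longrightarrow> \<rho> x \<in> carrier_mat ?d ?d" for x
    using hom_in_carrier[OF hom, of x] by (simp add: GL_carrier)
  show "x \<in> carrier G \<Longrightarrow> y \<in> carrier G \<Longrightarrow> \<rho> (x \<otimes> y) = \<rho> x * \<rho> y"
    using hom_mult[OF hom, of x y] by (simp add: units_of_mult ring_mat_simps)
  interpret R: ring "ring_mat TYPE(complex) ?d ()" by (rule ring_mat)
  interpret h: group_hom G "GL ?d" \<rho>
    by (intro group_hom.intro group_hom_axioms.intro is_group R.units_group hom)
  show "\<rho> \<one> = 1\<^sub>m ?d" using h.hom_one by (simp add: units_of_one ring_mat_simps)
qed

lemma finite_integer_mod_group: "0 < n \<Longrightarrow> finite (carrier (integer_mod_group n))"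
  by (simp add: carrier_integer_mod_group)

lemma (in group) I_op_apply:
  assumes \<rho>: "representation G \<rho>" and n: "0 < n" and \<gamma>: "\<gamma> \<in> Gamma G n"
    and v: "v \<in> carrier_vec (deg G \<rho>)"
  shows "I_op G \<rho> n \<gamma> \<in> carrier_mat (deg G \<rho>) (deg G \<rho>)"
    "i < deg G \<rho> \<Longrightarrow> (I_op G \<rho> n \<gamma> *\<^sub>v v) $ i = (\<Sum>t\<in>carrier (integer_mod_group n). (\<rho> (\<gamma> t) *\<^sub>v v) $ i)"
proof -
  interpret h: group_hom "integer_mod_group n" G \<gamma> by (rule GammaD(1)[OF \<gamma>])
  have c: "\<rho> (\<gamma> t) \<in> carrier_mat (deg G \<rho>) (deg G \<rho>)" if "t \<in> carrier (integer_mod_group n)" for t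
    using representationD(1)[OF \<rho> h.hom_closed[OF that]] .
  show "i < deg G \<rho> \<Longrightarrow> (I_op G \<rho> n \<gamma> *\<^sub>v v) $ i = (\<Sum>t\<in>carrier (integer_mod_group n). (\<rho> (\<gamma> t) *\<^sub>v v) $ i)"
    unfolding I_op_def by (rule finsum_matvec(2)[OF finite_integer_mod_group[OF n] c v])
  interpret R: ring "ring_mat TYPE(complex) (deg G \<rho>) ()" by (rule ring_mat)
  show "I_op G \<rho> n \<gamma> \<in> carrier_mat (deg G \<rho>) (deg G \<rho>)"
    unfolding I_op_def using R.finsum_closed[of "\<lambda>t. \<rho> (\<gamma> t)" "carrier (integer_mod_group n)"] c
    by (auto simp: ring_mat_simps)
qed

lemma (in group) prime_order_element:
  assumes fin: "finite (carrier G)" and C: "subgroup C G" "C \<noteq> {\<one>}"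
  obtains x p where "x \<in> C" "x \<noteq> \<one>" "Factorial_Ring.prime (p::nat)" "p dvd Coset.order G" "x [^] p = \<one>"
proof -
  obtain c where c: "c \<in> C" "c \<noteq> \<one>" using C subgroup.one_closed[OF C(1)] by blast
  have cG: "c \<in> carrier G" using subgroup.subset[OF C(1)] c by blast
  have "ord c \<noteq> 1" using ord_eq_1[OF cG] c by simp
  then obtain p where p: "Factorial_Ring.prime p" "p dvd ord c" using prime_factor_nat by blast
  then obtain k where k: "ord c = p * k" by (auto simp: dvd_def)
  have k0: "0 < k" using k ord_ge_1[OF fin cG] by (cases k) auto
  have "(c [^] k) [^] p = \<one>" using k cG by (simp add: nat_pow_pow mult.commute[of k p]) (metis pow_ord_eq_1 k)
  moreover have "c [^] k \<noteq> \<one>"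
  proof
    assume "c [^] k = \<one>"
    then have "ord c dvd k" using pow_eq_id[OF cG] by simp
    then have "p * k \<le> k" using k k0 by (auto dest: dvd_imp_le)
    then show False using k0 prime_ge_2_nat[OF p(1)] by simp
  qed
  moreover have "c [^] k \<in> C"
    using subgroup_int_pow_closed[OF C(1) c(1), of "int k"] by (simp add: int_pow_int)
  moreover have "p dvd Coset.order G" using p(2) ord_dvd_group_order[OF cG] dvd_trans by blast
  ultimately show ?thesis using that p(1) by blast
qed

text \<open>For \<open>v\<close> in \<open>k(\<rho>)\<close> the sum of the \<open>\<rho>(t)
  v\<close> over a subgroup of prime order vanishes, hence so do the sums of the coefficient
  function \<open>x \<mapsto> (\<rho>(x) v)\<^sub>i\<close> over the cosets of that subgroup. Every
  nontrivial subgroup contains one of prime order, so the Radon transform annihilates the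
  coefficient functions of \<open>v\<close>; at the identity they are the coordinates of
  \<open>v\<close>.\<close>

lemma (in group) k_space_not_radon_injective:
  assumes fin: "finite (carrier G)" and \<rho>: "representation G \<rho>" and k: "k_space G \<rho> \<noteq> {0\<^sub>v (deg G \<rho>)}"
  shows "\<not> radon_injective G"
proof
  assume inj: "radon_injective G"
  let ?d = "deg G \<rho>"
  have opos: "0 < Coset.order G" using fin order_gt_0_iff_finite by blast
  have zero_in: "0\<^sub>v ?d \<in> k_space G \<rho>"
    unfolding k_space_def
  proof (intro IntI INT_I)
    fix p \<gamma> assume p: "p \<in> {p. Factorial_Ring.prime p \<and> p dvd Coset.order G}" and \<gamma>: "\<gamma> \<in> Gamma G p"
    then have "0 < p" using prime_gt_0_nat by auto
    then show "0\<^sub>v ?d \<in> mat_kernel (I_op G \<rho> p \<gamma>)"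
      using I_op_apply(1)[OF \<rho> _ \<gamma> zero_carrier_vec] by (intro mat_kernelI[of _ ?d ?d]) auto
  qed simp
  then obtain v where v: "v \<in> k_space G \<rho>" "v \<noteq> 0\<^sub>v ?d" using k by blast
  then have vc: "v \<in> carrier_vec ?d" by (simp add: k_space_def)
  obtain i where i: "i < ?d" "v $ i \<noteq> 0" using v(2) vc by (metis eq_vecI carrier_vecD index_zero_vec)
  define f where "f x = (\<rho> x *\<^sub>v v) $ i" for x
  note rho = representationD[OF \<rho>]
  have sums: "(\<Sum>c\<in>C. f (y \<otimes> c)) = 0" if C: "subgroup C G" "C \<noteq> {\<one>}" and y: "y \<in> carrier G" for C y
  proof -
    obtain x p where x: "x \<in> C" "x \<noteq> \<one>" "Factorial_Ring.prime p" "p dvd Coset.order G" "x [^] p = \<one>"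
      using prime_order_element[OF fin C] .
    have xG: "x \<in> carrier G" using subgroup.subset[OF C(1)] x by blast
    have p0: "0 < p" by (rule prime_gt_0_nat[OF x(3)])
    note \<gamma> = power_in_Gamma(1)[OF xG x(2,5) p0]
    have "v \<in> mat_kernel (I_op G \<rho> p (\<lambda>t::int. x [^] t))" using v(1) x(3,4) \<gamma> by (auto simp: k_space_def)
    then have Iv: "I_op G \<rho> p (\<lambda>t::int. x [^] t) *\<^sub>v v = 0\<^sub>v ?d"
      using I_op_apply(1)[OF \<rho> p0 \<gamma> vc] by (simp add: mat_kernel_def)
    show ?thesis
    proof (rule subgroup_sum_zero_of_Gamma[OF C(1) _ p0, where \<gamma> = "\<lambda>t::int. x [^] t"])
      show "finite C" using subgroup.subset[OF C(1)] fin by (rule finite_subset)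
      show "x [^] (t::int) \<in> C" for t by (rule subgroup_int_pow_closed[OF C(1) x(1)])
      show "(\<Sum>t\<in>carrier (integer_mod_group p). f (z \<otimes> x [^] t)) = 0" if z: "z \<in> carrier G" for z
      proof -
        have "(\<Sum>t\<in>carrier (integer_mod_group p). f (z \<otimes> x [^] t))
            = (\<Sum>t\<in>carrier (integer_mod_group p). (\<rho> z *\<^sub>v (\<rho> (x [^] t) *\<^sub>v v)) $ i)"
        proof (intro sum.cong refl)
          fix t :: int
          have "\<rho> (z \<otimes> x [^] t) *\<^sub>v v = \<rho> z *\<^sub>v (\<rho> (x [^] t) *\<^sub>v v)"
            using rho(2)[OF z int_pow_closed[OF xG, of t]]
              assoc_mult_mat_vec[OF rho(1)[OF z] rho(1)[OF int_pow_closed[OF xG, of t]] vc] by simp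
          then show "f (z \<otimes> x [^] t) = (\<rho> z *\<^sub>v (\<rho> (x [^] t) *\<^sub>v v)) $ i" by (simp add: f_def)
        qed
        also have "\<dots> = (\<rho> z *\<^sub>v 0\<^sub>v ?d) $ i"
        proof (rule matvec_sum_swap[OF rho(1)[OF z] _ _ _ i(1), symmetric])
          show "\<rho> (x [^] t) *\<^sub>v v \<in> carrier_vec ?d" for t :: int
            by (rule mult_mat_vec_carrier[OF rho(1)[OF int_pow_closed[OF xG]] vc])
          show "0\<^sub>v ?d $ j = (\<Sum>t\<in>carrier (integer_mod_group p). (\<rho> (x [^] t) *\<^sub>v v) $ j)" if "j < ?d" for j
            using I_op_apply(2)[OF \<rho> p0 \<gamma> vc that] Iv by simp
        qed simp
        also have "\<dots> = 0"
          using matvec_index[OF rho(1)[OF z] zero_carrier_vec i(1)] by (auto intro!: sum.neutral)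
        finally show ?thesis .
      qed
    qed (rule y)
  qed
  have "radon G n f x \<gamma> = 0" if "2 \<le> n" "x \<in> carrier G" "\<gamma> \<in> Gamma G n" for n x \<gamma>
    by (rule radon_zero_of_subgroup_sums[OF fin _ that(3,2)]) (use that sums in auto)
  then have "f \<one> = 0" using inj one_closed unfolding radon_injective_def by blast
  then show False using i vc by (simp add: f_def rho(3))
qed

text \<open>The vector \<open>I(\<rho>, \<gamma>) w\<close> is fixed by \<open>\<rho>(\<gamma>
  s)\<close> for every \<open>s\<close>, and some \<open>\<gamma> s\<close> is not the identity. So
  \<open>I(\<rho>, \<gamma>) w = 0\<close> for every \<open>w\<close>; a unit vector is a nonzero
  choice.\<close>

lemma (in group) fixed_point_free_k_space:
  assumes \<rho>: "representation G \<rho>" and d: "deg G \<rho> \<noteq> 0" and F: "F_space G \<rho> = {0\<^sub>v (deg G \<rho>)}"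
  shows "k_space G \<rho> \<noteq> {0\<^sub>v (deg G \<rho>)}"
proof -
  let ?d = "deg G \<rho>"
  note rho = representationD[OF \<rho>]
  define w :: "complex vec" where "w = unit_vec ?d 0"
  have wc: "w \<in> carrier_vec ?d" and w0: "w \<noteq> 0\<^sub>v ?d" using d by (auto simp: w_def)
  have "w \<in> k_space G \<rho>" unfolding k_space_def
  proof (intro IntI INT_I wc)
    fix p \<gamma> assume p: "p \<in> {p. Factorial_Ring.prime p \<and> p dvd Coset.order G}" and \<gamma>: "\<gamma> \<in> Gamma G p"
    then have p0: "0 < p" using prime_gt_0_nat by auto
    let ?Z = "carrier (integer_mod_group p)"
    interpret h: group_hom "integer_mod_group p" G \<gamma> by (rule GammaD(1)[OF \<gamma>])
    note I = I_op_apply[OF \<rho> p0 \<gamma> wc]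
    define u where "u = I_op G \<rho> p \<gamma> *\<^sub>v w"
    have uc: "u \<in> carrier_vec ?d" unfolding u_def by (rule mult_mat_vec_carrier[OF I(1) wc])
    obtain s where s: "s \<in> ?Z" "\<gamma> s \<noteq> \<one>" using GammaD(2)[OF \<gamma>] by blast
    note sG = h.hom_closed[OF s(1)]
    have "\<rho> (\<gamma> s) *\<^sub>v u = u"
    proof (rule eq_vecI)
      show "dim_vec (\<rho> (\<gamma> s) *\<^sub>v u) = dim_vec u" using rho(1)[OF sG] uc by auto
      fix i assume "i < dim_vec u"
      then have i: "i < ?d" using uc by simp
      have "(\<rho> (\<gamma> s) *\<^sub>v u) $ i = (\<Sum>t\<in>?Z. (\<rho> (\<gamma> s) *\<^sub>v (\<rho> (\<gamma> t) *\<^sub>v w)) $ i)"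
      proof (rule matvec_sum_swap[OF rho(1)[OF sG] _ uc _ i])
        show "\<rho> (\<gamma> t) *\<^sub>v w \<in> carrier_vec ?d" if "t \<in> ?Z" for t
          by (rule mult_mat_vec_carrier[OF rho(1)[OF h.hom_closed[OF that]] wc])
        show "u $ k = (\<Sum>t\<in>?Z. (\<rho> (\<gamma> t) *\<^sub>v w) $ k)" if "k < ?d" for k
          unfolding u_def by (rule I(2)[OF that])
      qed
      also have "\<dots> = (\<Sum>t\<in>?Z. (\<rho> (\<gamma> (s \<otimes>\<^bsub>integer_mod_group p\<^esub> t)) *\<^sub>v w) $ i)"
      proof (intro sum.cong refl)
        fix t assume t: "t \<in> ?Z"
        have "\<rho> (\<gamma> (s \<otimes>\<^bsub>integer_mod_group p\<^esub> t)) = \<rho> (\<gamma> s) * \<rho> (\<gamma> t)"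
          using h.hom_mult[OF s(1) t] rho(2)[OF sG h.hom_closed[OF t]] by simp
        then show "(\<rho> (\<gamma> s) *\<^sub>v (\<rho> (\<gamma> t) *\<^sub>v w)) $ i = (\<rho> (\<gamma> (s \<otimes>\<^bsub>integer_mod_group p\<^esub> t)) *\<^sub>v w) $ i"
          using assoc_mult_mat_vec[OF rho(1)[OF sG] rho(1)[OF h.hom_closed[OF t]] wc] by simp
      qed
      also have "\<dots> = (\<Sum>t\<in>?Z. (\<rho> (\<gamma> t) *\<^sub>v w) $ i)"
      proof (rule sum.reindex_bij_betw[where g = "\<lambda>t. (\<rho> (\<gamma> t) *\<^sub>v w) $ i"])
        show "bij_betw ((\<otimes>\<^bsub>integer_mod_group p\<^esub>) s) ?Z ?Z"
          by (rule bij_betw_byWitness[where f' = "\<lambda>t. inv\<^bsub>integer_mod_group p\<^esub> s \<otimes>\<^bsub>integer_mod_group p\<^esub> t"])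
            (use s h.G.m_assoc[symmetric] h.G.m_closed h.G.inv_closed in
              \<open>auto simp del: mult_integer_mod_group inv_integer_mod_group\<close>)
      qed
      also have "\<dots> = u $ i" unfolding u_def by (rule I(2)[OF i, symmetric])
      finally show "(\<rho> (\<gamma> s) *\<^sub>v u) $ i = u $ i" .
    qed
    then have "u \<in> F_space G \<rho>" using uc sG s(2) by (auto simp: F_space_def)
    then have "u = 0\<^sub>v ?d" using F by simp
    then show "w \<in> mat_kernel (I_op G \<rho> p \<gamma>)"
      using I(1) wc by (intro mat_kernelI[of _ ?d ?d]) (auto simp: u_def)
  qed
  then show ?thesis using w0 by auto
qed

section \<open>A fixed-point-free irreducible representation inside the Radon kernel\<close>

text \<open>The stabilizer \<open>C\<close> of \<open>h\<close> is a subgroup, and if it is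
  nontrivial, then \<open>|C| h = \<sigma>\<^sub>C h = 0\<close>.\<close>

lemma radon_kernel_fixed_point_free:
  fixes h :: "'g::group_add \<Rightarrow>\<^sub>0 complex"
  assumes S: "fin_subgroup S" and h: "h \<in> radon_kernel S" and s: "s \<in> S" "s \<noteq> 0" "sg s 1 * h = h"
  shows "h = 0"
proof -
  note S' = fin_subgroupD[OF S]
  define C where "C = {s \<in> S. sg s 1 * h = h}"
  have "fin_subgroup C" unfolding fin_subgroup_def
  proof (intro conjI ballI)
    show "finite C" using S' by (simp add: C_def)
    show "0 \<in> C" using S' by (simp add: C_def)
    show "x + y \<in> C" if "x \<in> C" "y \<in> C" for x y
      using that S'(3) sg_mult_sg[of x y h] by (simp add: C_def)
    show "- x \<in> C" if "x \<in> C" for x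
      using that S'(4) sg_mult_sg[of "- x" x h] by (simp add: C_def)
  qed
  moreover have "s \<in> C" using s by (simp add: C_def)
  ultimately have "C \<in> nontrivial_subgroups S" using s(2) by (auto simp: nontrivial_subgroups_def C_def)
  then have "subgroup_sum C * h = 0" using h by (simp add: radon_kernel_def)
  moreover have "subgroup_sum C * h = sc (of_nat (card C)) * h"
    unfolding subgroup_sum_def sum_distrib_right by (simp add: C_def)
  ultimately have "of_nat (card C) = (0::complex) \<or> h = 0" by (simp only: sc_mult_eq_0_iff)
  then show ?thesis using fin_subgroup_card_pos[OF \<open>fin_subgroup C\<close>] by simp
qed

lemma module_basis:
  fixes M :: "('g::group_add \<Rightarrow>\<^sub>0 complex) set"
  assumes S: "fin_subgroup S" and M: "M \<subseteq> galg S" "\<And>f g. f \<in> M \<Longrightarrow> g \<in> M \<Longrightarrow> f + g \<in> M"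
    "\<And>c f. f \<in> M \<Longrightarrow> sc c * f \<in> M" "0 \<in> M"
  obtains d :: nat and b where "\<And>i. i < d \<Longrightarrow> b i \<in> M"
    "\<And>c. (\<Sum>i<d. sc (c i) * b i) = 0 \<Longrightarrow> \<forall>i<d. c i = 0"
    "\<And>m. m \<in> M \<Longrightarrow> \<exists>c. m = (\<Sum>i<d. sc (c i) * b i)"
proof -
  define indep where "indep d b \<longleftrightarrow> (\<forall>i<d. b i \<in> M) \<and> (\<forall>c. (\<Sum>i<d. sc (c i) * b i) = 0 \<longrightarrow> (\<forall>i<d. c i = 0))"
    for d and b :: "nat \<Rightarrow> 'g \<Rightarrow>\<^sub>0 complex"
  have bound: "d < card S + 1" if ex: "\<exists>b. indep d b" for d
  proof (rule ccontr)
    assume "\<not> d < card S + 1"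
    moreover obtain b where b: "indep d b" using ex by blast
    ultimately have "\<exists>c. (\<exists>i\<in>{..<d}. c i \<noteq> 0) \<and> (\<Sum>i\<in>{..<d}. sc (c i) * b i) = 0"
      by (intro linear_dependence[of S] fin_subgroupD(1)[OF S]) (use M(1) in \<open>auto simp: indep_def\<close>)
    then show False using b by (auto simp: indep_def)
  qed
  have "\<exists>b. indep 0 b" by (simp add: indep_def)
  from ex_has_greatest_nat[of "\<lambda>d. \<exists>b. indep d b" 0 "\<lambda>d. d" "card S + 1", OF this]
  obtain d b where b: "indep d b" and max: "\<And>d'. \<exists>b. indep d' b \<Longrightarrow> d' \<le> d" using bound by (metis less_imp_le)
  have "\<exists>c. m = (\<Sum>i<d. sc (c i) * b i)" if m: "m \<in> M" for m
  proof -
    have "\<not> indep (Suc d) (b(d := m))" using max[of "Suc d"] by auto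
    moreover have "\<forall>i<Suc d. (b(d := m)) i \<in> M" using b m by (auto simp: indep_def)
    ultimately obtain c where c: "(\<Sum>i<Suc d. sc (c i) * (b(d := m)) i) = 0" "\<exists>i<Suc d. c i \<noteq> 0"
      by (auto simp: indep_def)
    have "(\<Sum>i<d. sc (c i) * (b(d := m)) i) = (\<Sum>i<d. sc (c i) * b i)" by (intro sum.cong refl) auto
    then have c1: "(\<Sum>i<d. sc (c i) * b i) + sc (c d) * m = 0" using c(1) by simp
    have cd: "c d \<noteq> 0"
    proof
      assume "c d = 0"
      then have "\<forall>i<d. c i = 0" using c1 b by (simp add: indep_def)
      then show False using c(2) \<open>c d = 0\<close> by (auto simp: less_Suc_eq)
    qed
    have "m = (\<Sum>i<d. sc (- c i / c d) * b i)"
    proof (rule poly_mapping_eqI)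
      fix k
      from arg_cong[where f = "\<lambda>u. cf u k", OF c1]
      have "(\<Sum>i<d. c i * cf (b i) k) + c d * cf m k = 0" by (simp add: lookup_add lookup_sum)
      then have "cf m k = - (\<Sum>i<d. c i * cf (b i) k) / c d" using cd by (simp add: field_simps add_eq_0_iff)
      then show "cf m k = cf (\<Sum>i<d. sc (- c i / c d) * b i) k"
        by (simp add: lookup_sum sum_negf sum_divide_distrib)
    qed
    then show ?thesis by (intro exI[of _ "\<lambda>i. - c i / c d"])
  qed
  then show ?thesis using that[of d b] b by (auto simp: indep_def)
qed

lemma mat_eq_by_action:
  fixes A :: "complex mat"
  assumes A: "A \<in> carrier_mat d d" and B: "B \<in> carrier_mat d d"
    and eq: "\<And>v. v \<in> carrier_vec d \<Longrightarrow> A *\<^sub>v v = B *\<^sub>v v"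
  shows "A = B"
proof (rule eq_matI)
  show "dim_row A = dim_row B" "dim_col A = dim_col B" using A B by auto
  fix i j assume "i < dim_row B" "j < dim_col B"
  then have ij: "i < d" "j < d" using B by auto
  have entry: "(M *\<^sub>v unit_vec d j) $ i = M $$ (i, j)" if "M \<in> carrier_mat d d" for M :: "complex mat"
    using that ij by simp
  show "A $$ (i, j) = B $$ (i, j)"
    using eq[of "unit_vec d j"] entry[OF A] entry[OF B] by simp
qed

text \<open>Every nonzero element of \<open>\<complex>[S] E\<close> generates this left ideal: by
  nondegeneracy of the trace form \<open>E y u E\<close> has nonzero trace for some
  \<open>y\<close>, and it is a multiple of \<open>E\<close>.\<close>

lemma primitive_left_ideal_minimal:
  assumes S: "fin_subgroup S" and E: "primitive S E" and u: "u \<in> galg S" "u * E = u" "u \<noteq> 0"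
  shows "\<exists>a\<in>galg S. a * u = E"
proof -
  note E' = primitiveD[OF E]
  obtain y where y: "y \<in> galg S" "cf (u * y) 0 \<noteq> 0" using trace_form_nondegenerate[OF S u(1,3)] .
  obtain l where l: "E * (y * u) * E = sc l * E" using E'(4)[OF galg_mult[OF S y(1) u(1)]] by blast
  have "cf (E * (y * u) * E) 0 = cf (E * (y * u)) 0" using u(2) by (simp add: mult.assoc)
  also have "\<dots> = cf ((y * u) * E) 0" by (intro cf_mult_commute_zero[OF S] galg_mult S E' y u)
  also have "\<dots> = cf (u * y) 0"
    using u(2) cf_mult_commute_zero[OF S y(1) u(1)] by (simp add: mult.assoc)
  finally have "l \<noteq> 0" using y(2) l by auto
  then have "(sc (1 / l) * (E * y)) * u = E"
    using l u(2) by (simp add: mult.assoc sc_mult_sc)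
  moreover have "sc (1 / l) * (E * y) \<in> galg S" by (intro galg_mult galg_sc S E' y)
  ultimately show ?thesis by blast
qed

text \<open>By Maschke's theorem the Radon kernel is generated by an idempotent, and a primitive
  summand \<open>E\<close> of it again lies in the Radon kernel. In coordinates the minimal left
  ideal \<open>M = \<complex>[S] E\<close> is an irreducible matrix representation, and it has no
  fixed points because it is contained in the Radon kernel.\<close>

theorem (in group_embedding) fixed_point_free_irreducible_exists:
  assumes ninj: "\<not> radon_injective G"
  obtains \<rho> where "irreducible_rep G \<rho>"
    "\<And>x v. x \<in> carrier G \<Longrightarrow> x \<noteq> \<one> \<Longrightarrow> v \<in> carrier_vec (deg G \<rho>) \<Longrightarrow> \<rho> x *\<^sub>v v = v \<Longrightarrow> v = 0\<^sub>v (deg G \<rho>)"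
proof -
  note finS = fin_subgroup_S
  let ?L = "radon_kernel S :: ('g \<Rightarrow>\<^sub>0 complex) set"
  obtain h where h: "h \<in> ?L" "h \<noteq> 0" using ninj radon_injective_iff by blast
  obtain f where f: "f \<in> ?L" "\<And>j. j \<in> ?L \<Longrightarrow> j * f = j"
  proof (rule maschke_complex[OF finS, of ?L])
    show "f + g \<in> ?L" if "f \<in> ?L" "g \<in> ?L" for f g
      using that by (auto simp: radon_kernel_def distrib_left intro: galg_add)
    show "a * g \<in> ?L" if "a \<in> galg S" "g \<in> ?L" for a g
      by (rule radon_kernel_left_ideal[OF finS that])
  qed (auto simp: radon_kernel_def)
  have fS: "f \<in> galg S" using f(1) by (simp add: radon_kernel_def)
  obtain \<F> where \<F>: "finite \<F>" "\<And>E. E \<in> \<F> \<Longrightarrow> primitive S E"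
    "\<And>E E'. E \<in> \<F> \<Longrightarrow> E' \<in> \<F> \<Longrightarrow> E \<noteq> E' \<Longrightarrow> E * E' = 0" "\<Sum>\<F> = f"
    using primitive_decomposition[OF finS fS f(2)[OF f(1)]] by blast
  have "f \<noteq> 0" using f(2)[OF h(1)] h(2) by auto
  then obtain E where E: "E \<in> \<F>" using \<F>(4) by fastforce
  note pE = \<F>(2)[OF E] and E' = primitiveD[OF \<F>(2)[OF E]]
  have "E * f = (\<Sum>E'\<in>\<F>. if E' = E then E else 0)"
    unfolding \<F>(4)[symmetric] sum_distrib_left
    by (intro sum.cong refl) (use \<F>(3)[OF E] E'(2) in auto)
  then have "E * f = E" using \<F>(1) E by simp
  then have EL: "E \<in> ?L" using radon_kernel_left_ideal[OF finS E'(1) f(1)] by simp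
  define M where "M = {b \<in> galg S. b * E = b}"
  have M_ker: "b \<in> ?L" if "b \<in> M" for b
    using radon_kernel_left_ideal[OF finS _ EL, of b] that by (simp add: M_def)
  have Msg: "a * b \<in> M" if "a \<in> galg S" "b \<in> M" for a b
    using that by (auto simp: M_def mult.assoc intro: galg_mult finS)
  obtain d :: nat and b where b: "\<And>i. i < d \<Longrightarrow> b i \<in> M"
    and indp: "\<And>c. (\<Sum>i<d. sc (c i) * b i) = 0 \<Longrightarrow> \<forall>i<d. c i = 0"
    and spans: "\<And>m. m \<in> M \<Longrightarrow> \<exists>c. m = (\<Sum>i<d. sc (c i) * b i)"
    by (rule module_basis[OF finS, of M])
      (auto simp: M_def distrib_right mult.assoc intro: galg_add galg_mult galg_sc finS)
  \<comment> \<open>The isomorphism from coordinate vectors to \<open>M\<close>;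
    \<open>crd\<close> is its inverse.\<close>
  define lin where "lin v = (\<Sum>i<d. sc (v $ i) * b i)" for v :: "complex vec"
  have Msum: "(\<Sum>i\<in>I. g i) \<in> M" if "\<And>i. i \<in> I \<Longrightarrow> g i \<in> M" for g and I :: "nat set"
    using that by (auto simp: M_def sum_distrib_right intro: galg_sum)
  have linM: "lin v \<in> M" for v
    unfolding lin_def by (intro Msum Msg galg_sc finS b) auto
  have lin_add: "lin (v + w) = lin v + lin w" if "v \<in> carrier_vec d" "w \<in> carrier_vec d" for v w
    using that by (simp add: lin_def single_add distrib_right sum.distrib)
  have lin_smult: "lin (c \<cdot>\<^sub>v v) = sc c * lin v" if "v \<in> carrier_vec d" for c v
    using that by (simp add: lin_def sum_distrib_left sc_mult_sc)
  have lin_inj: "v = w" if v: "v \<in> carrier_vec d" and w: "w \<in> carrier_vec d" and eq: "lin v = lin w" for v w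
  proof -
    have "(\<Sum>i<d. sc (v $ i - w $ i) * b i) = 0"
      using eq by (simp add: lin_def single_diff left_diff_distrib sum_subtractf)
    from indp[OF this] show ?thesis using v w by (intro eq_vecI) auto
  qed
  have lin_zero: "lin (0\<^sub>v d) = 0" by (simp add: lin_def)
  have lin_surj: "\<exists>v\<in>carrier_vec d. lin v = m" if m: "m \<in> M" for m
  proof -
    obtain c where c: "m = (\<Sum>i<d. sc (c i) * b i)" using spans[OF m] by blast
    have "lin (vec d c) = m" unfolding c lin_def by (intro sum.cong refl) simp
    then show ?thesis by (intro bexI[of _ "vec d c"]) auto
  qed
  define crd where "crd m = (SOME v. v \<in> carrier_vec d \<and> lin v = m)" for m
  have crd: "crd m \<in> carrier_vec d" "lin (crd m) = m" if "m \<in> M" for m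
    using someI_ex[of "\<lambda>v. v \<in> carrier_vec d \<and> lin v = m"] lin_surj[OF that] by (auto simp: crd_def)
  define \<rho> where "\<rho> x = mat d d (\<lambda>(i, j). crd (sg (\<iota> x) 1 * b j) $ i)" for x
  have \<rho>c: "\<rho> x \<in> carrier_mat d d" for x by (simp add: \<rho>_def)
  have emb_galg: "sg (\<iota> x) c \<in> galg S" if "x \<in> carrier G" for x c using that by (intro galg_sg) auto
  have \<rho>_lin: "lin (\<rho> x *\<^sub>v v) = sg (\<iota> x) 1 * lin v" if x: "x \<in> carrier G" and v: "v \<in> carrier_vec d" for x v
  proof -
    have "lin (\<rho> x *\<^sub>v v) = (\<Sum>i<d. \<Sum>j<d. sc (v $ j) * (sc (crd (sg (\<iota> x) 1 * b j) $ i) * b i))"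
      unfolding lin_def
    proof (intro sum.cong refl)
      fix i assume "i \<in> {..<d}"
      then have i: "i < d" by simp
      have "(\<rho> x *\<^sub>v v) $ i = (\<Sum>j<d. v $ j * crd (sg (\<iota> x) 1 * b j) $ i)"
        unfolding matvec_index[OF \<rho>c v i] by (intro sum.cong refl) (use i in \<open>simp add: \<rho>_def mult.commute\<close>)
      then show "sc ((\<rho> x *\<^sub>v v) $ i) * b i = (\<Sum>j<d. sc (v $ j) * (sc (crd (sg (\<iota> x) 1 * b j) $ i) * b i))"
        by (intro poly_mapping_eqI) (simp add: lookup_sum sum_distrib_right mult.assoc)
    qed
    also have "\<dots> = (\<Sum>j<d. sc (v $ j) * lin (crd (sg (\<iota> x) 1 * b j)))"
      by (subst sum.swap) (simp add: lin_def sum_distrib_left)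
    also have "\<dots> = (\<Sum>j<d. sc (v $ j) * (sg (\<iota> x) 1 * b j))"
      by (intro sum.cong refl) (simp add: crd(2) Msg emb_galg x b)
    also have "\<dots> = sg (\<iota> x) 1 * lin v"
      unfolding lin_def sum_distrib_left by (intro sum.cong refl) (simp only: sc_mult_assoc[of "sg (\<iota> x) 1"])
    finally show ?thesis .
  qed
  have \<rho>v: "\<rho> x *\<^sub>v v \<in> carrier_vec d" if "v \<in> carrier_vec d" for x v
    by (rule mult_mat_vec_carrier[OF \<rho>c that])
  have \<rho>_mult: "\<rho> (x \<otimes> y) = \<rho> x * \<rho> y" if x: "x \<in> carrier G" and y: "y \<in> carrier G" for x y
  proof (rule mat_eq_by_action[OF \<rho>c mult_carrier_mat[OF \<rho>c \<rho>c]])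
    fix v :: "complex vec" assume v: "v \<in> carrier_vec d"
    have "lin (\<rho> (x \<otimes> y) *\<^sub>v v) = lin (\<rho> x *\<^sub>v (\<rho> y *\<^sub>v v))"
      using x y v \<rho>v by (simp add: \<rho>_lin emb_mult sg_mult_sg)
    then show "\<rho> (x \<otimes> y) *\<^sub>v v = \<rho> x * \<rho> y *\<^sub>v v"
      using lin_inj[OF \<rho>v[OF v] \<rho>v[OF \<rho>v[OF v]]] assoc_mult_mat_vec[OF \<rho>c \<rho>c v] by simp
  qed
  have \<rho>_one: "\<rho> \<one> = 1\<^sub>m d"
  proof (rule mat_eq_by_action[OF \<rho>c one_carrier_mat])
    fix v :: "complex vec" assume v: "v \<in> carrier_vec d"
    have "lin (\<rho> \<one> *\<^sub>v v) = lin v" using v by (simp add: \<rho>_lin emb_one)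
    then show "\<rho> \<one> *\<^sub>v v = 1\<^sub>m d *\<^sub>v v" using lin_inj[OF \<rho>v[OF v] v] v by simp
  qed
  have deg: "deg G \<rho> = d" by (simp add: Defs.deg_def \<rho>_one)
  have rep: "representation G \<rho>" unfolding representation_def deg
  proof (rule homI)
    fix x assume x: "x \<in> carrier G"
    show "\<rho> x \<in> carrier (GL d)" unfolding GL_carrier
      using \<rho>c \<rho>_mult[of x "inv x"] \<rho>_mult[of "inv x" x] x by (auto simp: \<rho>_one intro!: bexI[of _ "\<rho> (inv x)"])
    fix y assume "y \<in> carrier G"
    then show "\<rho> (x \<otimes> y) = \<rho> x \<otimes>\<^bsub>GL d\<^esub> \<rho> y"
      using x by (simp add: units_of_mult ring_mat_simps \<rho>_mult)
  qed
  have EM: "E \<in> M" using E' by (simp add: M_def)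
  have d0: "d \<noteq> 0"
  proof
    assume "d = 0"
    then have "E = 0" using spans[OF EM] by simp
    then show False using E'(3) by simp
  qed
  have irr: "irreducible_rep G \<rho>" unfolding irreducible_rep_def deg
  proof (intro conjI rep d0 allI impI, elim conjE)
    fix W assume W: "VectorSpace.subspace class_ring W (module_vec TYPE(complex) d)"
      and inva: "\<forall>x\<in>carrier G. \<forall>w\<in>W. \<rho> x *\<^sub>v w \<in> W"
    have "submodule class_ring W (module_vec TYPE(complex) d)" using W by (simp add: VectorSpace.subspace_def)
    then have Wc: "W \<subseteq> carrier_vec d" and Wadd: "\<And>v w. v \<in> W \<Longrightarrow> w \<in> W \<Longrightarrow> v + w \<in> W"
      and W0: "0\<^sub>v d \<in> W" and Wsm: "\<And>c v. v \<in> W \<Longrightarrow> c \<cdot>\<^sub>v v \<in> W"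
      by (auto simp: submodule_def module_vec_simps class_ring_simps)
    show "W = {0\<^sub>v d} \<or> W = carrier_vec d"
    proof (cases "W = {0\<^sub>v d}")
      case False
      then obtain w where w: "w \<in> W" "w \<noteq> 0\<^sub>v d" using W0 by blast
      have wc: "w \<in> carrier_vec d" using w Wc by blast
      have "lin w \<noteq> 0" using lin_inj[OF wc zero_carrier_vec] w(2) lin_zero by auto
      then obtain a where a: "a \<in> galg S" "a * lin w = E"
        using primitive_left_ideal_minimal[OF finS pE, of "lin w"] linM[of w] by (auto simp: M_def)
      have "v \<in> W" if v: "v \<in> carrier_vec d" for v
      proof -
        define A where "A = lin v * a"
        have AS: "A \<in> galg S" unfolding A_def using linM[of v] by (intro galg_mult finS a) (simp add: M_def)
        have "lin v = A * lin w" using linM[of v] by (simp add: A_def mult.assoc a M_def)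
        also have "\<dots> = (\<Sum>s\<in>S. sg s (cf A s) * lin w)"
          by (subst galg_expand[OF AS fin_subgroupD(1)[OF finS]]) (simp add: sum_distrib_right)
        also have "\<dots> \<in> lin ` W"
        proof -
          have sum_closed: "(\<Sum>s\<in>T. g s) \<in> lin ` W" if "\<And>s. s \<in> T \<Longrightarrow> g s \<in> lin ` W" for g and T :: "'g set"
            using that
          proof (induction T rule: infinite_finite_induct)
            case (insert s T)
            then obtain w1 w2 where w12: "w1 \<in> W" "w2 \<in> W" "g s = lin w1" "sum g T = lin w2" by fastforce
            have "lin (w1 + w2) = lin w1 + lin w2" using lin_add subsetD[OF Wc] w12(1,2) by blast
            then show ?case using insert.hyps w12 Wadd by (intro image_eqI[of _ _ "w1 + w2"]) auto
          qed (use W0 lin_zero in \<open>auto intro!: image_eqI[of _ _ "0\<^sub>v d"]\<close>)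
          show ?thesis
          proof (rule sum_closed)
            fix s assume "s \<in> S"
            then obtain x where x: "x \<in> carrier G" "s = \<iota> x" by blast
            have xw: "\<rho> x *\<^sub>v w \<in> W" using inva x w by blast
            have "sg s (cf A s) * lin w = sc (cf A s) * (sg (\<iota> x) 1 * lin w)"
              unfolding x(2) by (subst sg_eq_sc_mult) (simp only: mult.assoc)
            also have "\<dots> = lin (cf A s \<cdot>\<^sub>v (\<rho> x *\<^sub>v w))"
              by (simp add: lin_smult \<rho>v wc \<rho>_lin x)
            finally show "sg s (cf A s) * lin w \<in> lin ` W" using Wsm[OF xw] by blast
          qed
        qed
        finally obtain w' where "w' \<in> W" "lin v = lin w'" by blast
        then show "v \<in> W" using lin_inj[OF v, of w'] Wc by auto
      qed
      then show ?thesis using Wc by blast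
    qed simp
  qed
  show ?thesis
  proof (rule that[OF irr])
    fix x v assume x: "x \<in> carrier G" "x \<noteq> \<one>" and v: "v \<in> carrier_vec (deg G \<rho>)" and vfix: "\<rho> x *\<^sub>v v = v"
    have vc: "v \<in> carrier_vec d" using v deg by simp
    have "sg (\<iota> x) 1 * lin v = lin v" using \<rho>_lin[OF x(1) vc] vfix by simp
    then have "lin v = 0"
      by (intro radon_kernel_fixed_point_free[OF finS M_ker[OF linM], of "\<iota> x"]) (use x emb_eq_0_iff in auto)
    then show "v = 0\<^sub>v (deg G \<rho>)" using lin_inj[OF vc zero_carrier_vec] lin_zero deg by simp
  qed
qed

text \<open>Equivalent representations correspond under conjugation by a matrix that also matches
  their fixed vectors, so the fixed-point-free representation may be replaced by its
  representative.\<close>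

theorem (in group_embedding) FPF_nonempty:
  assumes ninj: "\<not> radon_injective G" and nt: "carrier G \<noteq> {\<one>}" and Gh: "unitary_dual G Gh"
  shows "FPF G Gh \<noteq> {}"
proof -
  obtain \<sigma> where irr: "irreducible_rep G \<sigma>"
    and fpf: "\<And>x v. x \<in> carrier G \<Longrightarrow> x \<noteq> \<one> \<Longrightarrow> v \<in> carrier_vec (deg G \<sigma>) \<Longrightarrow> \<sigma> x *\<^sub>v v = v \<Longrightarrow> v = 0\<^sub>v (deg G \<sigma>)"
    using fixed_point_free_irreducible_exists[OF ninj] by blast
  obtain \<rho> where \<rho>: "\<rho> \<in> Gh" "equivalent_rep G \<sigma> \<rho>" using Gh irr unfolding unitary_dual_def by blast
  have rep\<sigma>: "representation G \<sigma>" using irr by (simp add: irreducible_rep_def)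
  have rep\<rho>: "representation G \<rho>" using Gh \<rho>(1) unfolding unitary_dual_def irreducible_rep_def by blast
  define d where "d = deg G \<sigma>"
  have d\<rho>: "deg G \<rho> = d" using \<rho>(2) by (simp add: equivalent_rep_def d_def)
  obtain T where T: "T \<in> carrier (GL d)" "\<And>x. x \<in> carrier G \<Longrightarrow> T * \<sigma> x = \<rho> x * T"
    using \<rho>(2) unfolding equivalent_rep_def d_def by blast
  obtain U where Tc: "T \<in> carrier_mat d d" and U: "U \<in> carrier_mat d d" "U * T = 1\<^sub>m d" "T * U = 1\<^sub>m d"
    using T(1) unfolding GL_carrier by blast
  note s = representationD(1)[OF rep\<sigma>, folded d_def] and r = representationD(1)[OF rep\<rho>, unfolded d\<rho>]
  have "F_space G \<rho> = {0\<^sub>v d}"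
  proof
    show "F_space G \<rho> \<subseteq> {0\<^sub>v d}"
    proof
      fix v assume "v \<in> F_space G \<rho>"
      then obtain x where v: "v \<in> carrier_vec d" and x: "x \<in> carrier G" "x \<noteq> \<one>" and vfix: "\<rho> x *\<^sub>v v = v"
        by (auto simp: F_space_def d\<rho>)
      define u where "u = U *\<^sub>v v"
      have u: "u \<in> carrier_vec d" unfolding u_def by (rule mult_mat_vec_carrier[OF U(1) v])
      have Tu: "T *\<^sub>v u = v" unfolding u_def using assoc_mult_mat_vec[OF Tc U(1) v] U(3) v by simp
      have "T *\<^sub>v (\<sigma> x *\<^sub>v u) = \<rho> x *\<^sub>v (T *\<^sub>v u)"
        using assoc_mult_mat_vec[OF Tc s[OF x(1)] u] assoc_mult_mat_vec[OF r[OF x(1)] Tc u] T(2)[OF x(1)] by simp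
      then have "T *\<^sub>v (\<sigma> x *\<^sub>v u) = v" using Tu vfix by simp
      then have "U *\<^sub>v (T *\<^sub>v (\<sigma> x *\<^sub>v u)) = u" by (simp add: u_def)
      moreover have su: "\<sigma> x *\<^sub>v u \<in> carrier_vec d" by (rule mult_mat_vec_carrier[OF s[OF x(1)] u])
      ultimately have "\<sigma> x *\<^sub>v u = u" using assoc_mult_mat_vec[OF U(1) Tc su] U(2) by simp
      then have "u = 0\<^sub>v d" using fpf[OF x] u by (simp add: d_def)
      then show "v \<in> {0\<^sub>v d}" using Tu matvec_zero[OF Tc] by simp
    qed
    \<comment> \<open>The zero vector is a fixed vector only if there is a nonidentity element
      to fix it.\<close>
    obtain x where "x \<in> carrier G" "x \<noteq> \<one>" using nt one_closed by blast
    then show "{0\<^sub>v d} \<subseteq> F_space G \<rho>" using matvec_zero[OF r] by (auto simp: F_space_def d\<rho> intro!: bexI[of _ x])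
  qed
  then have "\<rho> \<in> FPF G Gh" using \<rho>(1) by (simp add: FPF_def d\<rho>)
  then show ?thesis by blast
qed

section \<open>From the Radon kernel to a Frobenius group\<close>

definition reduce :: "int \<Rightarrow> ('g \<Rightarrow>\<^sub>0 int) \<Rightarrow> ('g \<Rightarrow>\<^sub>0 int)" where
  "reduce p f = Poly_Mapping.map (\<lambda>c. c mod p) f"

lemma cf_reduce: "cf (reduce p f) x = cf f x mod p"
  by (simp add: reduce_def Poly_Mapping.map.rep_eq when_def)

lemma reduce_eq_iff: "reduce p f = reduce p g \<longleftrightarrow> cdvd p (f - g)"
proof
  assume "reduce p f = reduce p g"
  then have "cf f x mod p = cf g x mod p" for x by (metis cf_reduce)
  then show "cdvd p (f - g)" by (simp add: cdvd_def lookup_minus mod_eq_dvd_iff)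
next
  assume "cdvd p (f - g)"
  then show "reduce p f = reduce p g"
    by (intro poly_mapping_eqI) (simp add: cf_reduce cdvd_def lookup_minus mod_eq_dvd_iff)
qed

lemma cdvd_reduce: "cdvd p (reduce p f - f)"
  by (simp add: cdvd_def lookup_minus cf_reduce mod_eq_dvd_iff[symmetric])

lemma cdvd_reduce': "cdvd p (f - reduce p f)"
  by (simp add: cdvd_def lookup_minus cf_reduce mod_eq_dvd_iff[symmetric])

text \<open>The Radon kernel over \<open>\<int> / p\<close>, described by integral lifts.\<close>

definition radon_kernel_mod :: "int \<Rightarrow> 'g::group_add set \<Rightarrow> ('g \<Rightarrow>\<^sub>0 int) set" where
  "radon_kernel_mod p S = {f \<in> galg S. \<forall>C\<in>nontrivial_subgroups S. cdvd p (subgroup_sum C * f)}"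

lemma radon_kernel_mod_add:
  "f \<in> radon_kernel_mod p S \<Longrightarrow> g \<in> radon_kernel_mod p S \<Longrightarrow> f + g \<in> radon_kernel_mod p S"
  by (auto simp: radon_kernel_mod_def distrib_left intro: galg_add cdvd_add)

lemma radon_kernel_mod_uminus: "f \<in> radon_kernel_mod p S \<Longrightarrow> - f \<in> radon_kernel_mod p S"
  by (auto simp: radon_kernel_mod_def intro: galg_uminus)

lemma radon_kernel_mod_diff:
  "f \<in> radon_kernel_mod p S \<Longrightarrow> g \<in> radon_kernel_mod p S \<Longrightarrow> f - g \<in> radon_kernel_mod p S"
  using radon_kernel_mod_add[of f p S "- g"] radon_kernel_mod_uminus[of g p S] by simp

lemma radon_kernel_mod_zero: "0 \<in> radon_kernel_mod p S"
  by (simp add: radon_kernel_mod_def)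

lemma radon_kernel_mod_translate:
  assumes S: "fin_subgroup S" and x: "x \<in> S" and f: "f \<in> radon_kernel_mod p S"
  shows "sg x 1 * f \<in> radon_kernel_mod p S"
proof -
  have "cdvd p (subgroup_sum C * (sg x 1 * f))" if C: "C \<in> nontrivial_subgroups S" for C
  proof -
    have "subgroup_sum C * (sg x 1 * f) = (subgroup_sum C * sg x 1) * f" by (simp add: mult.assoc)
    also have "\<dots> = sg x 1 * (subgroup_sum ((\<lambda>t. - x + t - - x) ` C) * f)"
      unfolding subgroup_sum_sg by (simp add: mult.assoc)
    finally show ?thesis
      using f conjugate_nontrivial_subgroup[OF S fin_subgroupD(4)[OF S x] C]
      by (simp add: radon_kernel_mod_def cdvd_sg_mult)
  qed
  then show ?thesis using f x by (auto simp: radon_kernel_mod_def intro: galg_mult galg_sg S)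
qed

lemma radon_kernel_mod_reduce:
  assumes f: "f \<in> radon_kernel_mod p S" shows "reduce p f \<in> radon_kernel_mod p S"
proof -
  have "reduce p f \<in> galg S" using f by (auto simp: radon_kernel_mod_def galg_def cf_reduce) (metis mod_0)
  moreover have "cdvd p (subgroup_sum C * reduce p f)" if C: "C \<in> nontrivial_subgroups S" for C
  proof -
    have "subgroup_sum C * reduce p f = subgroup_sum C * (reduce p f - f) + subgroup_sum C * f"
      by (simp add: right_diff_distrib)
    then show ?thesis using f C by (simp add: radon_kernel_mod_def cdvd_add cdvd_mult_left cdvd_reduce)
  qed
  ultimately show ?thesis by (simp add: radon_kernel_mod_def)
qed

text \<open>The argument over the complex numbers carries over, as the order of the stabilizer
  \<open>C\<close> is less than \<open>p\<close> and therefore invertible modulo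
  \<open>p\<close>.\<close>

lemma radon_kernel_mod_fixed_point_free:
  assumes S: "fin_subgroup S" and p: "Factorial_Ring.prime (p::int)" "int (card S) < p"
    and f: "f \<in> radon_kernel_mod p S" and s: "s \<in> S" "s \<noteq> 0" "cdvd p (sg s 1 * f - f)"
  shows "cdvd p f"
proof -
  note S' = fin_subgroupD[OF S]
  define C where "C = {s \<in> S. cdvd p (sg s 1 * f - f)}"
  have C: "fin_subgroup C" unfolding fin_subgroup_def
  proof (intro conjI ballI)
    show "finite C" using S' by (simp add: C_def)
    show "0 \<in> C" using S' by (simp add: C_def)
    show "x + y \<in> C" if "x \<in> C" "y \<in> C" for x y
    proof -
      have eq: "sg (x + y) 1 * f - f = sg x 1 * (sg y 1 * f - f) + (sg x 1 * f - f)"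
        by (simp add: right_diff_distrib sg_mult_sg)
      have "cdvd p (sg (x + y) 1 * f - f)"
        unfolding eq by (intro cdvd_add cdvd_sg_mult) (use that in \<open>simp_all add: C_def\<close>)
      then show ?thesis using that S'(3) by (simp add: C_def)
    qed
    show "- x \<in> C" if "x \<in> C" for x
    proof -
      have "sg (- x) 1 * f - f = - (sg (- x) 1 * (sg x 1 * f - f))"
        by (simp add: right_diff_distrib sg_mult_sg)
      moreover have "cdvd p (- (sg (- x) 1 * (sg x 1 * f - f)))"
        using that unfolding cdvd_uminus by (auto simp: C_def intro!: cdvd_sg_mult)
      ultimately show ?thesis using that S'(4) by (simp add: C_def)
    qed
  qed
  have "s \<in> C" using s by (simp add: C_def)
  then have "C \<in> nontrivial_subgroups S" using s(2) C by (auto simp: nontrivial_subgroups_def C_def)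
  then have "cdvd p (subgroup_sum C * f)" using f by (simp add: radon_kernel_mod_def)
  moreover have "cdvd p (subgroup_sum C * f - of_nat (card C) * f)"
  proof -
    have "subgroup_sum C * f - of_nat (card C) * f = (\<Sum>t\<in>C. sg t 1 * f - f)"
      by (simp add: subgroup_sum_def sum_distrib_right sum_subtractf)
    also have "cdvd p \<dots>" by (rule cdvd_sum) (simp add: C_def)
    finally show ?thesis .
  qed
  ultimately have "cdvd p (subgroup_sum C * f - (subgroup_sum C * f - of_nat (card C) * f))"
    by (rule cdvd_diff)
  then have dv: "p dvd int (card C) * cf f x" for x by (simp add: cdvd_def)
  have "card C \<le> card S" by (rule card_mono) (use S' in \<open>auto simp: C_def\<close>)
  then have "\<not> p dvd int (card C)"
    using p(2) fin_subgroup_card_pos[OF C] by (auto dest!: zdvd_imp_le)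
  then show ?thesis using dv p(1) by (auto simp: cdvd_def prime_dvd_mult_iff)
qed

text \<open>Let \<open>M\<close> be the Radon kernel modulo a prime \<open>p\<close>. An affine
  map \<open>m \<mapsto> x m + c\<close> of \<open>M\<close> with two fixed points has a linear part
  \<open>x\<close> that fixes their nonzero difference, so \<open>x\<close> is the identity and the
  map is a translation with a fixed point, hence the identity. The translations make the group of
  affine maps transitive. Since Frobenius complements are defined by permutations of natural
  numbers, \<open>M\<close> is numbered by \<open>\<beta>\<close>.\<close>

theorem (in group_embedding) frobenius_complement_of_not_radon_injective:
  assumes ninj: "\<not> radon_injective G" and nt: "carrier G \<noteq> {\<one>}"
  shows "frobenius_complement G"
proof -
  note finS = fin_subgroup_S
  note S' = fin_subgroupD[OF finS]
  have "\<exists>h\<in>radon_kernel S. h \<noteq> (0 :: 'g \<Rightarrow>\<^sub>0 complex)" using ninj radon_injective_iff by blast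
  then obtain h :: "'g \<Rightarrow>\<^sub>0 int" where h: "h \<in> radon_kernel S" "h \<noteq> 0"
    unfolding radon_kernel_complex_iff_int[OF finS] by blast
  \<comment> \<open>A prime larger than \<open>B\<close> exceeds the orders of all subgroups of
    \<open>S\<close> and all coefficients of \<open>h\<close>, so \<open>h\<close> stays nonzero
    modulo \<open>p\<close>.\<close>
  define B where "B = int (card S) + (\<Sum>x\<in>S. \<bar>cf h x\<bar>)"
  obtain q where q: "Factorial_Ring.prime (q::nat)" "nat B < q" using bigger_prime by blast
  define p where "p = int q"
  have p: "Factorial_Ring.prime p" "B < p" using q by (auto simp: p_def)
  have p0: "0 < p" using q(1) prime_gt_0_nat by (simp add: p_def)
  have pS: "int (card S) < p"
  proof -
    have "0 \<le> (\<Sum>x\<in>S. \<bar>cf h x\<bar>)" by (rule sum_nonneg) simp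
    then show ?thesis using p(2) unfolding B_def by linarith
  qed
  define Q where "Q = radon_kernel_mod p S"
  \<comment> \<open>Reduced representatives make the kernel modulo \<open>p\<close> a finite
    set.\<close>
  define M where "M = {m \<in> Q. \<forall>x. 0 \<le> cf m x \<and> cf m x < p}"
  have red_M: "reduce p f \<in> M" if "f \<in> Q" for f
    using radon_kernel_mod_reduce[of f p S] that p0 by (simp add: M_def Q_def cf_reduce)
  have red_id: "reduce p m = m" if "m \<in> M" for m
    using that by (intro poly_mapping_eqI) (simp add: cf_reduce M_def)
  have M_eq: "m = m'" if "m \<in> M" "m' \<in> M" "cdvd p (m - m')" for m m'
    using that reduce_eq_iff[of p m m'] red_id by simp
  have MQ: "m \<in> Q" if "m \<in> M" for m using that by (simp add: M_def)
  note Q_closed = radon_kernel_mod_add[of _ p S, folded Q_def] radon_kernel_mod_uminus[of _ p S, folded Q_def]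
    radon_kernel_mod_diff[of _ p S, folded Q_def] radon_kernel_mod_translate[OF finS, of _ _ p, folded Q_def]
  have zM: "0 \<in> M" using radon_kernel_mod_zero[of p S] p0 by (simp add: M_def Q_def)
  have Q_fpf: "cdvd p f" if "f \<in> Q" "s \<in> S" "s \<noteq> 0" "cdvd p (sg s 1 * f - f)" for f s
    using radon_kernel_mod_fixed_point_free[OF finS p(1) pS] that by (simp add: Q_def)
  have finM: "finite M"
  proof (rule finite_subset)
    show "M \<subseteq> (\<lambda>g. \<Sum>x\<in>S. sg x (g x)) ` (S \<rightarrow>\<^sub>E {0..<p})"
    proof
      fix m assume m: "m \<in> M"
      then have "m \<in> galg S" by (simp add: M_def Q_def radon_kernel_mod_def)
      from galg_expand[OF this S'(1)]
      have "m = (\<Sum>x\<in>S. sg x (restrict (cf m) S x))" by simp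
      moreover have "restrict (cf m) S \<in> S \<rightarrow>\<^sub>E {0..<p}" using m by (auto simp: M_def)
      ultimately show "m \<in> (\<lambda>g. \<Sum>x\<in>S. sg x (g x)) ` (S \<rightarrow>\<^sub>E {0..<p})" by (rule image_eqI)
    qed
    show "finite ((\<lambda>g. \<Sum>x\<in>S. sg x (g x)) ` (S \<rightarrow>\<^sub>E {0..<p}))"
      by (intro finite_imageI finite_PiE S') simp
  qed
  have hQ: "h \<in> Q" using h(1) by (auto simp: Q_def radon_kernel_mod_def radon_kernel_def)
  define m0 where "m0 = reduce p h"
  have m0: "m0 \<in> M" unfolding m0_def by (rule red_M[OF hQ])
  have m0_nz: "\<not> cdvd p m0"
  proof
    assume "cdvd p m0"
    then have "m0 = 0" using M_eq[OF m0 zM] by simp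
    then have dv: "p dvd cf h x" for x using cf_reduce[of p h x] by (simp add: m0_def dvd_eq_mod_eq_0)
    obtain x where x: "cf h x \<noteq> 0" using nonzero_cf[OF h(2)] by (elim exE)
    then have "x \<in> S" using h(1) galgD[of h S x] by (auto simp: radon_kernel_def)
    then have "\<bar>cf h x\<bar> \<le> (\<Sum>x\<in>S. \<bar>cf h x\<bar>)" by (intro member_le_sum S') auto
    then have "\<bar>cf h x\<bar> < p" using p(2) by (simp add: B_def)
    then show False using dvd_imp_le_int[OF x dv] p0 by simp
  qed
  obtain \<beta> :: "('g \<Rightarrow>\<^sub>0 int) \<Rightarrow> nat" and n where \<beta>: "bij_betw \<beta> M {0..<n}"
    using ex_bij_betw_finite_nat[OF finM] by blast
  define X where "X = {0..<n}"
  define \<delta> where "\<delta> = inv_into M \<beta>"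
  have \<beta>X: "\<beta> m \<in> X" and \<delta>\<beta>: "\<delta> (\<beta> m) = m" if "m \<in> M" for m
    using that \<beta> by (auto simp: X_def \<delta>_def bij_betw_inv_into_left bij_betw_def)
  have \<delta>M: "\<delta> k \<in> M" and \<beta>\<delta>: "\<beta> (\<delta> k) = k" if "k \<in> X" for k
    using that \<beta> bij_betw_inv_into[OF \<beta>] bij_betw_inv_into_right[OF \<beta>]
    by (auto simp: X_def \<delta>_def bij_betw_def)
  define act where "act x c m = reduce p (sg x 1 * m + c)" for x and c m :: "'g \<Rightarrow>\<^sub>0 int"
  have act_M: "act x c m \<in> M" if "x \<in> S" "c \<in> M" "m \<in> M" for x c m
    unfolding act_def using that by (intro red_M Q_closed MQ)
  have act_act: "act x c (act y d m) = act (x + y) (reduce p (sg x 1 * d + c)) m" for x y c d m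
  proof -
    let ?u = "sg y 1 * m + d" and ?w = "sg x 1 * d + c"
    have "sg x 1 * reduce p ?u + c - (sg (x + y) 1 * m + reduce p ?w)
        = sg x 1 * (reduce p ?u - ?u) + (?w - reduce p ?w)"
      by (simp add: right_diff_distrib distrib_left sg_mult_sg)
    moreover have "cdvd p \<dots>" by (intro cdvd_add cdvd_sg_mult cdvd_reduce cdvd_reduce')
    ultimately show ?thesis unfolding act_def reduce_eq_iff by (simp only:)
  qed
  have act_id: "act 0 0 m = m" if "m \<in> M" for m using that by (simp add: act_def red_id)
  \<comment> \<open>The affine map \<open>m \<mapsto> x m + c\<close>, transported to
    numbers.\<close>
  define T where "T x c = (\<lambda>k\<in>X. \<beta> (act x c (\<delta> k)))" for x c
  have T_\<beta>: "T x c (\<beta> m) = \<beta> (act x c m)" if "m \<in> M" for x c m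
    using that by (simp add: T_def \<beta>X \<delta>\<beta>)
  have T_X: "T x c k \<in> X" if "x \<in> S" "c \<in> M" "k \<in> X" for x c k
    using that by (simp add: T_def \<beta>X act_M \<delta>M)
  have T_T: "T x c (T y d k) = T (x + y) (reduce p (sg x 1 * d + c)) k"
    if "x \<in> S" "c \<in> M" "y \<in> S" "d \<in> M" "k \<in> X" for x c y d k
    using that by (simp add: T_def \<beta>X act_M \<delta>M \<delta>\<beta> act_act)
  have T_id: "T 0 0 k = k" if "k \<in> X" for k using that by (simp add: T_def act_id \<delta>M \<beta>\<delta>)
  \<comment> \<open>The translation part of the inverse of the affine map with parts
    \<open>x\<close> and \<open>c\<close>.\<close>
  define c' where "c' x c = reduce p (- (sg (- x) 1 * c))" for x and c :: "'g \<Rightarrow>\<^sub>0 int"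
  have c'M: "c' x c \<in> M" if "x \<in> S" "c \<in> M" for x c
    unfolding c'_def using that by (intro red_M Q_closed MQ S')
  have red_0: "reduce p f = 0" if "cdvd p f" for f :: "'g \<Rightarrow>\<^sub>0 int"
    using that reduce_eq_iff[of p f 0] red_id[OF zM] by simp
  have inv1: "T (- x) (c' x c) (T x c k) = k" if "x \<in> S" "c \<in> M" "k \<in> X" for x c k
  proof -
    have "sg (- x) 1 * c + c' x c = reduce p (- (sg (- x) 1 * c)) - (- (sg (- x) 1 * c))" by (simp add: c'_def)
    then have "reduce p (sg (- x) 1 * c + c' x c) = 0" using red_0 cdvd_reduce by metis
    then show ?thesis using T_T[of "- x" "c' x c" x c k] that c'M S'(4) T_id by simp
  qed
  have inv2: "T x c (T (- x) (c' x c) k) = k" if "x \<in> S" "c \<in> M" "k \<in> X" for x c k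
  proof -
    have "sg x 1 * c' x c + c = sg x 1 * (reduce p (- (sg (- x) 1 * c)) - (- (sg (- x) 1 * c)))"
      by (simp add: c'_def distrib_left sg_mult_sg)
    then have "reduce p (sg x 1 * c' x c + c) = 0" using red_0 cdvd_reduce cdvd_sg_mult by metis
    then show ?thesis using T_T[of x c "- x" "c' x c" k] that c'M S'(4) T_id by simp
  qed
  have T_Bij: "T x c \<in> Bij X" if "x \<in> S" "c \<in> M" for x c
  proof -
    have "bij_betw (T x c) X X"
      by (rule bij_betw_byWitness[where f' = "T (- x) (c' x c)"])
        (use that inv1 inv2 T_X c'M S'(4) in auto)
    then show ?thesis by (simp add: Bij_def T_def)
  qed
  have T_ext: "f = T x c" if "f \<in> extensional X" "\<And>k. k \<in> X \<Longrightarrow> f k = T x c k" for f x c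
    by (rule extensionalityI[of _ X]) (use that in \<open>auto simp: T_def\<close>)
  have T_compose: "T x c \<otimes>\<^bsub>BijGroup X\<^esub> T y d = T (x + y) (reduce p (sg x 1 * d + c))"
    if "x \<in> S" "c \<in> M" "y \<in> S" "d \<in> M" for x c y d
  proof -
    have "T x c \<otimes>\<^bsub>BijGroup X\<^esub> T y d = compose X (T x c) (T y d)"
      using that by (simp add: BijGroup_def T_Bij)
    also have "\<dots> = T (x + y) (reduce p (sg x 1 * d + c))"
      by (rule T_ext) (use that in \<open>auto simp: compose_eq T_T\<close>)
    finally show ?thesis .
  qed
  have T_one: "T 0 0 = \<one>\<^bsub>BijGroup X\<^esub>"
    by (rule T_ext[symmetric]) (auto simp: BijGroup_def T_id)
  have add_M: "reduce p (sg x 1 * d + c) \<in> M" if "x \<in> S" "c \<in> M" "d \<in> M" for x c d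
    using that by (intro red_M Q_closed MQ)
  define H where "H = {T x c | x c. x \<in> S \<and> c \<in> M}"
  have HI: "T x c \<in> H" if "x \<in> S" "c \<in> M" for x c using that by (auto simp: H_def)
  interpret BG: group "BijGroup X" by (rule group_BijGroup)
  have sub: "subgroup H (BijGroup X)"
  proof (rule BG.subgroupI)
    show "H \<subseteq> carrier (BijGroup X)" using T_Bij by (auto simp: H_def BijGroup_def)
    show "H \<noteq> {}" using HI[OF S'(2) zM] by blast
    fix f assume "f \<in> H"
    then obtain x c where f: "x \<in> S" "c \<in> M" "f = T x c" by (auto simp: H_def)
    have "T (- x) (c' x c) \<otimes>\<^bsub>BijGroup X\<^esub> T x c = compose X (T (- x) (c' x c)) (T x c)"
      using f c'M S'(4) by (simp add: BijGroup_def T_Bij)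
    also have "\<dots> = T 0 0"
      by (rule T_ext) (use f in \<open>auto simp: compose_eq inv1 T_id\<close>)
    finally have "inv\<^bsub>BijGroup X\<^esub> f = T (- x) (c' x c)"
      using T_one f c'M S'(4) T_Bij by (intro BG.inv_equality) (simp_all add: BijGroup_def[of X])
    then show "inv\<^bsub>BijGroup X\<^esub> f \<in> H" using HI[OF S'(4)[OF f(1)] c'M[OF f(1,2)]] by simp
    fix g assume "g \<in> H"
    then obtain y d where g: "y \<in> S" "d \<in> M" "g = T y d" by (auto simp: H_def)
    show "f \<otimes>\<^bsub>BijGroup X\<^esub> g \<in> H"
      unfolding f(3) g(3) T_compose[OF f(1,2) g(1,2)] by (intro HI S' add_M f g)
  qed
  define BH where "BH = (BijGroup X)\<lparr>carrier := H\<rparr>"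
  have grpBH: "group BH" unfolding BH_def by (rule BG.subgroup_imp_group[OF sub])
  have trans: "transitive_action BH X (\<lambda>h. h)"
  proof (intro transitive_action.intro transitive_action_axioms.intro group_action.intro)
    show "group_hom BH (BijGroup X) (\<lambda>h. h)"
    proof (intro group_hom.intro group_hom_axioms.intro grpBH group_BijGroup homI)
      show "f \<in> carrier (BijGroup X)" if "f \<in> carrier BH" for f
        using subgroup.subset[OF sub] that by (auto simp: BH_def)
    qed (simp add: BH_def)
    fix k l assume kl: "k \<in> X" "l \<in> X"
    define c where "c = reduce p (\<delta> l - \<delta> k)"
    have cM: "c \<in> M" unfolding c_def by (intro red_M Q_closed MQ \<delta>M kl)
    have "reduce p (\<delta> k + c) = reduce p (\<delta> l)"
      unfolding reduce_eq_iff c_def using cdvd_reduce[of p "\<delta> l - \<delta> k"] by (simp add: algebra_simps)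
    then have "act 0 c (\<delta> k) = \<delta> l" using red_id[OF \<delta>M[OF kl(2)]] by (simp add: act_def)
    then have "T 0 c k = l" using kl by (simp add: T_def \<beta>\<delta>)
    then show "\<exists>g\<in>carrier BH. g k = l" using HI[OF S'(2) cM] by (auto simp: BH_def)
  qed
  have T_fixes: "cdvd p (sg x 1 * m + c - m)" if "m \<in> M" "T x c (\<beta> m) = \<beta> m" "x \<in> S" "c \<in> M" for x c m
  proof -
    have "act x c m = m" using that \<delta>\<beta>[of "act x c m"] \<delta>\<beta>[of m] act_M[of x c m] by (simp add: T_\<beta>)
    then have "reduce p (sg x 1 * m + c) = reduce p m" using red_id[OF that(1)] by (simp add: act_def)
    then show ?thesis by (simp add: reduce_eq_iff)
  qed
  have frob: "frobenius_perm_group X H" unfolding frobenius_perm_group_def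
  proof (intro conjI)
    show "finite X" by (simp add: X_def)
    show "subgroup H (BijGroup X)" by (rule sub)
    show "transitive_action (BijGroup X\<lparr>carrier := H\<rparr>) X (\<lambda>h. h)" using trans by (simp add: BH_def)
    show "\<forall>f\<in>H. f \<noteq> \<one>\<^bsub>BijGroup X\<^esub> \<longrightarrow> (\<forall>k\<in>X. \<forall>l\<in>X. f k = k \<and> f l = l \<longrightarrow> k = l)"
    proof (intro ballI impI, elim conjE)
      fix f k l assume fH: "f \<in> H" and f1: "f \<noteq> \<one>\<^bsub>BijGroup X\<^esub>" and k: "k \<in> X" "f k = k" and l: "l \<in> X" "f l = l"
      obtain x c where f: "x \<in> S" "c \<in> M" "f = T x c" using fH by (auto simp: H_def)
      have dk: "cdvd p (sg x 1 * \<delta> k + c - \<delta> k)" and dl: "cdvd p (sg x 1 * \<delta> l + c - \<delta> l)"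
        using T_fixes[of "\<delta> k" x c] T_fixes[of "\<delta> l" x c] k l f \<delta>M \<beta>\<delta> by auto
      show "k = l"
      proof (cases "x = 0")
        case True
        then have "cdvd p c" using dk by simp
        then have "c = 0" using M_eq[OF f(2) zM] by simp
        then show ?thesis using f(3) True T_one f1 by simp
      next
        case False
        have eq: "sg x 1 * (\<delta> k - \<delta> l) - (\<delta> k - \<delta> l) = (sg x 1 * \<delta> k + c - \<delta> k) - (sg x 1 * \<delta> l + c - \<delta> l)"
          by (simp add: right_diff_distrib)
        have "cdvd p (sg x 1 * (\<delta> k - \<delta> l) - (\<delta> k - \<delta> l))" unfolding eq by (rule cdvd_diff[OF dk dl])
        then have "cdvd p (\<delta> k - \<delta> l)"
          using Q_fpf[OF Q_closed(3)[OF MQ[OF \<delta>M[OF k(1)]] MQ[OF \<delta>M[OF l(1)]]] f(1) False] by simp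
        then have "\<delta> k = \<delta> l" by (rule M_eq[OF \<delta>M[OF k(1)] \<delta>M[OF l(1)]])
        then have "\<beta> (\<delta> k) = \<beta> (\<delta> l)" by (rule arg_cong)
        then show ?thesis by (simp only: \<beta>\<delta>[OF k(1)] \<beta>\<delta>[OF l(1)])
      qed
    qed
    obtain g where g: "g \<in> carrier G" "g \<noteq> \<one>" using nt one_closed by blast
    have xS: "\<iota> g \<in> S" "\<iota> g \<noteq> 0" using g emb_eq_0_iff by auto
    have "T (\<iota> g) 0 \<noteq> \<one>\<^bsub>BijGroup X\<^esub>"
    proof
      assume e: "T (\<iota> g) 0 = \<one>\<^bsub>BijGroup X\<^esub>"
      then have "T (\<iota> g) 0 (\<beta> m0) = \<beta> m0" using T_one T_id[OF \<beta>X[OF m0]] by simp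
      from T_fixes[OF m0 this xS(1) zM] show False using Q_fpf[OF MQ[OF m0] xS] m0_nz by simp
    qed
    moreover have "T (\<iota> g) 0 (\<beta> 0) = \<beta> 0"
      by (simp add: T_\<beta>[OF zM] act_def red_id[OF zM])
    ultimately show "\<exists>f\<in>H. f \<noteq> \<one>\<^bsub>BijGroup X\<^esub> \<and> (\<exists>x\<in>X. f x = x)"
      using HI[OF xS(1) zM] \<beta>X[OF zM] by blast
  qed
  define St where "St = stabilizer BH (\<lambda>h. h) (\<beta> 0)"
  have St: "St = {T x 0 | x. x \<in> S}"
  proof
    show "{T x 0 | x. x \<in> S} \<subseteq> St"
      using HI zM by (auto simp: St_def stabilizer_def BH_def T_\<beta> act_def red_id)
    show "St \<subseteq> {T x 0 | x. x \<in> S}"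
    proof
      fix f assume "f \<in> St"
      then have "f \<in> H" "f (\<beta> 0) = \<beta> 0" by (auto simp: St_def stabilizer_def BH_def)
      then obtain x c where f: "x \<in> S" "c \<in> M" "f = T x c" by (auto simp: H_def)
      have "cdvd p c" using T_fixes[OF zM _ f(1,2)] \<open>f (\<beta> 0) = \<beta> 0\<close> f(3) by simp
      then have "c = 0" using M_eq[OF f(2) zM] by simp
      then show "f \<in> {T x 0 | x. x \<in> S}" using f by blast
    qed
  qed
  define \<theta> where "\<theta> g = T (\<iota> g) 0" for g
  have "\<theta> \<in> iso G (BijGroup X\<lparr>carrier := St\<rparr>)"
    unfolding iso_iff
  proof (intro conjI)
    show "\<theta> \<in> hom G (BijGroup X\<lparr>carrier := St\<rparr>)"
    proof (rule homI)
      show "\<theta> x \<in> carrier (BijGroup X\<lparr>carrier := St\<rparr>)" if "x \<in> carrier G" for x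
        using that by (auto simp: St \<theta>_def)
      show "\<theta> (x \<otimes> y) = \<theta> x \<otimes>\<^bsub>BijGroup X\<lparr>carrier := St\<rparr>\<^esub> \<theta> y" if "x \<in> carrier G" "y \<in> carrier G" for x y
        using that T_compose[of "\<iota> x" 0 "\<iota> y" 0] zM by (simp add: \<theta>_def emb_mult red_id)
    qed
    show "\<theta> ` carrier G = carrier (BijGroup X\<lparr>carrier := St\<rparr>)" by (auto simp: St \<theta>_def)
    show "inj_on \<theta> (carrier G)"
    proof (rule inj_onI)
      fix g g' assume gg: "g \<in> carrier G" "g' \<in> carrier G" "\<theta> g = \<theta> g'"
      have "\<beta> (act (\<iota> g) 0 m0) = \<beta> (act (\<iota> g') 0 m0)"
        using gg(3) T_\<beta>[OF m0] by (metis \<theta>_def)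
      then have "act (\<iota> g) 0 m0 = act (\<iota> g') 0 m0"
        using \<delta>\<beta> act_M zM m0 gg by (metis imageI)
      then have "cdvd p (sg (\<iota> g) 1 * m0 - sg (\<iota> g') 1 * m0)" by (simp add: act_def reduce_eq_iff)
      then have "cdvd p (sg (- \<iota> g') 1 * (sg (\<iota> g) 1 * m0 - sg (\<iota> g') 1 * m0))" by (rule cdvd_sg_mult)
      then have "cdvd p (sg (- \<iota> g' + \<iota> g) 1 * m0 - m0)" by (simp add: right_diff_distrib sg_mult_sg)
      moreover have "- \<iota> g' + \<iota> g \<in> S" using gg by (intro S') auto
      ultimately have "- \<iota> g' + \<iota> g = 0" using Q_fpf[OF MQ[OF m0]] m0_nz by blast
      then have "\<iota> g = \<iota> g'" using add_eq_0_iff[of "- \<iota> g'" "\<iota> g"] by simp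
      then show "g = g'" using emb_eq_iff gg by simp
    qed
  qed
  then have "G \<cong> BijGroup X\<lparr>carrier := St\<rparr>" by (rule is_isoI)
  then show ?thesis unfolding frobenius_complement_def
    using frob \<beta>X[OF zM] by (intro exI[of _ X] exI[of _ H] conjI bexI[of _ "\<beta> 0"]) (simp_all add: St_def BH_def)
qed

theorem theorem6p9:
  fixes G (structure) and Gh :: "('a \<Rightarrow> complex mat) set"
  assumes "group G" and "finite (carrier G)" and "carrier G \<noteq> {\<one>}"
    and "unitary_dual G Gh"
  shows "(radon_injective G \<longleftrightarrow> (\<forall>\<rho> \<in> Gh. k_space G \<rho> = {0\<^sub>v (deg G \<rho>)})) \<and>
    ((\<forall>\<rho> \<in> Gh. k_space G \<rho> = {0\<^sub>v (deg G \<rho>)}) \<longleftrightarrow> FPF G Gh = {}) \<and>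
    (FPF G Gh = {} \<longleftrightarrow> \<not> frobenius_complement G)"
proof -
  obtain \<iota> :: "'a \<Rightarrow> nat_perm" where "group_embedding G \<iota>"
    using group_embedding_exists[OF assms(1,2)] .
  then interpret group_embedding G \<iota> .
  have rep: "representation G \<rho>" "deg G \<rho> \<noteq> 0" if "\<rho> \<in> Gh" for \<rho>
    using assms(4) that unfolding unitary_dual_def irreducible_rep_def by blast+
  have inj_k: "k_space G \<rho> = {0\<^sub>v (deg G \<rho>)}" if "radon_injective G" "\<rho> \<in> Gh" for \<rho>
    using k_space_not_radon_injective[OF assms(2) rep(1)[OF that(2)]] that(1) by blast
  have k_FPF: "FPF G Gh = {}" if "\<forall>\<rho> \<in> Gh. k_space G \<rho> = {0\<^sub>v (deg G \<rho>)}"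
    using fixed_point_free_k_space rep that unfolding FPF_def by blast
  have FPF_inj: "radon_injective G" if "FPF G Gh = {}"
    using FPF_nonempty[OF _ assms(3,4)] that by blast
  have inj_compl: "radon_injective G \<longleftrightarrow> \<not> frobenius_complement G"
    using frobenius_complement_not_radon_injective[OF assms(1-3)]
      frobenius_complement_of_not_radon_injective assms(3) by blast
  show ?thesis using inj_k k_FPF FPF_inj inj_compl by blast
qed

end
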